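(* Let $\mathcal P$ be a key distillation protocol with rate $R_{\mathcal P}$ for $\rho_{ABE}\otimes\tau^\ell$, where $\tau^\ell$ is some additional $\ell$-bit key shared by Alice and Bob. Then there exists another protocol $\mathcal P'$ for $\rho_{ABE}$ with rate $R_{\mathcal P'}\ge R_{\mathcal P}-\ell$.
   Context: Hilbert spaces are finite-dimensional. A tripartite state $\rho_{ABE}$ is a density operator on $\mathcal H_A\otimes\mathcal H_B\otimes\mathcal H_E$, held by Alice, Bob and the adversary Eve. The perfect $\ell$-bit key is $\tau^\ell=\tau^\ell_{ABE}:=\frac1{2^\ell}\sum_{i=1}^{2^\ell}|ii\rangle\langle ii|_{AB}\otimes\tau_E$ for some arbitrary state $\tau_E$. In $\rho_{ABE}\otimes\tau^\ell$ each party additionally holds its part of $\tau^\ell$. Distance: $\|\rho-\sigma\|:=\frac12\mathrm{Tr}|\rho-\sigma|$. LOPC operation: a concatenation of finitely many steps, each being either (i) a local quantum operation of Bob, $\rho_{ABE}\mapsto(I_{AE}\otimes\Lambda_B)(\rho_{ABE})$ with $\Lambda_B$ completely positive trace preserving (CPTP), or the analogue for Alice; or (ii) public classical communication from Alice to Bob: a state $\sum_i\rho^i_{ABE}\otimes|i\rangle\langle i|_{A'}$ ($A'$ a classical register of Alice) is transformed into $\sum_i\rho^i_{ABE}\otimes|iii\rangle\langle iii|_{A'B'E'}$, or the analogue from Bob to Alice. LOPC protocol: a family $\mathcal P=\{\Lambda_n\}_{n\in\mathbb N}$ of CPTP maps $\Lambda_n:(\mathcal H_A\otimes\mathcal H_B\otimes\mathcal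 H_E)^{\otimes n}\to\mathcal H_A^n\otimes\mathcal H_B^n\otimes\mathcal H_E^n$, each an LOPC operation. $\mathcal P$ is a key distillation protocol for a state $\rho_{ABE}$ with rate $R_{\mathcal P}$ if there is a sequence $\{\ell_n\}$ with $\limsup_{n\to\infty}\ell_n/n=R_{\mathcal P}$ and $\lim_{n\to\infty}\|\Lambda_n(\rho_{ABE}^{\otimes n})-\tau^{\ell_n}_{ABE}\|=0$; here $n$ counts the copies of the whole input state, so a protocol for $\rho_{ABE}\otimes\tau^\ell$ acts on $(\rho_{ABE}\otimes\tau^\ell)^{\otimes n}$. *)

theory Defs
  imports
    "HOL-Analysis.Analysis"
    "Jordan_Normal_Form.Matrix"
    "Jordan_Normal_Form.Conjugate"
    "Jordan_Normal_Form.Schur_Decomposition"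
begin

text \<open>Operators on a Hilbert space of dimension \<open>n\<close> are the matrices in
  \<^term>\<open>carrier_mat n n\<close>, with respect to a fixed orthonormal (computational) basis.\<close>

section \<open>States and trace distance\<close>

definition mat_trace :: "complex mat \<Rightarrow> complex" where
  "mat_trace X = (\<Sum>i<dim_row X. X $$ (i, i))"

text \<open>The order on \<^typ>\<open>complex\<close> is the one of \<^theory>\<open>HOL-Library.Complex_Order\<close>:
  \<open>0 \<le> z\<close> says that \<open>z\<close> is real and nonnegative.  In particular positive operators are
  self-adjoint.\<close>

definition positive_op :: "nat \<Rightarrow> complex mat \<Rightarrow> bool" where
  "positive_op n X \<longleftrightarrow>
     X \<in> carrier_mat n n \<and> (\<forall>v\<in>carrier_vec n. 0 \<le> (X *\<^sub>v v) \<bullet>c v)"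

definition density_op :: "nat \<Rightarrow> complex mat \<Rightarrow> bool" where
  "density_op n X \<longleftrightarrow> positive_op n X \<and> mat_trace X = 1"

text \<open>\<open>|X|\<close> is the positive square root of \<open>X\<^sup>* X\<close>; it exists and is unique for
  every square matrix.\<close>

definition op_abs :: "complex mat \<Rightarrow> complex mat" where
  "op_abs X = (THE P. positive_op (dim_col X) P \<and> P * P = mat_adjoint X * X)"

definition trace_dist :: "complex mat \<Rightarrow> complex mat \<Rightarrow> real" where
  "trace_dist \<rho> \<sigma> = Re (mat_trace (op_abs (\<rho> - \<sigma>))) / 2"


section \<open>Tripartite systems\<close>

text \<open>The triple \<open>(dA, dB, dE)\<close> holds the dimensions of the systems of Alice, Bob and
  Eve.  The basis vector \<open>|a\<rangle>|b\<rangle>|e\<rangle>\<close> of the joint space is numbered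
  \<open>(a * dB + b) * dE + e\<close>.\<close>

type_synonym dims = "nat \<times> nat \<times> nat"

fun total_dim :: "dims \<Rightarrow> nat" where
  "total_dim (dA, dB, dE) = dA * dB * dE"

fun index_of :: "dims \<Rightarrow> nat \<times> nat \<times> nat \<Rightarrow> nat" where
  "index_of (dA, dB, dE) (a, b, e) = (a * dB + b) * dE + e"

fun triple_of :: "dims \<Rightarrow> nat \<Rightarrow> nat \<times> nat \<times> nat" where
  "triple_of (dA, dB, dE) i = (i div dE div dB, i div dE mod dB, i mod dE)"

definition tri_entry ::
    "dims \<Rightarrow> complex mat \<Rightarrow> nat \<times> nat \<times> nat \<Rightarrow> nat \<times> nat \<times> nat \<Rightarrow> complex" where
  "tri_entry D X s t = X $$ (index_of D s, index_of D t)"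

definition tri_mat ::
    "dims \<Rightarrow> (nat \<times> nat \<times> nat \<Rightarrow> nat \<times> nat \<times> nat \<Rightarrow> complex) \<Rightarrow> complex mat" where
  "tri_mat D f =
     mat (total_dim D) (total_dim D) (\<lambda>(i, j). f (triple_of D i) (triple_of D j))"

fun dims_mult :: "dims \<Rightarrow> dims \<Rightarrow> dims" where
  "dims_mult (dA, dB, dE) (dA', dB', dE') = (dA * dA', dB * dB', dE * dE')"

text \<open>Tensor product of two tripartite operators, regrouped so that the two systems of each
  party form one system.  A pair of basis vectors \<open>|x\<rangle>|x'\<rangle>\<close> of a party is numbered
  \<open>x * d' + x'\<close>, where \<open>d'\<close> is the dimension of the second system.\<close>

fun tri_tensor :: "dims \<Rightarrow> dims \<Rightarrow> complex mat \<Rightarrow> complex mat \<Rightarrow> complex mat" where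
  "tri_tensor (dA, dB, dE) (dA', dB', dE') X Y =
     tri_mat (dA * dA', dB * dB', dE * dE') (\<lambda>(a1, b1, e1) (a2, b2, e2).
       tri_entry (dA, dB, dE) X
         (a1 div dA', b1 div dB', e1 div dE') (a2 div dA', b2 div dB', e2 div dE') *
       tri_entry (dA', dB', dE') Y
         (a1 mod dA', b1 mod dB', e1 mod dE') (a2 mod dA', b2 mod dB', e2 mod dE'))"

primrec dims_power :: "dims \<Rightarrow> nat \<Rightarrow> dims" where
  "dims_power D 0 = (1, 1, 1)"
| "dims_power D (Suc n) = dims_mult (dims_power D n) D"

primrec tri_power :: "dims \<Rightarrow> complex mat \<Rightarrow> nat \<Rightarrow> complex mat" where
  "tri_power D X 0 = 1\<^sub>m 1"
| "tri_power D X (Suc n) = tri_tensor (dims_power D n) D (tri_power D X n) X"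

text \<open>The matrix of \<open>2\<^sup>-\<^sup>l (\<Sum>i. |ii\<rangle>\<langle>ii|) \<otimes> \<tau>E\<close>, where \<open>i\<close> ranges over \<open>2\<^sup>l\<close> basis
  vectors and \<open>\<tau>E\<close> is a state of a system of dimension \<open>dE\<close>.\<close>

definition key_dims :: "nat \<Rightarrow> nat \<Rightarrow> dims" where
  "key_dims l dE = (2 ^ l, 2 ^ l, dE)"

definition perfect_key :: "nat \<Rightarrow> nat \<Rightarrow> complex mat \<Rightarrow> complex mat" where
  "perfect_key l dE \<tau>E = tri_mat (key_dims l dE) (\<lambda>(a1, b1, e1) (a2, b2, e2).
     if a1 = b1 \<and> a2 = b2 \<and> a1 = a2 then \<tau>E $$ (e1, e2) / 2 ^ l else 0)"


section \<open>LOPC operations\<close>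

text \<open>The operators \<open>\<Lambda> \<otimes> I\<^sub>B\<^sub>E\<close> and \<open>I\<^sub>A\<^sub>E \<otimes> \<Lambda>\<close> for a linear map \<open>\<Lambda>\<close> on the operators
  on Alice's, respectively Bob's, system; \<open>\<Lambda>\<close> is applied to every block obtained by fixing
  the row and column indices of the other parties.  The number \<open>d'\<close> is the output dimension
  of \<open>\<Lambda>\<close>.\<close>

fun alice_local ::
    "dims \<Rightarrow> nat \<Rightarrow> (complex mat \<Rightarrow> complex mat) \<Rightarrow> complex mat \<Rightarrow> complex mat" where
  "alice_local (dA, dB, dE) d' \<Lambda> X = tri_mat (d', dB, dE) (\<lambda>(a1, b1, e1) (a2, b2, e2).
     \<Lambda> (mat dA dA (\<lambda>(x, y). tri_entry (dA, dB, dE) X (x, b1, e1) (y, b2, e2))) $$ (a1, a2))"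

fun bob_local ::
    "dims \<Rightarrow> nat \<Rightarrow> (complex mat \<Rightarrow> complex mat) \<Rightarrow> complex mat \<Rightarrow> complex mat" where
  "bob_local (dA, dB, dE) d' \<Lambda> X = tri_mat (dA, d', dE) (\<lambda>(a1, b1, e1) (a2, b2, e2).
     \<Lambda> (mat dB dB (\<lambda>(x, y). tri_entry (dA, dB, dE) X (a1, x, e1) (a2, y, e2))) $$ (b1, b2))"

text \<open>In the clause for complete positivity, \<^term>\<open>bob_local (k, d, 1) d' \<Lambda>\<close> is
  \<open>id\<^sub>k \<otimes> \<Lambda>\<close>, because the third system is trivial.\<close>

definition cptp :: "nat \<Rightarrow> nat \<Rightarrow> (complex mat \<Rightarrow> complex mat) \<Rightarrow> bool" where
  "cptp d d' \<Lambda> \<longleftrightarrow>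
     (\<forall>X\<in>carrier_mat d d. \<Lambda> X \<in> carrier_mat d' d') \<and>
     (\<forall>X\<in>carrier_mat d d. \<forall>Y\<in>carrier_mat d d. \<Lambda> (X + Y) = \<Lambda> X + \<Lambda> Y) \<and>
     (\<forall>c. \<forall>X\<in>carrier_mat d d. \<Lambda> (c \<cdot>\<^sub>m X) = c \<cdot>\<^sub>m \<Lambda> X) \<and>
     (\<forall>k X. positive_op (k * d) X \<longrightarrow> positive_op (k * d') (bob_local (k, d, 1) d' \<Lambda> X)) \<and>
     (\<forall>X\<in>carrier_mat d d. mat_trace (\<Lambda> X) = mat_trace X)"

text \<open>Public communication.  If Alice's system is \<open>A \<otimes> A'\<close> with \<open>dim A' = m\<close>, then
  \<open>alice_sends\<close> maps \<open>\<Sum>\<^sub>i \<rho>\<^sub>i \<otimes> |i\<rangle>\<langle>i|\<close> on \<open>ABE \<otimes> A'\<close> to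
  \<open>\<Sum>\<^sub>i \<rho>\<^sub>i \<otimes> |iii\<rangle>\<langle>iii|\<close> on \<open>ABE \<otimes> A'B'E'\<close>; the new registers \<open>B'\<close> and \<open>E'\<close> are
  appended to the systems of Bob and Eve.  On an operator \<open>X\<close> for which the register \<open>A'\<close>
  is not classical, the blocks \<open>\<rho>\<^sub>i = \<langle>i|X|i\<rangle>\<close> are used, that is, the register is first
  dephased, which is a local operation of Alice.  Hence the total map adds no operation
  beyond those generated by the two kinds of steps.\<close>

fun alice_sends :: "nat \<Rightarrow> dims \<Rightarrow> complex mat \<Rightarrow> complex mat" where
  "alice_sends m (dA, dB, dE) X =
     tri_mat (dA, dB * m, dE * m) (\<lambda>(a1, b1, e1) (a2, b2, e2).
       if (\<exists>i. a1 mod m = i \<and> b1 mod m = i \<and> e1 mod m = i \<and>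
               a2 mod m = i \<and> b2 mod m = i \<and> e2 mod m = i)
       then tri_entry (dA, dB, dE) X (a1, b1 div m, e1 div m) (a2, b2 div m, e2 div m)
       else 0)"

fun bob_sends :: "nat \<Rightarrow> dims \<Rightarrow> complex mat \<Rightarrow> complex mat" where
  "bob_sends m (dA, dB, dE) X =
     tri_mat (dA * m, dB, dE * m) (\<lambda>(a1, b1, e1) (a2, b2, e2).
       if (\<exists>i. a1 mod m = i \<and> b1 mod m = i \<and> e1 mod m = i \<and>
               a2 mod m = i \<and> b2 mod m = i \<and> e2 mod m = i)
       then tri_entry (dA, dB, dE) X (a1 div m, b1, e1 div m) (a2 div m, b2, e2 div m)
       else 0)"

inductive lopc_step :: "dims \<Rightarrow> dims \<Rightarrow> (complex mat \<Rightarrow> complex mat) \<Rightarrow> bool" where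
  alice_local: "cptp dA d' \<Lambda> \<Longrightarrow>
     lopc_step (dA, dB, dE) (d', dB, dE) (alice_local (dA, dB, dE) d' \<Lambda>)"
| bob_local: "cptp dB d' \<Lambda> \<Longrightarrow>
     lopc_step (dA, dB, dE) (dA, d', dE) (bob_local (dA, dB, dE) d' \<Lambda>)"
| alice_sends:
    "lopc_step (dA * m, dB, dE) (dA * m, dB * m, dE * m) (alice_sends m (dA * m, dB, dE))"
| bob_sends:
    "lopc_step (dA, dB * m, dE) (dA * m, dB * m, dE * m) (bob_sends m (dA, dB * m, dE))"

inductive lopc :: "dims \<Rightarrow> dims \<Rightarrow> (complex mat \<Rightarrow> complex mat) \<Rightarrow> bool" where
  lopc_none: "lopc D D (\<lambda>X. X)"
| lopc_append: "lopc D D' \<Lambda> \<Longrightarrow> lopc_step D' D'' \<Gamma> \<Longrightarrow> lopc D D'' (\<lambda>X. \<Gamma> (\<Lambda> X))"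


section \<open>Key distillation\<close>

text \<open>A protocol consists of the output systems \<^term>\<open>out n\<close> and the maps \<^term>\<open>P n\<close>.\<close>

definition lopc_protocol ::
    "dims \<Rightarrow> (nat \<Rightarrow> dims) \<Rightarrow> (nat \<Rightarrow> complex mat \<Rightarrow> complex mat) \<Rightarrow> bool" where
  "lopc_protocol D out P \<longleftrightarrow> (\<forall>n. lopc (dims_power D n) (out n) (P n))"

text \<open>The target key \<open>\<tau>\<^sup>l\<close> is only determined up to the arbitrary state of Eve, which may
  depend on \<open>n\<close>.  The rate is a limes superior and hence an extended real.\<close>

definition key_distillation_protocol ::
    "dims \<Rightarrow> complex mat \<Rightarrow> (nat \<Rightarrow> dims) \<Rightarrow> (nat \<Rightarrow> complex mat \<Rightarrow> complex mat)
      \<Rightarrow> ereal \<Rightarrow> bool" where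
  "key_distillation_protocol D \<rho> out P R \<longleftrightarrow>
     lopc_protocol D out P \<and>
     (\<exists>(l :: nat \<Rightarrow> nat) (dE :: nat \<Rightarrow> nat) (\<tau>E :: nat \<Rightarrow> complex mat).
        (\<forall>n. out n = key_dims (l n) (dE n) \<and> density_op (dE n) (\<tau>E n)) \<and>
        limsup (\<lambda>n. ereal (real (l n) / real n)) = R \<and>
        (\<lambda>n. trace_dist (P n (tri_power D \<rho> n)) (perfect_key (l n) (dE n) (\<tau>E n)))
          \<longlonglongrightarrow> 0)"

end

theory Submission
  imports Defs "HOL-Real_Asymp.Real_Asymp"
begin

text \<open>The key \<open>\<tau>\<^sup>l\<close> is not available to the new protocol, so Alice and Bob use a fixed value
  \<open>t\<close> of the \<open>l n\<close> key bits in its place and hash the output of the old protocol with a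
  fixed function \<open>f\<close> to \<open>l n + k\<close> bits less, where \<open>k = \<lfloor>\<surd>n\<rfloor>\<close>.  Given the value \<open>t\<close>, the
  operators \<open>x\<^sub>j\<close> of Eve that belong to the raw key \<open>j\<close> are bounded by \<open>2\<^bsup>l n\<^esup>\<close> times their
  average over \<open>t\<close>.  This average is the output of the old protocol and hence close to
  \<open>2\<^bsup>-L\<^esup> \<tau>\<^sub>E\<close>.  As in the leftover hash lemma, a good \<open>f\<close> makes the distance to a perfect key at
  most of order \<open>2\<^bsup>-k/2\<^esup>\<close>, up to the square root of the error of the old protocol; \<open>t\<close> and
  \<open>f\<close> exist by averaging.  Since a protocol is a sequence of arbitrary LOPC maps, it may contain
  the choice of \<open>t\<close> and \<open>f\<close>.  The part \<open>\<tau>\<^sub>F\<close> of the key state that Eve would hold is removed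
  by a partial trace, which commutes with every LOPC operation.\<close>

section \<open>Spectral theorem\<close>

text \<open>The averaged output differs from the ideal key by P - Q with P and Q positive and of
  small trace. So a single seed satisfies only x_t <= s (T + P), where s = 2^(l n) and T = 2^(-L)
  tau. An operator of small trace may be large in the operator order, so a hash lemma with the
  weight T alone does not apply. The weight is therefore T + P_k for each raw key k, and the surplus
  P_k is split off at a cost of order sqrt(tr P). The main term is sqrt((m - 1) tr(T) s) = sqrt((2^M
  - 1) 2^(l n - L)), which is why about L - l n bits survive. The greedy hash attains the second
  moment 1 - 1/m of a uniformly random function, so no family of hash functions has to be averaged.
  Eve's part of the target key is free. It is taken to be her actual reduced state for the chosen
  seed, so that state never has to be compared with tau. The trace over F is forced by the types:
  the old maps act on (E F)^n, whereas Eve holds E^n in the new protocol.\<close>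

unbundle no vec_syntax

lemma mat_adjoint_carrier [simp]:
  "A \<in> carrier_mat n m \<Longrightarrow> mat_adjoint A \<in> carrier_mat m n"
  by (auto simp: mat_adjoint_def)

lemma dim_mat_adjoint [simp]:
  "dim_row (mat_adjoint A) = dim_col A" "dim_col (mat_adjoint A) = dim_row A"
  by (auto simp: mat_adjoint_def)

lemma index_mat_adjoint [simp]:
  assumes "i < dim_col A" "j < dim_row A"
  shows "mat_adjoint A $$ (i, j) = conjugate (A $$ (j, i))"
  using assms by (simp add: mat_adjoint_def mat_of_rows_index)

lemma square_mat_closed [simp]:
  "A \<in> carrier_mat n n \<Longrightarrow> B \<in> carrier_mat n n \<Longrightarrow> A * B \<in> carrier_mat n n"
  "A \<in> carrier_mat n n \<Longrightarrow> B \<in> carrier_mat n n \<Longrightarrow> A + B \<in> carrier_mat n n"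
  "A \<in> carrier_mat n n \<Longrightarrow> B \<in> carrier_mat n n \<Longrightarrow> A - B \<in> carrier_mat n n"
  by auto

lemma mat_adjoint_adjoint [simp]: "mat_adjoint (mat_adjoint A) = A"
  by (rule eq_matI) auto

lemma mat_adjoint_one [simp]: "mat_adjoint (1\<^sub>m n :: complex mat) = 1\<^sub>m n"
  by (rule eq_matI) auto

lemma mat_adjoint_mult:
  fixes A B :: "complex mat"
  assumes "A \<in> carrier_mat n m" "B \<in> carrier_mat m k"
  shows "mat_adjoint (A * B) = mat_adjoint B * mat_adjoint A"
  using assms by (intro eq_matI) (auto simp: scalar_prod_def mult.commute)

lemma mat_adjoint_minus:
  fixes A B :: "complex mat"
  assumes "A \<in> carrier_mat n m" "B \<in> carrier_mat n m"
  shows "mat_adjoint (A - B) = mat_adjoint A - mat_adjoint B"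
  using assms by (intro eq_matI) auto

lemma index_mult_mat_sum:
  assumes "A \<in> carrier_mat n m" "B \<in> carrier_mat m k" "i < n" "j < k"
  shows "(A * B) $$ (i, j) = (\<Sum>r<m. A $$ (i, r) * B $$ (r, j))"
  using assms by (auto simp: scalar_prod_def lessThan_atLeast0)

text \<open>Gram-Schmidt applied to a basis that starts with \<open>v\<close> keeps \<open>v\<close>
  as its head but yields only an orthogonal family, hence the division by the norms;
  \<open>c\<close> is the reciprocal of the norm of \<open>v\<close>. This is the change of basis
  for one deflation step of the spectral theorem.\<close>

lemma orthonormal_completion:
  assumes v: "v \<in> carrier_vec n" and v0: "v \<noteq> (0\<^sub>v n :: complex vec)" and n: "0 < n"
  obtains W c where "W \<in> carrier_mat n n" "mat_adjoint W * W = 1\<^sub>m n" "W * mat_adjoint W = 1\<^sub>m n"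
    "col W 0 = c \<cdot>\<^sub>v v"
proof -
  interpret cof_vec_space n "TYPE(complex)" .
  define b where "b = basis_completion v"
  from basis_completion[OF v v0, folded b_def]
  have dist_b: "distinct b" and indep: "\<not> lin_dep (set b)" and b: "set b \<subseteq> carrier_vec n"
    and hdb: "hd b = v" and len_b: "length b = n" by auto
  define ws where "ws = gram_schmidt n b"
  from hdb len_b n obtain vs where bv: "b = v # vs" by (cases b, auto)
  from gram_schmidt_result[OF b dist_b indep refl, folded ws_def]
  have ws: "set ws \<subseteq> carrier_vec n" "corthogonal ws" "length ws = n"
    by (auto simp: len_b)
  from gram_schmidt_hd[OF v, of vs, folded bv] have hdws: "hd ws = v" unfolding ws_def .
  have ws_carr: "ws ! j \<in> carrier_vec n" if "j < n" for j
    using that ws by auto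
  define q where "q j = (\<Sum>k<n. (cmod (ws ! j $ k))\<^sup>2)" for j
  have prod: "ws ! i \<bullet>c ws ! j = (\<Sum>k<n. ws ! i $ k * cnj (ws ! j $ k))" if "i < n" "j < n" for i j
    using that ws_carr[of i] ws_carr[of j] by (auto simp: scalar_prod_def lessThan_atLeast0)
  have prod_same: "ws ! j \<bullet>c ws ! j = of_real (q j)" if "j < n" for j
    using prod[OF that that] by (simp add: q_def complex_norm_square[symmetric])
  have qpos: "q j > 0" if "j < n" for j
  proof -
    have "ws ! j \<bullet>c ws ! j \<noteq> 0"
      using corthogonalD[OF ws(2), of j j] that ws(3) by auto
    then have "q j \<noteq> 0" using prod_same[OF that] by auto
    moreover have "q j \<ge> 0" unfolding q_def by (simp add: sum_nonneg)
    ultimately show ?thesis by simp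
  qed
  define W where "W = mat n n (\<lambda>(i, j). ws ! j $ i / of_real (sqrt (q j)))"
  have W: "W \<in> carrier_mat n n" by (simp add: W_def)
  have "(mat_adjoint W * W) $$ (i, j) = (1\<^sub>m n) $$ (i, j)" if i: "i < n" and j: "j < n" for i j
  proof -
    have "(mat_adjoint W * W) $$ (i, j) = (\<Sum>k<n. cnj (W $$ (k, i)) * W $$ (k, j))"
      using W i j by (subst index_mult_mat_sum[of _ n n _ n]) auto
    also have "\<dots> = (\<Sum>k<n. (ws ! j $ k * cnj (ws ! i $ k)) / (of_real (sqrt (q j)) * of_real (sqrt (q i))))"
      using i j by (intro sum.cong) (auto simp: W_def mult.commute)
    also have "\<dots> = (ws ! j \<bullet>c ws ! i) / (of_real (sqrt (q j)) * of_real (sqrt (q i)))"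
      by (simp add: prod[OF j i] sum_divide_distrib)
    also have "\<dots> = (1\<^sub>m n) $$ (i, j)"
    proof (cases "i = j")
      case True
      have "of_real (sqrt (q j)) * of_real (sqrt (q j)) = (of_real (q j) :: complex)"
        using qpos[OF j] by (simp flip: of_real_mult)
      then show ?thesis using True i qpos[OF j] prod_same[OF j] by simp
    next
      case False
      then show ?thesis using i j corthogonalD[OF ws(2), of j i] ws(3) by auto
    qed
    finally show ?thesis .
  qed
  then have WW: "mat_adjoint W * W = 1\<^sub>m n"
    using W by (intro eq_matI) auto
  then have WW': "W * mat_adjoint W = 1\<^sub>m n"
    using mat_mult_left_right_inverse[of "mat_adjoint W" n W] W by auto
  have "ws ! 0 = v" using hdws ws(3) n by (metis hd_conv_nth length_0_conv less_irrefl)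
  then have "col W 0 = (1 / of_real (sqrt (q 0))) \<cdot>\<^sub>v v"
    using v n by (intro eq_vecI) (auto simp: W_def)
  with that[OF W WW WW'] show ?thesis by blast
qed

definition real_diag :: "nat \<Rightarrow> (nat \<Rightarrow> real) \<Rightarrow> complex mat" where
  "real_diag n d = mat n n (\<lambda>(i, j). if i = j then of_real (d i) else 0)"

lemma real_diag_carrier [simp]: "real_diag n d \<in> carrier_mat n n"
  by (simp add: real_diag_def)

lemma real_diag_mult: "real_diag n c * real_diag n d = real_diag n (\<lambda>i. c i * d i)"
proof (rule eq_matI)
  fix i j assume "i < dim_row (real_diag n (\<lambda>i. c i * d i))" "j < dim_col (real_diag n (\<lambda>i. c i * d i))"
  then have i: "i < n" and j: "j < n" by (auto simp: real_diag_def)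
  have "(real_diag n c * real_diag n d) $$ (i, j)
      = (\<Sum>k<n. (if i = k then of_real (c i) else 0) * (if k = j then of_real (d k) else 0))"
    using i j by (subst index_mult_mat_sum[of _ n n _ n]) (auto simp: real_diag_def)
  also have "\<dots> = (\<Sum>k<n. if i = k then (if k = j then of_real (c i * d k) else 0) else 0)"
    by (intro sum.cong) auto
  also have "\<dots> = real_diag n (\<lambda>i. c i * d i) $$ (i, j)"
    using i j by (simp add: real_diag_def)
  finally show "(real_diag n c * real_diag n d) $$ (i, j) = real_diag n (\<lambda>i. c i * d i) $$ (i, j)" .
qed (auto simp: real_diag_def)

lemma real_diag_add: "real_diag n c + real_diag n d = real_diag n (\<lambda>i. c i + d i)"
  by (rule eq_matI) (auto simp: real_diag_def)

lemma real_diag_diff: "real_diag n c - real_diag n d = real_diag n (\<lambda>i. c i - d i)"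
  by (rule eq_matI) (auto simp: real_diag_def)

lemma real_diag_adjoint [simp]: "mat_adjoint (real_diag n d) = real_diag n d"
  by (rule eq_matI) (auto simp: real_diag_def)

definition unitary_op :: "nat \<Rightarrow> complex mat \<Rightarrow> bool" where
  "unitary_op n U \<longleftrightarrow> U \<in> carrier_mat n n \<and> mat_adjoint U * U = 1\<^sub>m n \<and> U * mat_adjoint U = 1\<^sub>m n"

lemma unitary_op_mult:
  assumes "unitary_op n U" "unitary_op n V"
  shows "unitary_op n (U * V)"
proof -
  have U: "U \<in> carrier_mat n n" "mat_adjoint U * U = 1\<^sub>m n" "U * mat_adjoint U = 1\<^sub>m n"
    and V: "V \<in> carrier_mat n n" "mat_adjoint V * V = 1\<^sub>m n" "V * mat_adjoint V = 1\<^sub>m n"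
    using assms by (auto simp: unitary_op_def)
  note c = U(1) V(1) mat_adjoint_carrier[OF U(1)] mat_adjoint_carrier[OF V(1)]
  have "mat_adjoint V * mat_adjoint U * (U * V) = mat_adjoint V * (mat_adjoint U * U * V)"
    using c by (simp add: assoc_mult_mat[of _ n n _ n _ n])
  moreover have "U * V * (mat_adjoint V * mat_adjoint U) = U * (V * mat_adjoint V * mat_adjoint U)"
    using c by (simp add: assoc_mult_mat[of _ n n _ n _ n])
  ultimately show ?thesis
    using c U V unfolding unitary_op_def by (auto simp: mat_adjoint_mult[OF U(1) V(1)])
qed

text \<open>Deflation: a unitary whose first column is an eigenvector turns the first column of
  \<open>A\<close> into a multiple of the first basis vector. Self-adjointness clears the first row
  as well, so the induction applies to the remaining block.\<close>

theorem hermitian_spectral: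
  assumes "A \<in> carrier_mat n n" "mat_adjoint A = A"
  shows "\<exists>U d. unitary_op n U \<and> A = U * real_diag n d * mat_adjoint U"
proof -
  \<comment> \<open>The induction runs on the form \<open>mat_adjoint U * A * U\<close>, in which
    the unitaries of successive deflations compose directly; solving for \<open>A\<close> is left to
    the end.\<close>
  have "\<exists>U d. unitary_op n U \<and> mat_adjoint U * A * U = real_diag n d"
    using assms
  proof (induction n arbitrary: A)
    case 0
    then show ?case
      by (intro exI[of _ "1\<^sub>m 0"]) (auto simp: unitary_op_def real_diag_def intro!: eq_matI)
  next
    case (Suc m)
    let ?n = "Suc m"
    have A: "A \<in> carrier_mat ?n ?n" and hA: "mat_adjoint A = A" using Suc.prems by auto
    have "degree (char_poly A) \<noteq> 0" using degree_monic_char_poly[OF A] by simp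
    then obtain e where "poly (char_poly A) e = 0"
      using fundamental_theorem_of_algebra[of "char_poly A"] constant_degree by metis
    then have "eigenvalue A e" using eigenvalue_root_char_poly[OF A] by simp
    then obtain v where v: "v \<in> carrier_vec ?n" "v \<noteq> 0\<^sub>v ?n" "A *\<^sub>v v = e \<cdot>\<^sub>v v"
      using A unfolding eigenvalue_def eigenvector_def by auto
    obtain W c where W: "W \<in> carrier_mat ?n ?n" "mat_adjoint W * W = 1\<^sub>m ?n"
      "W * mat_adjoint W = 1\<^sub>m ?n" and colW: "col W 0 = c \<cdot>\<^sub>v v"
      using orthonormal_completion[OF v(1,2)] by blast
    define B where "B = mat_adjoint W * (A * W)"
    have aW: "mat_adjoint W \<in> carrier_mat ?n ?n" using W(1) by simp
    have B: "B \<in> carrier_mat ?n ?n" using W A by (simp add: B_def)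
    have hB: "mat_adjoint B = B"
      using W A aW hA unfolding B_def
      by (simp add: mat_adjoint_mult[of _ ?n ?n _ ?n] assoc_mult_mat[of _ ?n ?n _ ?n _ ?n])
    have "col (A * W) 0 = A *\<^sub>v col W 0" using A W by auto
    also have "\<dots> = e \<cdot>\<^sub>v col W 0"
      unfolding colW using A v by (auto simp: mult_mat_vec smult_smult_assoc mult.commute)
    finally have AW0: "col (A * W) 0 = e \<cdot>\<^sub>v col W 0" .
    have col0: "B $$ (i, 0) = (if i = 0 then e else 0)" if "i < ?n" for i
    proof -
      have "B $$ (i, 0) = row (mat_adjoint W) i \<bullet> col (A * W) 0"
        using that A W aW by (simp add: B_def)
      also have "\<dots> = e * (row (mat_adjoint W) i \<bullet> col W 0)"
        unfolding AW0 using W that by (intro scalar_prod_smult_right) auto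
      also have "row (mat_adjoint W) i \<bullet> col W 0 = (mat_adjoint W * W) $$ (i, 0)"
        using W(1) aW that by simp
      finally show ?thesis unfolding W(2) using that by simp
    qed
    have row0: "B $$ (0, i) = (if i = 0 then e else 0)" if i: "i < ?n" for i
    proof -
      have "B $$ (0, i) = cnj (B $$ (i, 0))"
        using hB B i by (metis carrier_matD conjugate_complex_def index_mat_adjoint zero_less_Suc)
      moreover have "B $$ (0, 0) = cnj (B $$ (0, 0))"
        using hB B by (metis carrier_matD conjugate_complex_def index_mat_adjoint zero_less_Suc)
      ultimately show ?thesis using col0[OF i] col0[of 0] by auto
    qed
    define C where "C = mat m m (\<lambda>(i, j). B $$ (Suc i, Suc j))"
    have C: "C \<in> carrier_mat m m" by (simp add: C_def)
    have hBij: "cnj (B $$ (j, i)) = B $$ (i, j)" if "i < ?n" "j < ?n" for i j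
      using hB B that by (metis carrier_matD conjugate_complex_def index_mat_adjoint)
    have hC: "mat_adjoint C = C"
      using hBij by (intro eq_matI) (auto simp: C_def)
    obtain V d where V: "unitary_op m V" and VC: "mat_adjoint V * C * V = real_diag m d"
      using Suc.IH[OF C hC] by blast
    have Vc: "V \<in> carrier_mat m m" "mat_adjoint V \<in> carrier_mat m m"
      and VV: "mat_adjoint V * V = 1\<^sub>m m" "V * mat_adjoint V = 1\<^sub>m m"
      using V by (auto simp: unitary_op_def)
    let ?four = "\<lambda>a X. four_block_mat (mat 1 1 (\<lambda>_. a)) (0\<^sub>m 1 m) (0\<^sub>m m 1) X"
    have four_mult: "?four a X * ?four b Y = ?four (a * b) (X * Y)"
      if "X \<in> carrier_mat m m" "Y \<in> carrier_mat m m" for a b :: complex and X Y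
    proof -
      have "mat 1 1 (\<lambda>_. a) * mat 1 1 (\<lambda>_. b) = mat 1 1 (\<lambda>_. a * b)"
        by (rule eq_matI) (auto simp: scalar_prod_def)
      then show ?thesis
        using that by (subst mult_four_block_mat[of _ 1 1 _ m _ m _ _ 1 _ m])
          (auto)
    qed
    have Beq: "B = ?four e C"
      using B col0 row0 by (intro eq_matI) (auto simp: C_def)
    define V' where "V' = ?four 1 V"
    have V'c: "V' \<in> carrier_mat ?n ?n"
      using Vc four_block_carrier_mat[of "mat 1 1 (\<lambda>_. 1)" 1 1 V m m] by (simp add: V'_def)
    have aV': "mat_adjoint V' = ?four 1 (mat_adjoint V)"
      unfolding V'_def using Vc by (intro eq_matI) auto
    have four_one: "?four 1 (1\<^sub>m m) = 1\<^sub>m ?n"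
      by (intro eq_matI) auto
    have V'u: "unitary_op ?n V'"
      using V'c four_mult[OF Vc(2) Vc(1), of 1 1] four_mult[OF Vc(1) Vc(2), of 1 1] VV four_one
      unfolding unitary_op_def aV' by (simp add: V'_def)
    have "mat_adjoint V' * B * V' = ?four e (mat_adjoint V * C * V)"
      unfolding aV' Beq unfolding V'_def
      using four_mult[OF Vc(2) C, of 1 e] four_mult[of "mat_adjoint V * C" V e 1] Vc C by (simp add: assoc_mult_mat[of _ m m _ m _ m])
    also have "\<dots> = real_diag ?n (\<lambda>i. if i = 0 then Re e else d (i - 1))"
    proof -
      have "Im e = 0" using hBij[of 0 0] col0[of 0] by (simp add: complex_eq_iff)
      then have "of_real (Re e) = e" by (simp add: complex_eq_iff)
      then show ?thesis unfolding VC by (intro eq_matI) (auto simp: real_diag_def)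
    qed
    finally have D: "mat_adjoint V' * B * V' = real_diag ?n (\<lambda>i. if i = 0 then Re e else d (i - 1))" .
    have "mat_adjoint (W * V') * A * (W * V') = mat_adjoint V' * B * V'"
      unfolding mat_adjoint_mult[OF W(1) V'c] B_def
      using W(1) aW V'c mat_adjoint_carrier[OF V'c] A
      by (simp add: assoc_mult_mat[of _ ?n ?n _ ?n _ ?n])
    moreover have "unitary_op ?n (W * V')"
      using V'u W by (intro unitary_op_mult) (auto simp: unitary_op_def)
    ultimately show ?case using D by metis
  qed
  then obtain U d where U: "unitary_op n U" and D: "mat_adjoint U * A * U = real_diag n d"
    by blast
  have Uc: "U \<in> carrier_mat n n" "mat_adjoint U \<in> carrier_mat n n" "U * mat_adjoint U = 1\<^sub>m n"
    using U by (auto simp: unitary_op_def)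
  have "U * real_diag n d * mat_adjoint U = (U * mat_adjoint U) * A * (U * mat_adjoint U)"
    unfolding D[symmetric] using Uc(1,2) assms(1)
    by (simp add: assoc_mult_mat[of _ n n _ n _ n])
  also have "\<dots> = A" using Uc assms by simp
  finally show ?thesis using U by metis
qed

section \<open>Positive operators and trace distance\<close>

abbreviation rtrace :: "complex mat \<Rightarrow> real" where
  "rtrace X \<equiv> Re (mat_trace X)"

section \<open>Trace and quadratic forms\<close>

lemma mat_trace_add:
  assumes "A \<in> carrier_mat n n" "B \<in> carrier_mat n n"
  shows "mat_trace (A + B) = mat_trace A + mat_trace B"
  using assms by (simp add: mat_trace_def sum.distrib)

lemma mat_trace_minus:
  assumes "A \<in> carrier_mat n n" "B \<in> carrier_mat n n"
  shows "mat_trace (A - B) = mat_trace A - mat_trace B"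
  using assms by (simp add: mat_trace_def sum_subtractf)

lemma mat_trace_smult:
  assumes "A \<in> carrier_mat n n"
  shows "mat_trace (c \<cdot>\<^sub>m A) = c * mat_trace A"
  using assms by (simp add: mat_trace_def sum_distrib_left)

lemma mat_trace_mult:
  assumes "A \<in> carrier_mat n m" "B \<in> carrier_mat m n"
  shows "mat_trace (A * B) = (\<Sum>i<n. \<Sum>j<m. A $$ (i, j) * B $$ (j, i))"
  using assms by (simp add: mat_trace_def index_mult_mat_sum[OF assms] del: index_mult_mat(1))

lemma mat_trace_comm:
  assumes "A \<in> carrier_mat n m" "B \<in> carrier_mat m n"
  shows "mat_trace (A * B) = mat_trace (B * A)"
  unfolding mat_trace_mult[OF assms] mat_trace_mult[OF assms(2,1)]
  by (subst sum.swap) (simp add: mult.commute)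

lemma mat_trace_gram:
  assumes "C \<in> carrier_mat m n"
  shows "mat_trace (mat_adjoint C * C) = of_real (\<Sum>i<m. \<Sum>j<n. (cmod (C $$ (i, j)))\<^sup>2)"
proof -
  have "mat_trace (mat_adjoint C * C) = (\<Sum>j<n. \<Sum>i<m. cnj (C $$ (i, j)) * C $$ (i, j))"
    using assms by (subst mat_trace_mult[of _ n m]) auto
  also have "\<dots> = (\<Sum>j<n. \<Sum>i<m. of_real ((cmod (C $$ (i, j)))\<^sup>2))"
    unfolding complex_norm_square by (simp add: mult.commute)
  finally show ?thesis by (subst sum.swap) simp
qed

text \<open>Vectors are plain functions, so test vectors supported on one or two basis vectors can
  be written and added without side conditions on dimensions. The two arguments are separate to
  allow polarisation.\<close>

definition quad_form :: "nat \<Rightarrow> complex mat \<Rightarrow> (nat \<Rightarrow> complex) \<Rightarrow> (nat \<Rightarrow> complex) \<Rightarrow> complex" where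
  "quad_form n X f g = (\<Sum>i<n. \<Sum>j<n. cnj (f i) * X $$ (i, j) * g j)"

lemma positive_op_quad_form:
  "positive_op n X \<longleftrightarrow> X \<in> carrier_mat n n \<and> (\<forall>f. 0 \<le> quad_form n X f f)"
proof -
  have *: "(X *\<^sub>v v) \<bullet>c v = quad_form n X (\<lambda>i. v $ i) (\<lambda>i. v $ i)"
    if "X \<in> carrier_mat n n" "v \<in> carrier_vec n" for v
    using that
    by (auto simp: quad_form_def scalar_prod_def lessThan_atLeast0 sum_distrib_right
        intro!: sum.cong)
  have **: "quad_form n X f f = quad_form n X (\<lambda>i. vec n f $ i) (\<lambda>i. vec n f $ i)" for f
    by (simp add: quad_form_def)
  show ?thesis
    unfolding positive_op_def using * ** by (metis vec_carrier)
qed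

lemma positive_op_carrier: "positive_op n X \<Longrightarrow> X \<in> carrier_mat n n"
  by (simp add: positive_op_def)

lemma quad_form_delta:
  assumes "a < n" "b < n"
  shows "quad_form n X (\<lambda>i. if i = a then c else 0) (\<lambda>i. if i = b then d else 0)
    = cnj c * X $$ (a, b) * d"
proof -
  have "quad_form n X (\<lambda>i. if i = a then c else 0) (\<lambda>i. if i = b then d else 0)
    = (\<Sum>i<n. \<Sum>j<n. if i = a then (if j = b then cnj c * X $$ (a, b) * d else 0) else 0)"
    unfolding quad_form_def by (intro sum.cong) auto
  also have "\<dots> = (\<Sum>i<n. if i = a then (\<Sum>j<n. (if j = b then cnj c * X $$ (a, b) * d else 0)) else 0)"
    by (intro sum.cong) auto
  finally show ?thesis using assms by simp
qed

lemma quad_form_add: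
  "quad_form n X (\<lambda>i. f i + f' i) (\<lambda>i. g i + g' i)
   = quad_form n X f g + quad_form n X f g' + quad_form n X f' g + quad_form n X f' g'"
  by (simp add: quad_form_def algebra_simps sum.distrib)

text \<open>Polarisation: the form is real on \<open>e_a + e_b\<close> and on
  \<open>e_a + i e_b\<close>, and these two conditions give the imaginary and the real part of the
  claim.\<close>

lemma positive_op_hermitian:
  assumes "positive_op n X"
  shows "mat_adjoint X = X"
proof -
  have X: "X \<in> carrier_mat n n" and q: "\<And>f. 0 \<le> quad_form n X f f"
    using assms by (auto simp: positive_op_quad_form)
  have im: "Im (quad_form n X f f) = 0" for f
    using q[of f] by (simp add: less_eq_complex_def)
  have "cnj (X $$ (b, a)) = X $$ (a, b)" if a: "a < n" and b: "b < n" for a b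
  proof -
    have 1: "Im (X $$ (a, a) + X $$ (a, b) * c + cnj c * X $$ (b, a) + cnj c * X $$ (b, b) * c) = 0" for c
      using im[of "\<lambda>i. (if i = a then 1 else 0) + (if i = b then c else 0)"]
      unfolding quad_form_add by (simp add: quad_form_delta a b)
    have 2: "Im (X $$ (a, a)) = 0" "Im (X $$ (b, b)) = 0"
      using im[of "\<lambda>i. if i = a then 1 else 0"] im[of "\<lambda>i. if i = b then 1 else 0"]
      by (simp_all add: quad_form_delta a b)
    from 1[of 1] 1[of \<i>] 2 show ?thesis
      by (simp add: complex_eq_iff)
  qed
  then show ?thesis using X by (intro eq_matI) auto
qed

lemma positive_op_gram:
  assumes "C \<in> carrier_mat m n"
  shows "positive_op n (mat_adjoint C * C)"
  unfolding positive_op_quad_form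
proof (intro conjI allI)
  show "mat_adjoint C * C \<in> carrier_mat n n"
    using assms mult_carrier_mat[of "mat_adjoint C" n m C n] by simp
  fix f :: "nat \<Rightarrow> complex"
  have "quad_form n (mat_adjoint C * C) f f
      = (\<Sum>i<n. \<Sum>j<n. \<Sum>r<m. cnj (C $$ (r, i) * f i) * (C $$ (r, j) * f j))"
    unfolding quad_form_def
  proof (intro sum.cong refl)
    fix i j assume "i \<in> {..<n}" "j \<in> {..<n}"
    then have "(mat_adjoint C * C) $$ (i, j) = (\<Sum>r<m. cnj (C $$ (r, i)) * C $$ (r, j))"
      using assms by (subst index_mult_mat_sum[of _ n m _ n]) auto
    then show "cnj (f i) * (mat_adjoint C * C) $$ (i, j) * f j
      = (\<Sum>r<m. cnj (C $$ (r, i) * f i) * (C $$ (r, j) * f j))"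
      by (simp add: sum_distrib_left sum_distrib_right mult_ac)
  qed
  also have "\<dots> = (\<Sum>i<n. \<Sum>r<m. \<Sum>j<n. cnj (C $$ (r, i) * f i) * (C $$ (r, j) * f j))"
    by (intro sum.cong refl sum.swap)
  also have "\<dots> = (\<Sum>r<m. \<Sum>i<n. \<Sum>j<n. cnj (C $$ (r, i) * f i) * (C $$ (r, j) * f j))"
    by (rule sum.swap)
  also have "\<dots> = (\<Sum>r<m. cnj (\<Sum>i<n. C $$ (r, i) * f i) * (\<Sum>j<n. C $$ (r, j) * f j))"
    by (simp add: sum_product)
  also have "\<dots> = of_real (\<Sum>r<m. (cmod (\<Sum>i<n. C $$ (r, i) * f i))\<^sup>2)"
    unfolding of_real_sum complex_norm_square by (simp only: mult.commute)
  also have "\<dots> \<ge> 0" by (simp add: less_eq_complex_def sum_nonneg)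
  finally show "0 \<le> quad_form n (mat_adjoint C * C) f f" .
qed

text \<open>Functional calculus in a fixed eigenbasis \<open>U\<close>: sums, differences, products
  and adjoints act pointwise on the eigenvalue function \<open>d\<close>. Square roots, inverses,
  signs and absolute values thereby become statements about real numbers.\<close>

definition spectral_mat :: "nat \<Rightarrow> complex mat \<Rightarrow> (nat \<Rightarrow> real) \<Rightarrow> complex mat" where
  "spectral_mat n U d = U * real_diag n d * mat_adjoint U"

context
  fixes n :: nat and U :: "complex mat"
  assumes U: "unitary_op n U"
begin

private lemma U_facts: "U \<in> carrier_mat n n" "mat_adjoint U * U = 1\<^sub>m n" "U * mat_adjoint U = 1\<^sub>m n"
  using U by (auto simp: unitary_op_def)

lemma spectral_mat_carrier: "spectral_mat n U d \<in> carrier_mat n n"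
  using U_facts by (simp add: spectral_mat_def)

lemma spectral_mat_mult: "spectral_mat n U c * spectral_mat n U d = spectral_mat n U (\<lambda>i. c i * d i)"
proof -
  note as = assoc_mult_mat[of _ n n _ n _ n]
  have "spectral_mat n U c * spectral_mat n U d
      = U * real_diag n c * (mat_adjoint U * U) * real_diag n d * mat_adjoint U"
    using U_facts(1) by (simp add: spectral_mat_def as)
  also have "\<dots> = U * (real_diag n c * real_diag n d) * mat_adjoint U"
    unfolding U_facts(2) using U_facts(1)
    by (simp add: as left_mult_one_mat[of _ n n] right_mult_one_mat[of _ n n])
  finally show ?thesis by (simp add: real_diag_mult spectral_mat_def)
qed

lemma spectral_mat_diff: "spectral_mat n U c - spectral_mat n U d = spectral_mat n U (\<lambda>i. c i - d i)"
  using U_facts(1) unfolding spectral_mat_def real_diag_diff[symmetric]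
  by (simp add: mult_minus_distrib_mat[of _ n n _ n] minus_mult_distrib_mat[of _ n n _ _ n])

lemma spectral_mat_add: "spectral_mat n U c + spectral_mat n U d = spectral_mat n U (\<lambda>i. c i + d i)"
  using U_facts(1) unfolding spectral_mat_def real_diag_add[symmetric]
  by (simp add: mult_add_distrib_mat[of _ n n _ n] add_mult_distrib_mat[of _ n n _ _ n])

lemma spectral_mat_adjoint: "mat_adjoint (spectral_mat n U d) = spectral_mat n U d"
  using U_facts(1)
  by (simp add: spectral_mat_def mat_adjoint_mult[of _ n n _ n] assoc_mult_mat[of _ n n _ n _ n])

lemma spectral_mat_const: "spectral_mat n U (\<lambda>_. c) = of_real c \<cdot>\<^sub>m 1\<^sub>m n"
proof -
  have "real_diag n (\<lambda>_. c) = of_real c \<cdot>\<^sub>m 1\<^sub>m n" by (rule eq_matI) (auto simp: real_diag_def)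
  moreover have "U * (of_real c \<cdot>\<^sub>m 1\<^sub>m n) = of_real c \<cdot>\<^sub>m U"
    using U_facts(1) by (simp add: mult_smult_distrib[of _ n n _ n])
  ultimately show ?thesis
    using U_facts by (simp add: spectral_mat_def mult_smult_assoc_mat[of _ n n _ n])
qed

lemma spectral_mat_one: "spectral_mat n U (\<lambda>_. 1) = 1\<^sub>m n"
  unfolding spectral_mat_const by (rule eq_matI) auto

lemma spectral_mat_cong: "(\<And>i. i < n \<Longrightarrow> c i = d i) \<Longrightarrow> spectral_mat n U c = spectral_mat n U d"
proof -
  assume "\<And>i. i < n \<Longrightarrow> c i = d i"
  then have "real_diag n c = real_diag n d" by (auto simp: real_diag_def intro!: eq_matI)
  then show ?thesis by (simp add: spectral_mat_def)
qed

lemma spectral_mat_positive: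
  assumes "\<And>i. i < n \<Longrightarrow> 0 \<le> d i"
  shows "positive_op n (spectral_mat n U d)"
proof -
  have "spectral_mat n U d
      = mat_adjoint (spectral_mat n U (\<lambda>i. sqrt (d i))) * spectral_mat n U (\<lambda>i. sqrt (d i))"
    unfolding spectral_mat_adjoint spectral_mat_mult using assms by (intro spectral_mat_cong) simp
  then show ?thesis using positive_op_gram spectral_mat_carrier by metis
qed

end

text \<open>The eigenvalue \<open>d i\<close> is the quadratic form of \<open>X\<close> at column
  \<open>i\<close> of \<open>U\<close>.\<close>

lemma positive_op_spectral:
  assumes "positive_op n X"
  shows "\<exists>U d. unitary_op n U \<and> X = spectral_mat n U d \<and> (\<forall>i<n. 0 \<le> d i)"
proof -
  have X: "X \<in> carrier_mat n n" using assms by (rule positive_op_carrier)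
  obtain U d where U: "unitary_op n U" and XU: "X = U * real_diag n d * mat_adjoint U"
    using hermitian_spectral[OF X positive_op_hermitian[OF assms]] by blast
  have Uc: "U \<in> carrier_mat n n" "mat_adjoint U * U = 1\<^sub>m n"
    using U by (auto simp: unitary_op_def)
  have D: "mat_adjoint U * (X * U) = real_diag n d"
  proof -
    have "mat_adjoint U * (X * U) = (mat_adjoint U * U) * real_diag n d * (mat_adjoint U * U)"
      unfolding XU using Uc(1) by (simp add: assoc_mult_mat[of _ n n _ n _ n])
    then show ?thesis unfolding Uc(2) by (simp add: left_mult_one_mat[of _ n n] right_mult_one_mat[of _ n n])
  qed
  have "0 \<le> d i" if i: "i < n" for i
  proof -
    have "complex_of_real (d i) = (mat_adjoint U * (X * U)) $$ (i, i)"
      unfolding D using i by (simp add: real_diag_def)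
    also have "\<dots> = (\<Sum>k<n. cnj (U $$ (k, i)) * (\<Sum>j<n. X $$ (k, j) * U $$ (j, i)))"
      using i X Uc(1)
      by (subst index_mult_mat_sum[of _ n n _ n])
        (auto simp: index_mult_mat_sum[of _ n n _ n] simp del: index_mult_mat(1) intro!: sum.cong)
    also have "\<dots> = quad_form n X (\<lambda>k. U $$ (k, i)) (\<lambda>k. U $$ (k, i))"
      by (simp add: quad_form_def sum_distrib_left mult.assoc)
    also have "\<dots> \<ge> 0" using assms by (simp add: positive_op_quad_form)
    finally show ?thesis by (simp add: less_eq_complex_def)
  qed
  with U XU show ?thesis unfolding spectral_mat_def by blast
qed

lemma positive_op_gramE:
  assumes "positive_op n X"
  obtains C where "C \<in> carrier_mat n n" "X = mat_adjoint C * C"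
proof -
  obtain U d where U: "unitary_op n U" and X: "X = spectral_mat n U d"
    and d: "\<And>i. i < n \<Longrightarrow> 0 \<le> d i"
    using positive_op_spectral[OF assms] by blast
  let ?C = "spectral_mat n U (\<lambda>i. sqrt (d i))"
  have "X = mat_adjoint ?C * ?C"
    unfolding X spectral_mat_adjoint[OF U] spectral_mat_mult[OF U]
    using d by (intro spectral_mat_cong[OF U]) simp
  from that[OF spectral_mat_carrier[OF U] this] show ?thesis .
qed

text \<open>The weights of the hashing argument may be singular; a small multiple of the identity
  makes them invertible. The inverse belongs to the same functional calculus and is therefore
  self-adjoint.\<close>

lemma positive_op_shift_inverse:
  assumes "positive_op n A" and "0 < (\<eta> :: real)"
  obtains V where "V \<in> carrier_mat n n" "mat_adjoint V = V"
    "(A + of_real \<eta> \<cdot>\<^sub>m 1\<^sub>m n) * V = 1\<^sub>m n" "V * (A + of_real \<eta> \<cdot>\<^sub>m 1\<^sub>m n) = 1\<^sub>m n"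
proof -
  obtain U d where U: "unitary_op n U" and A: "A = spectral_mat n U d"
    and d: "\<And>i. i < n \<Longrightarrow> 0 \<le> d i"
    using positive_op_spectral[OF assms(1)] by blast
  let ?V = "spectral_mat n U (\<lambda>i. 1 / (d i + \<eta>))"
  have W: "A + of_real \<eta> \<cdot>\<^sub>m 1\<^sub>m n = spectral_mat n U (\<lambda>i. d i + \<eta>)"
    unfolding A spectral_mat_const[OF U, symmetric] spectral_mat_add[OF U] ..
  have pos: "d i + \<eta> \<noteq> 0" if "i < n" for i using d[OF that] assms(2) by simp
  note one = spectral_mat_one[OF U]
  show ?thesis
  proof (rule that[of ?V])
    show "(A + of_real \<eta> \<cdot>\<^sub>m 1\<^sub>m n) * ?V = 1\<^sub>m n" "?V * (A + of_real \<eta> \<cdot>\<^sub>m 1\<^sub>m n) = 1\<^sub>m n"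
      unfolding one[symmetric] unfolding W[unfolded one[symmetric]] spectral_mat_mult[OF U]
      by (rule spectral_mat_cong[OF U], use pos in simp)+
  qed (rule spectral_mat_carrier[OF U], rule spectral_mat_adjoint[OF U])
qed

lemma positive_op_congruence:
  assumes "positive_op n X" "B \<in> carrier_mat n m"
  shows "positive_op m (mat_adjoint B * X * B)"
proof -
  obtain C where C: "C \<in> carrier_mat n n" "X = mat_adjoint C * C"
    using positive_op_gramE[OF assms(1)] .
  have "mat_adjoint B * X * B = mat_adjoint (C * B) * (C * B)"
    unfolding C(2) mat_adjoint_mult[OF C(1) assms(2)] using C(1) assms(2)
    by (smt (verit) assoc_mult_mat mat_adjoint_carrier mult_carrier_mat)
  then show ?thesis using positive_op_gram[of "C * B" n m] C(1) assms(2) by simp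
qed

lemma positive_op_add:
  assumes "positive_op n X" "positive_op n Y"
  shows "positive_op n (X + Y)"
proof -
  have "quad_form n (X + Y) f f = quad_form n X f f + quad_form n Y f f" for f
    using assms[THEN positive_op_carrier]
    by (simp add: quad_form_def algebra_simps sum.distrib)
  then show ?thesis using assms by (simp add: positive_op_quad_form)
qed

lemma positive_op_smult:
  assumes "positive_op n X" "0 \<le> c"
  shows "positive_op n (of_real c \<cdot>\<^sub>m X)"
proof -
  have "quad_form n (of_real c \<cdot>\<^sub>m X) f f = of_real c * quad_form n X f f" for f
    using assms(1)[THEN positive_op_carrier]
    by (simp add: quad_form_def sum_distrib_left mult_ac)
  then show ?thesis using assms by (simp add: positive_op_quad_form less_eq_complex_def)
qed

section \<open>Trace inequalities for positive operators\<close>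

lemma mat_trace_positive_op:
  assumes "positive_op n X"
  shows "mat_trace X = of_real (rtrace X)" "0 \<le> rtrace X"
proof -
  obtain C where C: "C \<in> carrier_mat n n" "X = mat_adjoint C * C"
    using positive_op_gramE[OF assms] .
  show "mat_trace X = of_real (rtrace X)" "0 \<le> rtrace X"
    unfolding C(2) mat_trace_gram[OF C(1)] by (simp_all add: sum_nonneg)
qed

lemma gram_trace_eq_0:
  assumes "C \<in> carrier_mat m n" "mat_trace (mat_adjoint C * C) = 0"
  shows "C = 0\<^sub>m m n"
proof -
  have "(\<Sum>i<m. \<Sum>j<n. (cmod (C $$ (i, j)))\<^sup>2) = 0"
    using assms(2) unfolding mat_trace_gram[OF assms(1)] of_real_eq_0_iff .
  then have "\<forall>i<m. \<forall>j<n. C $$ (i, j) = 0"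
    by (simp add: sum_nonneg_eq_0_iff sum_nonneg)
  then show ?thesis using assms(1) by (intro eq_matI) auto
qed

lemma positive_op_trace_eq_0:
  assumes "positive_op n X" "rtrace X = 0"
  shows "X = 0\<^sub>m n n"
proof -
  obtain C where C: "C \<in> carrier_mat n n" "X = mat_adjoint C * C"
    using positive_op_gramE[OF assms(1)] .
  then have "C = 0\<^sub>m n n"
    using gram_trace_eq_0[OF C(1)] assms mat_trace_positive_op(1)[OF assms(1)] by simp
  then show ?thesis using C by simp
qed

text \<open>With \<open>T = mat_adjoint C * C\<close> this is Cauchy-Schwarz for the Hilbert-Schmidt
  inner product of \<open>C * mat_adjoint A\<close> and \<open>C * B\<close>. The main estimates
  below are instances of it with different weights \<open>T\<close>.\<close>

lemma trace_cauchy_schwarz: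
  assumes T: "positive_op n T" and A: "A \<in> carrier_mat m n" and B: "B \<in> carrier_mat n m"
  shows "cmod (mat_trace (A * T * B))
    \<le> sqrt (rtrace (A * T * mat_adjoint A)) * sqrt (rtrace (mat_adjoint B * T * B))"
proof -
  obtain C where C: "C \<in> carrier_mat n n" "T = mat_adjoint C * C"
    using positive_op_gramE[OF T] .
  define F where "F = C * mat_adjoint A"
  define G where "G = C * B"
  have F: "F \<in> carrier_mat n m" and G: "G \<in> carrier_mat n m"
    using C A B by (auto simp: F_def G_def)
  have aF: "mat_adjoint F = A * mat_adjoint C"
    using C(1) A by (simp add: F_def mat_adjoint_mult[of _ n n _ m])
  have aG: "mat_adjoint G = mat_adjoint B * mat_adjoint C"
    using C(1) B by (simp add: G_def mat_adjoint_mult[of _ n n _ m])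
  have aC: "mat_adjoint C \<in> carrier_mat n n" and aA: "mat_adjoint A \<in> carrier_mat n m"
    and aB: "mat_adjoint B \<in> carrier_mat m n" using C A B by auto
  have 1: "A * T * B = mat_adjoint F * G" "A * T * mat_adjoint A = mat_adjoint F * F"
    "mat_adjoint B * T * B = mat_adjoint G * G"
    unfolding aF aG unfolding F_def G_def C(2)
    using A B C(1) aC aA aB by (smt (verit) assoc_mult_mat mult_carrier_mat)+
  let ?I = "{..<m} \<times> {..<n}"
  have "mat_trace (mat_adjoint F * G) = (\<Sum>j<m. \<Sum>i<n. cnj (F $$ (i, j)) * G $$ (i, j))"
    using F G by (subst mat_trace_mult[of _ m n]) auto
  also have "\<dots> = (\<Sum>(j, i)\<in>?I. cnj (F $$ (i, j)) * G $$ (i, j))"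
    by (simp add: sum.cartesian_product)
  finally have "cmod (mat_trace (mat_adjoint F * G)) \<le> (\<Sum>(j, i)\<in>?I. \<bar>cmod (F $$ (i, j))\<bar> * \<bar>cmod (G $$ (i, j))\<bar>)"
    using norm_sum[of "\<lambda>(j, i). cnj (F $$ (i, j)) * G $$ (i, j)" ?I]
    by (simp add: case_prod_beta norm_mult)
  also have "\<dots> \<le> L2_set (\<lambda>(j, i). cmod (F $$ (i, j))) ?I * L2_set (\<lambda>(j, i). cmod (G $$ (i, j))) ?I"
    using L2_set_mult_ineq[of "\<lambda>(j, i). cmod (F $$ (i, j))" "\<lambda>(j, i). cmod (G $$ (i, j))" ?I]
    by (simp add: case_prod_beta)
  also have "L2_set (\<lambda>(j, i). cmod (F $$ (i, j))) ?I = sqrt (rtrace (mat_adjoint F * F))"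
    unfolding mat_trace_gram[OF F] L2_set_def
    by (subst sum.swap) (simp add: sum.cartesian_product case_prod_beta)
  also have "L2_set (\<lambda>(j, i). cmod (G $$ (i, j))) ?I = sqrt (rtrace (mat_adjoint G * G))"
    unfolding mat_trace_gram[OF G] L2_set_def
    by (subst sum.swap) (simp add: sum.cartesian_product case_prod_beta)
  finally show ?thesis unfolding 1 .
qed

text \<open>The difference \<open>D\<close> satisfies \<open>P * D + D * Q = 0\<close>. Multiplying
  by \<open>D\<close> and taking traces leaves two nonnegative numbers with sum zero, so
  \<open>D * P * D\<close> and \<open>D * Q * D\<close> vanish. Hence \<open>D * D * D = 0\<close>,
  and a nilpotent self-adjoint operator is zero. This gives the definite description in
  \<open>op_abs\<close> its meaning.\<close>

lemma positive_sqrt_unique: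
  assumes P: "positive_op n P" and Q: "positive_op n Q" and PQ: "P * P = Q * Q"
  shows "P = Q"
proof -
  have Pc: "P \<in> carrier_mat n n" and Qc: "Q \<in> carrier_mat n n"
    using P Q by (auto dest: positive_op_carrier)
  have hP: "mat_adjoint P = P" and hQ: "mat_adjoint Q = Q"
    using P Q by (auto dest: positive_op_hermitian)
  define D where "D = P - Q"
  have D: "D \<in> carrier_mat n n" using Pc Qc by (simp add: D_def)
  have hD: "mat_adjoint D = D" using hP hQ Pc Qc by (simp add: D_def mat_adjoint_minus[of _ n n])
  note as = assoc_mult_mat[of _ n n _ n _ n]
  have "P * D = P * P - P * Q" "D * Q = P * Q - Q * Q"
    using Pc Qc by (simp_all add: D_def mult_minus_distrib_mat[of _ n n _ n] minus_mult_distrib_mat[of _ n n _ _ n])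
  then have PD: "P * D + D * Q = 0\<^sub>m n n"
    unfolding PQ using Pc Qc by (intro eq_matI) (auto simp del: index_mult_mat(1))
  have DPD: "positive_op n (D * P * D)" and DQD: "positive_op n (D * Q * D)"
    using positive_op_congruence[OF P D] positive_op_congruence[OF Q D] by (simp_all add: hD)
  have "D * P * D + D * D * Q = D * (P * D + D * Q)"
    using D Pc Qc by (simp add: mult_add_distrib_mat[of _ n n _ n] as)
  also have "\<dots> = 0\<^sub>m n n" unfolding PD using D by simp
  finally have "mat_trace (D * P * D) + mat_trace (D * D * Q) = mat_trace (0\<^sub>m n n :: complex mat)"
    using D Pc Qc by (metis mat_trace_add square_mat_closed(1))
  moreover have "mat_trace (D * D * Q) = mat_trace (D * Q * D)"
    using D Qc mat_trace_comm[of D n n "D * Q"] by (simp add: as)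
  ultimately have "mat_trace (D * P * D) + mat_trace (D * Q * D) = 0"
    by (simp add: mat_trace_def)
  then have "rtrace (D * P * D) + rtrace (D * Q * D) = 0"
    by (metis plus_complex.sel(1) zero_complex.sel(1))
  then have z: "D * P * D = 0\<^sub>m n n" "D * Q * D = 0\<^sub>m n n"
    using positive_op_trace_eq_0[OF DPD] positive_op_trace_eq_0[OF DQD]
      mat_trace_positive_op(2)[OF DPD] mat_trace_positive_op(2)[OF DQD] by auto
  have "D * D * D = D * P * D - D * Q * D"
    using D Pc Qc
    by (subst (2) D_def) (simp add: mult_minus_distrib_mat[of _ n n _ n] minus_mult_distrib_mat[of _ n n _ _ n])
  then have D3: "D * D * D = 0\<^sub>m n n" unfolding z by simp
  have "mat_adjoint (D * D) * (D * D) = D * D * D * D"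
    using D by (simp add: mat_adjoint_mult[of _ n n _ n] hD as)
  then have "mat_adjoint (D * D) * (D * D) = 0\<^sub>m n n" unfolding D3 using D by simp
  then have "D * D = 0\<^sub>m n n"
    using gram_trace_eq_0[of "D * D" n n] D by (simp add: mat_trace_def)
  then have "D = 0\<^sub>m n n"
    using gram_trace_eq_0[of D n n] D by (simp add: mat_trace_def hD)
  then have "P $$ (i, j) - Q $$ (i, j) = 0" if "i < n" "j < n" for i j
    using that Pc Qc unfolding D_def by (metis carrier_matD index_minus_mat(1) index_zero_mat(1))
  then show ?thesis using Pc Qc by (intro eq_matI) auto
qed

text \<open>\<open>P\<close> and \<open>Q\<close> are the positive and the negative part.
  \<open>S\<close> is the sign function of \<open>Z\<close>, with value 1 on the kernel so that it
  is unitary. Through \<open>S * Z = op_abs Z\<close> the trace norm becomes a linear functional of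
  \<open>Z\<close>.\<close>

lemma hermitian_jordan_decomposition:
  assumes Z: "Z \<in> carrier_mat n n" "mat_adjoint Z = Z"
  obtains P Q S where "positive_op n P" "positive_op n Q" "unitary_op n S" "Z = P - Q"
    "S * Z = P + Q" "op_abs Z = P + Q"
proof -
  obtain U d where U: "unitary_op n U" and Zc: "Z = spectral_mat n U d"
    using hermitian_spectral[OF Z] unfolding spectral_mat_def by blast
  let ?conj = "spectral_mat n U"
  define P where "P = ?conj (\<lambda>i. max (d i) 0)"
  define Q where "Q = ?conj (\<lambda>i. max (- d i) 0)"
  define s where "s i = (if d i \<ge> 0 then 1 else - 1 :: real)" for i
  have P: "positive_op n P" and Q: "positive_op n Q" by (auto simp: P_def Q_def intro: spectral_mat_positive[OF U])
  have ss: "(\<lambda>i. s i * s i) = (\<lambda>i. 1)" by (auto simp: s_def)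
  have S: "unitary_op n (?conj s)"
    by (simp add: unitary_op_def spectral_mat_carrier[OF U] spectral_mat_adjoint[OF U] spectral_mat_mult[OF U] ss spectral_mat_one[OF U])
  have "(\<lambda>i. max (d i) 0 - max (- d i) 0) = d" by auto
  then have "Z = P - Q" unfolding Zc P_def Q_def spectral_mat_diff[OF U] by simp
  have e1: "(\<lambda>i. max (d i) 0 + max (- d i) 0) = (\<lambda>i. s i * d i)" by (auto simp: s_def)
  have SZ: "?conj s * Z = P + Q" unfolding Zc P_def Q_def spectral_mat_add[OF U] spectral_mat_mult[OF U] e1 ..
  have PQ: "positive_op n (P + Q)" using P Q by (rule positive_op_add)
  have sq: "(P + Q) * (P + Q) = mat_adjoint Z * Z"
  proof -
    have "(\<lambda>i. s i * d i * (s i * d i)) = (\<lambda>i. d i * d i)" by (auto simp: s_def)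
    then show ?thesis unfolding Z(2) unfolding SZ[symmetric] unfolding Zc spectral_mat_mult[OF U] by simp
  qed
  have "op_abs Z = P + Q"
    unfolding op_abs_def using PQ sq Z(1)
    by (intro the_equality) (auto intro: positive_sqrt_unique[of n])
  from that[OF P Q S \<open>Z = P - Q\<close> SZ this] show ?thesis .
qed

text \<open>Cauchy-Schwarz with weight \<open>P\<close>, applied to \<open>S\<close> and the
  identity; both factors equal the square root of the trace of \<open>P\<close>.\<close>

lemma trace_unitary_positive_le:
  assumes S: "unitary_op n S" and P: "positive_op n P"
  shows "cmod (mat_trace (S * P)) \<le> rtrace P"
proof -
  have Sc: "S \<in> carrier_mat n n" "mat_adjoint S * S = 1\<^sub>m n" using S by (auto simp: unitary_op_def)
  have Pc: "P \<in> carrier_mat n n" using P by (rule positive_op_carrier)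
  have "mat_trace (S * P * mat_adjoint S) = mat_trace (mat_adjoint S * (S * P))"
    using Sc Pc by (intro mat_trace_comm[of _ n n]) auto
  also have "mat_adjoint S * (S * P) = mat_adjoint S * S * P"
    using Sc(1) Pc by (simp add: assoc_mult_mat[of _ n n _ n _ n])
  also have "\<dots> = P" unfolding Sc(2) using Pc by simp
  finally have *: "mat_trace (S * P * mat_adjoint S) = mat_trace P" .
  have "cmod (mat_trace (S * P * 1\<^sub>m n))
    \<le> sqrt (rtrace P) * sqrt (rtrace P)"
    using trace_cauchy_schwarz[OF P Sc(1), of "1\<^sub>m n"] Pc by (simp add: *)
  also have "\<dots> = rtrace P" using mat_trace_positive_op(2)[OF P] by simp
  finally show ?thesis using right_mult_one_mat[of "S * P" n n] Sc Pc by simp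
qed

text \<open>The splitting \<open>A - B\<close> need not be the Jordan decomposition. A distance can
  thus be bounded by exhibiting positive operators block by block, without computing an absolute
  value.\<close>

lemma trace_dist_le:
  assumes "\<rho> \<in> carrier_mat n n" "\<sigma> \<in> carrier_mat n n"
    and A: "positive_op n A" and B: "positive_op n B" and eq: "\<rho> - \<sigma> = A - B"
  shows "trace_dist \<rho> \<sigma> \<le> (rtrace A + rtrace B) / 2"
proof -
  have c: "A \<in> carrier_mat n n" "B \<in> carrier_mat n n" using A B by (auto dest: positive_op_carrier)
  have h: "mat_adjoint (\<rho> - \<sigma>) = \<rho> - \<sigma>"
    unfolding eq using c A B by (simp add: mat_adjoint_minus[of _ n n] positive_op_hermitian)
  obtain P Q S where S: "unitary_op n S" "S * (\<rho> - \<sigma>) = P + Q" "op_abs (\<rho> - \<sigma>) = P + Q"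
    by (rule hermitian_jordan_decomposition[OF _ h, of n]) (use assms(1,2) in auto)
  have Sc: "S \<in> carrier_mat n n" using S(1) by (simp add: unitary_op_def)
  have "mat_trace (op_abs (\<rho> - \<sigma>)) = mat_trace (S * A) - mat_trace (S * B)"
    unfolding S(3) unfolding S(2)[symmetric] unfolding eq using Sc c
    by (simp add: mult_minus_distrib_mat[of _ n n _ n] mat_trace_minus[of _ n])
  then have "rtrace (op_abs (\<rho> - \<sigma>)) \<le> cmod (mat_trace (S * A)) + cmod (mat_trace (S * B))"
    using complex_Re_le_cmod[of "mat_trace (S * A)"] complex_Re_le_cmod[of "- mat_trace (S * B)"]
    by simp
  also have "\<dots> \<le> rtrace A + rtrace B"
    by (intro add_mono trace_unitary_positive_le[OF S(1)] A B)
  finally show ?thesis by (simp add: trace_dist_def)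
qed

lemma trace_dist_decomposition:
  assumes "\<rho> \<in> carrier_mat n n" "\<sigma> \<in> carrier_mat n n" "mat_adjoint \<rho> = \<rho>" "mat_adjoint \<sigma> = \<sigma>"
  obtains P Q where "positive_op n P" "positive_op n Q" "\<rho> - \<sigma> = P - Q"
    "2 * trace_dist \<rho> \<sigma> = rtrace P + rtrace Q"
proof -
  have h: "mat_adjoint (\<rho> - \<sigma>) = \<rho> - \<sigma>" using assms by (simp add: mat_adjoint_minus[of _ n n])
  obtain P Q S where 1: "positive_op n P" "positive_op n Q" "\<rho> - \<sigma> = P - Q"
    "op_abs (\<rho> - \<sigma>) = P + Q"
    by (rule hermitian_jordan_decomposition[OF _ h, of n]) (use assms in auto)
  have "2 * trace_dist \<rho> \<sigma> = rtrace P + rtrace Q"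
    using 1(4) mat_trace_add[of P n Q] 1(1,2)[THEN positive_op_carrier] by (simp add: trace_dist_def)
  then show ?thesis using that 1 by blast
qed

text \<open>The unitary \<open>S\<close> turns the trace norm of a sum over raw keys into a linear
  expression, which can be split term by term before absolute values are taken.\<close>

lemma hermitian_trace_norm:
  assumes Z: "Z \<in> carrier_mat n n" "mat_adjoint Z = Z"
  obtains P Q S where "positive_op n P" "positive_op n Q" "Z = P - Q" "unitary_op n S"
    "rtrace P + rtrace Q = rtrace (S * Z)"
proof -
  obtain P Q S where 1: "positive_op n P" "positive_op n Q" "unitary_op n S" "Z = P - Q"
    "S * Z = P + Q"
    using hermitian_jordan_decomposition[OF Z] .
  have "rtrace P + rtrace Q = rtrace (S * Z)"
    using 1(5) mat_trace_add[of P n Q] 1(1,2)[THEN positive_op_carrier] by simp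
  then show ?thesis using that 1 by blast
qed

lemma trace_dist_nonneg:
  assumes "\<rho> \<in> carrier_mat n n" "\<sigma> \<in> carrier_mat n n" "mat_adjoint \<rho> = \<rho>" "mat_adjoint \<sigma> = \<sigma>"
  shows "0 \<le> trace_dist \<rho> \<sigma>"
proof -
  obtain P Q where "positive_op n P" "positive_op n Q"
    "2 * trace_dist \<rho> \<sigma> = rtrace P + rtrace Q"
    using trace_dist_decomposition[OF assms] .
  then show ?thesis using mat_trace_positive_op(2)[of n P] mat_trace_positive_op(2)[of n Q] by linarith
qed

section \<open>Privacy amplification\<close>

text \<open>The size \<open>n\<close> is a parameter because the empty sum has to be a matrix of a
  definite size.\<close>

definition mat_sum :: "nat \<Rightarrow> ('k \<Rightarrow> complex mat) \<Rightarrow> 'k set \<Rightarrow> complex mat" where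
  "mat_sum n x I = mat n n (\<lambda>ij. \<Sum>k\<in>I. x k $$ ij)"

lemma mat_sum_carrier [simp]: "mat_sum n x I \<in> carrier_mat n n"
  by (simp add: mat_sum_def)

lemma index_mat_sum [simp]:
  "i < n \<Longrightarrow> j < n \<Longrightarrow> mat_sum n x I $$ (i, j) = (\<Sum>k\<in>I. x k $$ (i, j))"
  by (simp add: mat_sum_def)

lemma dim_mat_sum [simp]: "dim_row (mat_sum n x I) = n" "dim_col (mat_sum n x I) = n"
  by (simp_all add: mat_sum_def)

lemma positive_op_mat_sum:
  assumes "\<And>k. k \<in> I \<Longrightarrow> positive_op n (x k)"
  shows "positive_op n (mat_sum n x I)"
proof -
  have "quad_form n (mat_sum n x I) f f = (\<Sum>k\<in>I. quad_form n (x k) f f)" for f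
  proof -
    have "quad_form n (mat_sum n x I) f f = (\<Sum>i<n. \<Sum>j<n. \<Sum>k\<in>I. cnj (f i) * x k $$ (i, j) * f j)"
      unfolding quad_form_def
      by (intro sum.cong refl) (simp add: sum_distrib_left sum_distrib_right)
    also have "\<dots> = (\<Sum>i<n. \<Sum>k\<in>I. \<Sum>j<n. cnj (f i) * x k $$ (i, j) * f j)"
      by (intro sum.cong refl sum.swap)
    also have "\<dots> = (\<Sum>k\<in>I. quad_form n (x k) f f)"
      unfolding quad_form_def by (rule sum.swap)
    finally show ?thesis .
  qed
  then show ?thesis
    using assms unfolding positive_op_quad_form by (auto intro!: sum_nonneg)
qed

lemma mat_trace_mult_mat_sum:
  assumes "A \<in> carrier_mat n n" "\<And>k. k \<in> I \<Longrightarrow> x k \<in> carrier_mat n n"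
  shows "mat_trace (A * mat_sum n x I) = (\<Sum>k\<in>I. mat_trace (A * x k))"
proof -
  have "mat_trace (A * mat_sum n x I) = (\<Sum>i<n. \<Sum>j<n. \<Sum>k\<in>I. A $$ (i, j) * x k $$ (j, i))"
    unfolding mat_trace_mult[OF assms(1) mat_sum_carrier]
    by (intro sum.cong refl) (simp add: sum_distrib_left)
  also have "\<dots> = (\<Sum>i<n. \<Sum>k\<in>I. \<Sum>j<n. A $$ (i, j) * x k $$ (j, i))"
    by (intro sum.cong refl sum.swap)
  also have "\<dots> = (\<Sum>k\<in>I. \<Sum>i<n. \<Sum>j<n. A $$ (i, j) * x k $$ (j, i))"
    by (rule sum.swap)
  also have "\<dots> = (\<Sum>k\<in>I. mat_trace (A * x k))"
    using assms by (intro sum.cong refl) (simp add: mat_trace_mult[of _ n n])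
  finally show ?thesis .
qed

lemma mat_trace_mat_sum:
  assumes "\<And>k. k \<in> I \<Longrightarrow> x k \<in> carrier_mat n n"
  shows "mat_trace (mat_sum n x I) = (\<Sum>k\<in>I. mat_trace (x k))"
  using mat_trace_mult_mat_sum[of "1\<^sub>m n" n I x] assms
  by (simp add: left_mult_one_mat[of _ n n] cong: sum.cong)

lemma positive_op_diff_trace_mono:
  assumes "positive_op n (Y - X)" "X \<in> carrier_mat n n" "Y \<in> carrier_mat n n" "B \<in> carrier_mat n n"
  shows "rtrace (mat_adjoint B * X * B) \<le> rtrace (mat_adjoint B * Y * B)"
proof -
  have "mat_adjoint B * (Y - X) * B = mat_adjoint B * Y * B - mat_adjoint B * X * B"
    using assms(2-4)
    by (simp add: mult_minus_distrib_mat[of _ n n _ n] minus_mult_distrib_mat[of _ n n _ _ n])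
  then have "mat_trace (mat_adjoint B * (Y - X) * B)
      = mat_trace (mat_adjoint B * Y * B) - mat_trace (mat_adjoint B * X * B)"
    using assms(2-4) by (simp add: mat_trace_minus[of _ n])
  moreover have "0 \<le> rtrace (mat_adjoint B * (Y - X) * B)"
    using positive_op_congruence[OF assms(1,4)] by (rule mat_trace_positive_op(2))
  ultimately show ?thesis by simp
qed

text \<open>Let q = tr(x V x). Cauchy-Schwarz with weight \<open>x\<close> gives q^2 <= tr(x) tr(x V
  x V x). By x <= c W and V W V = V the last trace is at most c q, and q cancels. No square root of
  the weight \<open>W\<close> is taken.\<close>

lemma trace_inverse_weight_le:
  assumes x: "positive_op n x" and W: "positive_op n W" and le: "positive_op n (of_real c \<cdot>\<^sub>m W - x)"
    and V: "V \<in> carrier_mat n n" "mat_adjoint V = V" "W * V = 1\<^sub>m n" "V * W = 1\<^sub>m n" and c: "0 \<le> c"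
  shows "rtrace (x * V * x) \<le> c * rtrace x"
proof -
  have xc: "x \<in> carrier_mat n n" and Wc: "W \<in> carrier_mat n n"
    using x W by (auto dest: positive_op_carrier)
  have hx: "mat_adjoint x = x" using x by (rule positive_op_hermitian)
  note as = assoc_mult_mat[of _ n n _ n _ n]
  define q where "q = rtrace (x * V * x)"
  have aVx: "mat_adjoint (V * x) = x * V"
    using V xc hx by (simp add: mat_adjoint_mult[of _ n n _ n])
  have xVWVx: "mat_adjoint (V * x) * W * (V * x) = x * V * x"
  proof -
    have "mat_adjoint (V * x) * W * (V * x) = x * (V * W) * (V * x)"
      unfolding aVx using V(1) xc Wc by (simp add: as)
    then show ?thesis unfolding V(4) using V(1) xc by (simp add: as)
  qed
  have q0: "0 \<le> q"
    using mat_trace_positive_op(2)[OF positive_op_congruence[OF W, of "V * x" n]] V(1) xc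
    unfolding xVWVx q_def by simp
  have "rtrace (mat_adjoint (V * x) * x * (V * x))
      \<le> rtrace (mat_adjoint (V * x) * (of_real c \<cdot>\<^sub>m W) * (V * x))"
    using V(1) xc Wc by (intro positive_op_diff_trace_mono[OF le]) auto
  also have "mat_adjoint (V * x) * (of_real c \<cdot>\<^sub>m W) * (V * x)
      = of_real c \<cdot>\<^sub>m (mat_adjoint (V * x) * W * (V * x))"
    unfolding aVx using V(1) xc Wc
    by (simp add: mult_smult_distrib[of _ n n _ n] mult_smult_assoc_mat[of _ n n _ n])
  also have "rtrace \<dots> = c * q"
    unfolding xVWVx using V(1) xc by (simp add: mat_trace_smult[of _ n] q_def)
  finally have 1: "rtrace (mat_adjoint (V * x) * x * (V * x)) \<le> c * q" .
  have "q \<le> cmod (mat_trace (1\<^sub>m n * x * (V * x)))"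
  proof -
    have "1\<^sub>m n * x * (V * x) = x * V * x" using V(1) xc by (simp add: as)
    then show ?thesis unfolding q_def using complex_Re_le_cmod by metis
  qed
  also have "\<dots> \<le> sqrt (rtrace x) * sqrt (rtrace (mat_adjoint (V * x) * x * (V * x)))"
    using trace_cauchy_schwarz[OF x, of "1\<^sub>m n" n "V * x"] V(1) xc by (simp add: hx)
  also have "\<dots> \<le> sqrt (rtrace x) * sqrt (c * q)"
    using 1 mat_trace_positive_op(2)[OF x] by (intro mult_left_mono) auto
  finally have "q\<^sup>2 \<le> (sqrt (rtrace x) * sqrt (c * q))\<^sup>2"
    using q0 by (intro power_mono) auto
  also have "\<dots> = (c * rtrace x) * q"
    using mat_trace_positive_op(2)[OF x] c q0 by (simp add: power_mult_distrib)
  finally have "q * q \<le> (c * rtrace x) * q" by (simp add: power2_eq_square)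
  then show ?thesis
    using q0 c mat_trace_positive_op(2)[OF x] unfolding q_def[symmetric]
    by (cases "q = 0") auto
qed

text \<open>A greedy choice of \<open>f\<close>: the cross terms created by a new element \<open>k\<close> sum to zero over the
  possible values \<open>f k\<close>, so for one of these values they are not positive.\<close>

lemma balanced_hash_exists:
  fixes g :: "'k \<Rightarrow> 'i \<Rightarrow> complex"
  assumes "finite K" "0 < m" "finite I"
  shows "\<exists>f. (\<forall>k\<in>K. f k < m) \<and>
    (\<Sum>a<m. \<Sum>i\<in>I. (cmod (\<Sum>k\<in>K. of_real (of_bool (f k = a) - 1 / real m) * g k i))\<^sup>2)
      \<le> (1 - 1 / real m) * (\<Sum>k\<in>K. \<Sum>i\<in>I. (cmod (g k i))\<^sup>2)"
  using assms(1)
proof (induction K rule: finite_induct)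
  case empty
  then show ?case by simp
next
  case (insert k0 K)
  define c where "c f k a = of_bool (f k = a) - 1 / real m" for f :: "'k \<Rightarrow> nat" and k a
  obtain f where f: "\<forall>k\<in>K. f k < m" and
    le: "(\<Sum>a<m. \<Sum>i\<in>I. (cmod (\<Sum>k\<in>K. of_real (c f k a) * g k i))\<^sup>2)
      \<le> (1 - 1 / real m) * (\<Sum>k\<in>K. \<Sum>i\<in>I. (cmod (g k i))\<^sup>2)"
    using insert.IH unfolding c_def by blast
  define z where "z a i = (\<Sum>k\<in>K. of_real (c f k a) * g k i)" for a i
  have c_sum: "(\<Sum>a<m. c h k a) = 0" if "h k < m" for h k
    using that assms(2) by (simp add: c_def sum_subtractf of_bool_def)
  have z_sum: "(\<Sum>a<m. z a i) = 0" for i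
  proof -
    have "(\<Sum>a<m. z a i) = (\<Sum>k\<in>K. of_real (\<Sum>a<m. c f k a) * g k i)"
      unfolding z_def of_real_sum sum_distrib_right by (rule sum.swap)
    then show ?thesis using f by (simp add: c_sum)
  qed
  define r where "r a = (\<Sum>i\<in>I. Re (z a i * cnj (g k0 i)))" for a
  have r_sum: "(\<Sum>a<m. r a) = 0"
  proof -
    have "(\<Sum>a<m. r a) = (\<Sum>i\<in>I. Re ((\<Sum>a<m. z a i) * cnj (g k0 i)))"
      unfolding r_def Re_sum[symmetric] sum_distrib_right by (subst sum.swap) (simp add: Re_sum)
    then show ?thesis by (simp add: z_sum)
  qed
  obtain a0 where a0: "a0 < m" "r a0 \<le> 0"
  proof (rule ccontr)
    assume "\<not> thesis"
    then have "\<And>a. a < m \<Longrightarrow> r a > 0" using that by force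
    then have "(\<Sum>a<m. r a) > 0" using assms(2) by (intro sum_pos) auto
    then show False using r_sum by simp
  qed
  define f' where "f' = f(k0 := a0)"
  define c0 where "c0 a = c f' k0 a" for a
  have c0: "c0 a = of_bool (a0 = a) - 1 / real m" for a by (simp add: c0_def c_def f'_def)
  have delta: "of_bool (a0 = a) * y = (if a = a0 then y else 0)" for a and y :: real by simp
  have split: "(\<Sum>k\<in>insert k0 K. of_real (c f' k a) * g k i) = z a i + of_real (c0 a) * g k0 i" for a i
  proof -
    have "(\<Sum>k\<in>K. of_real (c f' k a) * g k i) = z a i"
      unfolding z_def using insert.hyps by (intro sum.cong refl) (auto simp: c_def f'_def)
    then show ?thesis using insert.hyps by (simp add: c0_def)
  qed
  have sq: "(cmod (u + of_real t * v))\<^sup>2 = (cmod u)\<^sup>2 + 2 * t * Re (u * cnj v) + t\<^sup>2 * (cmod v)\<^sup>2" for u v t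
    unfolding cmod_power2 by (simp add: power2_eq_square algebra_simps)
  have "(\<Sum>a<m. \<Sum>i\<in>I. (cmod (z a i + of_real (c0 a) * g k0 i))\<^sup>2)
      = (\<Sum>a<m. (\<Sum>i\<in>I. (cmod (z a i))\<^sup>2) + 2 * c0 a * r a + (c0 a)\<^sup>2 * (\<Sum>i\<in>I. (cmod (g k0 i))\<^sup>2))"
    by (simp only: sq r_def sum.distrib sum_distrib_left)
  also have "\<dots> = (\<Sum>a<m. \<Sum>i\<in>I. (cmod (z a i))\<^sup>2) + 2 * (\<Sum>a<m. c0 a * r a)
      + (\<Sum>a<m. (c0 a)\<^sup>2) * (\<Sum>i\<in>I. (cmod (g k0 i))\<^sup>2)"
    by (simp only: sum.distrib sum_distrib_left[symmetric] sum_distrib_right[symmetric] mult.assoc)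
  \<comment> \<open>The cross terms for the value \<open>a0\<close> reduce to \<open>r a0\<close>,
    because the constant \<open>1 / real m\<close> is paired with a family of sum zero.\<close>
  also have "(\<Sum>a<m. c0 a * r a) = r a0"
  proof -
    have "(\<Sum>a<m. c0 a * r a) = (\<Sum>a<m. of_bool (a0 = a) * r a) - (\<Sum>a<m. r a) / real m"
      unfolding c0 by (simp add: left_diff_distrib sum_subtractf sum_divide_distrib)
    then show ?thesis using a0(1) r_sum unfolding delta by simp
  qed
  \<comment> \<open>This square norm of a centred indicator on \<open>m\<close> points is the
    increase per new element, so the constant of the induction hypothesis is reproduced
    exactly.\<close>
  also have "(\<Sum>a<m. (c0 a)\<^sup>2) = 1 - 1 / real m"
  proof -
    have "(c0 a)\<^sup>2 = of_bool (a0 = a) * (1 - 2 / real m) + 1 / (real m)\<^sup>2" for a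
      unfolding c0 by (cases "a0 = a") (simp_all add: power2_diff power_divide)
    then have "(\<Sum>a<m. (c0 a)\<^sup>2) = (1 - 2 / real m) + real m * (1 / (real m)\<^sup>2)"
      using a0(1) unfolding delta by (simp add: sum.distrib)
    then show ?thesis using assms(2) by (simp add: power2_eq_square field_simps)
  qed
  also have "(\<Sum>a<m. \<Sum>i\<in>I. (cmod (z a i))\<^sup>2) + 2 * r a0 + (1 - 1 / real m) * (\<Sum>i\<in>I. (cmod (g k0 i))\<^sup>2)
      \<le> (1 - 1 / real m) * (\<Sum>k\<in>insert k0 K. \<Sum>i\<in>I. (cmod (g k i))\<^sup>2)"
    using le a0(2) insert.hyps by (simp add: z_def distrib_left)
  finally have "(\<Sum>a<m. \<Sum>i\<in>I. (cmod (\<Sum>k\<in>insert k0 K. of_real (c f' k a) * g k i))\<^sup>2)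
      \<le> (1 - 1 / real m) * (\<Sum>k\<in>insert k0 K. \<Sum>i\<in>I. (cmod (g k i))\<^sup>2)"
    unfolding split .
  moreover have "\<forall>k\<in>insert k0 K. f' k < m" using f a0(1) by (auto simp: f'_def)
  ultimately show ?case unfolding c_def by blast
qed

section \<open>Hashing with operator weights\<close>

lemma positive_op_one: "positive_op n (1\<^sub>m n)"
  using positive_op_gram[of "1\<^sub>m n" n n] by simp

lemma mat_trace_unitary_conj:
  assumes "unitary_op n S" "X \<in> carrier_mat n n"
  shows "mat_trace (S * X * mat_adjoint S) = mat_trace X"
proof -
  have S: "S \<in> carrier_mat n n" "mat_adjoint S * S = 1\<^sub>m n" using assms by (auto simp: unitary_op_def)
  have "mat_trace (S * X * mat_adjoint S) = mat_trace (mat_adjoint S * (S * X))"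
    using S assms by (intro mat_trace_comm[of _ n n]) auto
  also have "mat_adjoint S * (S * X) = mat_adjoint S * S * X"
    using S(1) assms by (simp add: assoc_mult_mat[of _ n n _ n _ n])
  also have "\<dots> = X" unfolding S(2) using assms by simp
  finally show ?thesis .
qed

text \<open>With \<open>W\<^sub>k = T + P\<^sub>k\<close> one has \<open>x\<^sub>k = T V\<^sub>k x\<^sub>k + P\<^sub>k V\<^sub>k x\<^sub>k\<close>.  Smoothing \<open>x\<^sub>k\<close> on one
  side only avoids matrix square roots: the first part is controlled by Cauchy-Schwarz with
  weight \<open>T\<close>, the second by Cauchy-Schwarz with weight \<open>x\<^sub>k\<close>.\<close>

lemma weighted_sum_trace_norm_le:
  fixes w :: "'k \<Rightarrow> real"
  assumes C: "C \<in> carrier_mat n n" and T: "T = mat_adjoint C * C"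
    and P: "\<And>k. k \<in> K \<Longrightarrow> positive_op n (P k)"
    and x: "\<And>k. k \<in> K \<Longrightarrow> positive_op n (x k)"
    and V: "\<And>k. k \<in> K \<Longrightarrow> V k \<in> carrier_mat n n" "\<And>k. k \<in> K \<Longrightarrow> mat_adjoint (V k) = V k"
      "\<And>k. k \<in> K \<Longrightarrow> (T + P k) * V k = 1\<^sub>m n"
  shows "\<exists>A B. positive_op n A \<and> positive_op n B \<and>
    A - B = mat_sum n (\<lambda>k. of_real (w k) \<cdot>\<^sub>m x k) K \<and>
    rtrace A + rtrace B
      \<le> sqrt (rtrace T) *
          sqrt (\<Sum>i<n. \<Sum>j<n. (cmod (\<Sum>k\<in>K. of_real (w k) * (C * (V k * x k)) $$ (i, j)))\<^sup>2) +
        (\<Sum>k\<in>K. \<bar>w k\<bar> * (sqrt (rtrace (P k * V k * x k * V k * P k)) * sqrt (rtrace (x k))))"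
proof -
  note as = assoc_mult_mat[of _ n n _ n _ n]
  have xc: "x k \<in> carrier_mat n n" and Pc: "P k \<in> carrier_mat n n" if "k \<in> K" for k
    using x P that by (auto dest: positive_op_carrier)
  have xd: "dim_row (x k) = n" "dim_col (x k) = n" if "k \<in> K" for k using xc[OF that] by auto
  have Tc: "T \<in> carrier_mat n n" using C by (simp add: T)
  define Z where "Z = mat_sum n (\<lambda>k. of_real (w k) \<cdot>\<^sub>m x k) K"
  have "mat_adjoint Z = Z"
  proof (rule eq_matI)
    fix i j assume "i < dim_row Z" "j < dim_col Z"
    then have ij: "i < n" "j < n" by (auto simp: Z_def)
    have "cnj (x k $$ (j, i)) = x k $$ (i, j)" if "k \<in> K" for k
      using positive_op_hermitian[OF x[OF that]] xc[OF that] ij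
      by (metis carrier_matD conjugate_complex_def index_mat_adjoint)
    then show "mat_adjoint Z $$ (i, j) = Z $$ (i, j)"
      using ij xd by (simp add: Z_def cong: sum.cong)
  qed (auto simp: Z_def)
  then obtain A B S where AB: "positive_op n A" "positive_op n B" "Z = A - B" and S: "unitary_op n S"
    and tr: "rtrace A + rtrace B = rtrace (S * Z)"
    using hermitian_trace_norm[of Z n] by (auto simp: Z_def)
  have Sc: "S \<in> carrier_mat n n" using S by (simp add: unitary_op_def)
  \<comment> \<open>The factorisation of \<open>T\<close> is distributed over both sides: the trace
    of \<open>S T V_k x_k\<close> becomes the inner product of a fixed \<open>h\<close> with
    \<open>y k\<close>. The sum over \<open>k\<close> then acts on the \<open>y k\<close> alone, and
    \<open>S\<close>, which depends on the weights \<open>w\<close>, drops out of the norm of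
    \<open>h\<close>.\<close>
  define h where "h = C * mat_adjoint S"
  define y where "y k = C * (V k * x k)" for k
  define G where "G = mat_sum n (\<lambda>k. of_real (w k) \<cdot>\<^sub>m y k) K"
  have hc: "h \<in> carrier_mat n n" and yc: "k \<in> K \<Longrightarrow> y k \<in> carrier_mat n n" for k
    using C Sc V(1) xc by (auto simp: h_def y_def)
  have Gc: "G \<in> carrier_mat n n" by (simp add: G_def)
  have ah: "mat_adjoint h = S * mat_adjoint C"
    using C Sc by (simp add: h_def mat_adjoint_mult[of _ n n _ n])
  have Sx: "mat_trace (S * x k) = mat_trace (mat_adjoint h * y k) + mat_trace (S * P k * V k * x k)"
    if k: "k \<in> K" for k
  proof -
    have "S * x k = S * (((T + P k) * V k) * x k)" unfolding V(3)[OF k] using xc[OF k] by simp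
    also have "\<dots> = S * T * V k * x k + S * P k * V k * x k"
      using Sc Tc Pc[OF k] V(1)[OF k] xc[OF k]
      by (simp add: as add_mult_distrib_mat[of _ n n _ _ n] mult_add_distrib_mat[of _ n n _ n])
    also have "S * T * V k * x k = mat_adjoint h * y k"
      unfolding ah y_def T using C Sc V(1)[OF k] xc[OF k] by (simp add: as)
    finally show ?thesis
      using Sc Pc[OF k] V(1)[OF k] xc[OF k] hc yc[OF k] by (simp add: mat_trace_add[of _ n])
  qed
  have "mat_trace (S * Z) = (\<Sum>k\<in>K. of_real (w k) * mat_trace (S * x k))"
    unfolding Z_def using Sc xc
    by (subst mat_trace_mult_mat_sum)
      (auto simp: mult_smult_distrib[of _ n n _ n] mat_trace_smult[of _ n] intro!: sum.cong)
  also have "\<dots> = (\<Sum>k\<in>K. of_real (w k) * mat_trace (mat_adjoint h * y k)) +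
      (\<Sum>k\<in>K. of_real (w k) * mat_trace (S * P k * V k * x k))"
    by (simp add: Sx distrib_left sum.distrib)
  also have "(\<Sum>k\<in>K. of_real (w k) * mat_trace (mat_adjoint h * y k)) = mat_trace (mat_adjoint h * G)"
    unfolding G_def using hc yc
    by (subst mat_trace_mult_mat_sum)
      (auto simp: mult_smult_distrib[of _ n n _ n] mat_trace_smult[of _ n] intro!: sum.cong)
  finally have 1: "rtrace (S * Z) \<le> cmod (mat_trace (mat_adjoint h * G)) +
      cmod (\<Sum>k\<in>K. of_real (w k) * mat_trace (S * P k * V k * x k))"
    by (simp only: order_trans[OF complex_Re_le_cmod norm_triangle_ineq])
  have 2: "cmod (mat_trace (mat_adjoint h * G))
      \<le> sqrt (rtrace T) * sqrt (\<Sum>i<n. \<Sum>j<n. (cmod (G $$ (i, j)))\<^sup>2)"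
  proof -
    have "mat_adjoint h * h = S * T * mat_adjoint S"
      unfolding ah unfolding h_def T using C Sc by (simp add: as)
    then have "mat_trace (mat_adjoint h * h) = mat_trace T"
      using mat_trace_unitary_conj[OF S Tc] by simp
    then show ?thesis
      using trace_cauchy_schwarz[OF positive_op_one, of "mat_adjoint h" n n G] hc Gc
      by (simp add: mat_trace_gram[of _ n n])
  qed
  have 3: "(\<Sum>i<n. \<Sum>j<n. (cmod (G $$ (i, j)))\<^sup>2)
    = (\<Sum>i<n. \<Sum>j<n. (cmod (\<Sum>k\<in>K. of_real (w k) * y k $$ (i, j)))\<^sup>2)"
  proof -
    have "G $$ (i, j) = (\<Sum>k\<in>K. of_real (w k) * y k $$ (i, j))" if "i < n" "j < n" for i j
    proof -
      have "(of_real (w k) \<cdot>\<^sub>m y k) $$ (i, j) = of_real (w k) * y k $$ (i, j)" if "k \<in> K" for k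
        using yc[OF that] \<open>i < n\<close> \<open>j < n\<close> by simp
      then show ?thesis unfolding G_def using that by simp
    qed
    then show ?thesis by simp
  qed
  \<comment> \<open>No cancellation between different \<open>k\<close> is exploited for the surplus
    parts. In the application the operators \<open>P k\<close> are small in trace, so the triangle
    inequality is good enough.\<close>
  have "cmod (\<Sum>k\<in>K. of_real (w k) * mat_trace (S * P k * V k * x k))
    \<le> (\<Sum>k\<in>K. \<bar>w k\<bar> * cmod (mat_trace (S * P k * V k * x k)))"
    using norm_sum[of "\<lambda>k. of_real (w k) * mat_trace (S * P k * V k * x k)" K] by (simp add: norm_mult)
  also have "\<dots> \<le> (\<Sum>k\<in>K. \<bar>w k\<bar> * (sqrt (rtrace (P k * V k * x k * V k * P k)) * sqrt (rtrace (x k))))"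
  proof (intro sum_mono mult_left_mono)
    fix k assume k: "k \<in> K"
    note c = Sc Pc[OF k] V(1)[OF k] xc[OF k]
    have adj: "mat_adjoint (S * P k * V k) = V k * P k * mat_adjoint S"
      using c V(2)[OF k] positive_op_hermitian[OF P[OF k]]
      by (simp add: mat_adjoint_mult[of _ n n _ n] as)
    have "S * P k * V k * x k * mat_adjoint (S * P k * V k)
        = S * (P k * V k * x k * V k * P k) * mat_adjoint S"
      unfolding adj using c by (simp add: as)
    then have "mat_trace (S * P k * V k * x k * mat_adjoint (S * P k * V k))
        = mat_trace (P k * V k * x k * V k * P k)"
      using mat_trace_unitary_conj[OF S, of "P k * V k * x k * V k * P k"] c by simp
    then show "cmod (mat_trace (S * P k * V k * x k))
        \<le> sqrt (rtrace (P k * V k * x k * V k * P k)) * sqrt (rtrace (x k))"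
      using trace_cauchy_schwarz[OF x[OF k], of "S * P k * V k" n "1\<^sub>m n"] c
      by (simp add: right_mult_one_mat[of _ n n])
  qed auto
  finally have "rtrace A + rtrace B
      \<le> sqrt (rtrace T) *
          sqrt (\<Sum>i<n. \<Sum>j<n. (cmod (\<Sum>k\<in>K. of_real (w k) * (C * (V k * x k)) $$ (i, j)))\<^sup>2) +
        (\<Sum>k\<in>K. \<bar>w k\<bar> * (sqrt (rtrace (P k * V k * x k * V k * P k)) * sqrt (rtrace (x k))))"
    using 1 2 unfolding 3 y_def tr by linarith
  with AB(1,2) AB(3)[symmetric] show ?thesis
    unfolding Z_def by (intro exI[of _ A] exI[of _ B] conjI)
qed

text \<open>A leftover hash lemma under the bound \<open>x k \<le> c (T + P k)\<close>. The hash is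
  balanced for the entries of \<open>C * (V k * x k)\<close>, whose squared Hilbert-Schmidt norms
  are at most \<open>c\<close> times the trace of \<open>x k\<close>; the surplus \<open>P k\<close>
  is charged once per raw key. With \<open>m - 1\<close> in place of \<open>m\<close> the main term
  vanishes for \<open>m = 1\<close>.\<close>

lemma hash_trace_norm_le:
  fixes x :: "'k \<Rightarrow> complex mat"
  assumes K: "finite K" and m: "0 < m" and T: "positive_op n T" and c: "0 \<le> c"
    and P: "\<And>k. k \<in> K \<Longrightarrow> positive_op n (P k)"
    and x: "\<And>k. k \<in> K \<Longrightarrow> positive_op n (x k)"
    and le: "\<And>k. k \<in> K \<Longrightarrow> positive_op n (of_real c \<cdot>\<^sub>m (T + P k) - x k)"
    and V: "\<And>k. k \<in> K \<Longrightarrow> V k \<in> carrier_mat n n" "\<And>k. k \<in> K \<Longrightarrow> mat_adjoint (V k) = V k"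
      "\<And>k. k \<in> K \<Longrightarrow> (T + P k) * V k = 1\<^sub>m n" "\<And>k. k \<in> K \<Longrightarrow> V k * (T + P k) = 1\<^sub>m n"
  shows "\<exists>f A B. (\<forall>k\<in>K. f k < m) \<and>
    (\<forall>a<m. positive_op n (A a) \<and> positive_op n (B a) \<and>
      A a - B a = mat_sum n (\<lambda>k. of_real (of_bool (f k = a) - 1 / real m) \<cdot>\<^sub>m x k) K) \<and>
    (\<Sum>a<m. rtrace (A a) + rtrace (B a))
      \<le> sqrt ((real m - 1) * rtrace T * c * (\<Sum>k\<in>K. rtrace (x k))) +
        2 * (\<Sum>k\<in>K. sqrt (rtrace (P k * V k * x k * V k * P k)) * sqrt (rtrace (x k)))"
proof -
  note as = assoc_mult_mat[of _ n n _ n _ n]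
  obtain C where C: "C \<in> carrier_mat n n" "T = mat_adjoint C * C"
    using positive_op_gramE[OF T] .
  have Tc: "T \<in> carrier_mat n n" using T by (rule positive_op_carrier)
  have xc: "x k \<in> carrier_mat n n" and Pc: "P k \<in> carrier_mat n n" if "k \<in> K" for k
    using x P that by (auto dest: positive_op_carrier)
  define g where "g k ij = (C * (V k * x k)) $$ ij" for k ij
  have gk: "(\<Sum>ij\<in>{..<n} \<times> {..<n}. (cmod (g k ij))\<^sup>2) \<le> c * rtrace (x k)" if k: "k \<in> K" for k
  proof -
    note cs = Tc xc[OF k] Pc[OF k] V(1)[OF k] C(1)
    let ?B = "V k * x k"
    have aB: "mat_adjoint ?B = x k * V k"
      using cs V(2)[OF k] positive_op_hermitian[OF x[OF k]] by (simp add: mat_adjoint_mult[of _ n n _ n])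
    have "(\<Sum>ij\<in>{..<n} \<times> {..<n}. (cmod (g k ij))\<^sup>2) = rtrace (mat_adjoint (C * ?B) * (C * ?B))"
      using cs by (subst mat_trace_gram[of _ n n]) (auto simp: g_def sum.cartesian_product case_prod_beta simp del: index_mult_mat(1))
    also have "mat_adjoint (C * ?B) * (C * ?B) = mat_adjoint ?B * T * ?B"
      unfolding C(2) using cs by (simp add: mat_adjoint_mult[of _ n n _ n] as)
    \<comment> \<open>Enlarging \<open>T\<close> to \<open>T + P k\<close> lets one of the two
      inverses \<open>V k\<close> cancel.\<close>
    also have "rtrace (mat_adjoint ?B * T * ?B) \<le> rtrace (mat_adjoint ?B * (T + P k) * ?B)"
    proof (rule positive_op_diff_trace_mono)
      have "T + P k - T = P k" using cs by (intro eq_matI) auto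
      then show "positive_op n (T + P k - T)" using P[OF k] by simp
    qed (use cs in auto)
    also have "mat_adjoint ?B * (T + P k) * ?B = x k * (V k * (T + P k)) * (V k * x k)"
      unfolding aB using cs by (simp add: as)
    also have "\<dots> = x k * V k * x k"
      unfolding V(4)[OF k] using cs by (simp add: as)
    also have "rtrace (x k * V k * x k) \<le> c * rtrace (x k)"
      using k by (intro trace_inverse_weight_le[OF x positive_op_add[OF T P] le] V c) auto
    finally show ?thesis .
  qed
  obtain f where f: "\<forall>k\<in>K. f k < m" and
    fle: "(\<Sum>a<m. \<Sum>ij\<in>{..<n} \<times> {..<n}. (cmod (\<Sum>k\<in>K. of_real (of_bool (f k = a) - 1 / real m) * g k ij))\<^sup>2)
      \<le> (1 - 1 / real m) * (\<Sum>k\<in>K. \<Sum>ij\<in>{..<n} \<times> {..<n}. (cmod (g k ij))\<^sup>2)"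
    using balanced_hash_exists[OF K m, of "{..<n} \<times> {..<n}" g] by blast
  define w where "w a k = of_bool (f k = a) - 1 / real m" for a k
  define e where "e k = sqrt (rtrace (P k * V k * x k * V k * P k)) * sqrt (rtrace (x k))" for k
  define Q where "Q a = (\<Sum>ij\<in>{..<n} \<times> {..<n}. (cmod (\<Sum>k\<in>K. of_real (w a k) * g k ij))\<^sup>2)" for a
  have Q0: "0 \<le> Q a" for a by (simp add: Q_def sum_nonneg)
  have "\<forall>a. \<exists>AB. positive_op n (fst AB) \<and> positive_op n (snd AB) \<and>
      fst AB - snd AB = mat_sum n (\<lambda>k. of_real (w a k) \<cdot>\<^sub>m x k) K \<and>
      rtrace (fst AB) + rtrace (snd AB)
        \<le> sqrt (rtrace T) * sqrt (Q a) + (\<Sum>k\<in>K. \<bar>w a k\<bar> * e k)"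
  proof
    fix a
    have "Q a = (\<Sum>i<n. \<Sum>j<n. (cmod (\<Sum>k\<in>K. of_real (w a k) * (C * (V k * x k)) $$ (i, j)))\<^sup>2)"
      by (simp add: Q_def g_def sum.cartesian_product case_prod_beta)
    then show "\<exists>AB. positive_op n (fst AB) \<and> positive_op n (snd AB) \<and>
      fst AB - snd AB = mat_sum n (\<lambda>k. of_real (w a k) \<cdot>\<^sub>m x k) K \<and>
      rtrace (fst AB) + rtrace (snd AB)
        \<le> sqrt (rtrace T) * sqrt (Q a) + (\<Sum>k\<in>K. \<bar>w a k\<bar> * e k)"
      unfolding split_paired_Ex fst_conv snd_conv e_def
      using weighted_sum_trace_norm_le[where w = "w a", OF C P x V(1-3)] by simp
  qed
  from choice[OF this] obtain AB where AB: "\<And>a. positive_op n (fst (AB a))" "\<And>a. positive_op n (snd (AB a))"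
      "\<And>a. fst (AB a) - snd (AB a) = mat_sum n (\<lambda>k. of_real (w a k) \<cdot>\<^sub>m x k) K"
    and tr: "\<And>a. rtrace (fst (AB a)) + rtrace (snd (AB a))
      \<le> sqrt (rtrace T) * sqrt (Q a) + (\<Sum>k\<in>K. \<bar>w a k\<bar> * e k)"
    by blast
  have e0: "0 \<le> e k" if "k \<in> K" for k
  proof -
    have "P k * V k * x k * V k * P k = mat_adjoint (V k * P k) * x k * (V k * P k)"
      using Pc[OF that] V(1,2)[OF that] xc[OF that] positive_op_hermitian[OF P[OF that]]
      by (simp add: mat_adjoint_mult[of _ n n _ n] as)
    then show ?thesis
      using mat_trace_positive_op(2)[OF positive_op_congruence[OF x[OF that], of "V k * P k" n]]
        mat_trace_positive_op(2)[OF x[OF that]] Pc[OF that] V(1)[OF that]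
      by (simp add: e_def)
  qed
  have "(\<Sum>a<m. rtrace (fst (AB a)) + rtrace (snd (AB a)))
    \<le> (\<Sum>a<m. sqrt (rtrace T) * sqrt (Q a) + (\<Sum>k\<in>K. \<bar>w a k\<bar> * e k))"
    by (intro sum_mono tr)
  also have "\<dots> = sqrt (rtrace T) * (\<Sum>a<m. sqrt (Q a)) + (\<Sum>k\<in>K. (\<Sum>a<m. \<bar>w a k\<bar>) * e k)"
    by (simp add: sum.distrib sum_distrib_left sum_distrib_right) (rule sum.swap)
  finally have 1: "(\<Sum>a<m. rtrace (fst (AB a)) + rtrace (snd (AB a)))
    \<le> sqrt (rtrace T) * (\<Sum>a<m. sqrt (Q a)) + (\<Sum>k\<in>K. (\<Sum>a<m. \<bar>w a k\<bar>) * e k)" .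
  \<comment> \<open>The indicator and the constant \<open>1 / real m\<close> each sum to 1 over the
    hash values, whence the factor 2.\<close>
  have "(\<Sum>k\<in>K. (\<Sum>a<m. \<bar>w a k\<bar>) * e k) \<le> (\<Sum>k\<in>K. 2 * e k)"
  proof (intro sum_mono mult_right_mono e0)
    fix k assume k: "k \<in> K"
    have "(\<Sum>a<m. \<bar>w a k\<bar>) \<le> (\<Sum>a<m. of_bool (f k = a) + 1 / real m)"
      by (intro sum_mono) (simp add: w_def)
    also have "\<dots> = (\<Sum>a<m. (if a = f k then 1 else 0)) + (\<Sum>a<m. 1 / real m)"
      unfolding sum.distrib by (intro arg_cong2[of _ _ _ _ "(+)"] sum.cong) auto
    also have "\<dots> \<le> 2" using m f k by simp
    finally show "(\<Sum>a<m. \<bar>w a k\<bar>) \<le> 2" .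
  qed
  then have 2: "(\<Sum>k\<in>K. (\<Sum>a<m. \<bar>w a k\<bar>) * e k) \<le> 2 * (\<Sum>k\<in>K. e k)"
    by (simp add: sum_distrib_left)
  \<comment> \<open>Cauchy-Schwarz over the hash values costs a factor \<open>m\<close>, which turns
    the \<open>1 - 1 / real m\<close> of the balanced hash into \<open>m - 1\<close>.\<close>
  have 3: "(\<Sum>a<m. sqrt (Q a)) \<le> sqrt (real m * (\<Sum>a<m. Q a))"
  proof -
    have "(\<Sum>a<m. \<bar>1\<bar> * \<bar>sqrt (Q a)\<bar>) \<le> L2_set (\<lambda>_. 1) {..<m} * L2_set (\<lambda>a. sqrt (Q a)) {..<m}"
      by (rule L2_set_mult_ineq)
    then show ?thesis using Q0 by (simp add: L2_set_def real_sqrt_mult)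
  qed
  have 4: "(\<Sum>a<m. Q a) \<le> (1 - 1 / real m) * (\<Sum>k\<in>K. c * rtrace (x k))"
  proof -
    have "(\<Sum>a<m. Q a) \<le> (1 - 1 / real m) * (\<Sum>k\<in>K. \<Sum>ij\<in>{..<n} \<times> {..<n}. (cmod (g k ij))\<^sup>2)"
      using fle unfolding Q_def w_def .
    also have "\<dots> \<le> (1 - 1 / real m) * (\<Sum>k\<in>K. c * rtrace (x k))"
      by (rule mult_left_mono[OF sum_mono[OF gk]]) (use m in auto)
    finally show ?thesis .
  qed
  have "sqrt (rtrace T) * (\<Sum>a<m. sqrt (Q a))
    \<le> sqrt (rtrace T) * sqrt (real m * ((1 - 1 / real m) * (\<Sum>k\<in>K. c * rtrace (x k))))"
  proof (rule mult_left_mono)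
    have "real m * (\<Sum>a<m. Q a) \<le> real m * ((1 - 1 / real m) * (\<Sum>k\<in>K. c * rtrace (x k)))"
      using 4 by (rule mult_left_mono) simp
    then show "(\<Sum>a<m. sqrt (Q a)) \<le> sqrt (real m * ((1 - 1 / real m) * (\<Sum>k\<in>K. c * rtrace (x k))))"
      using 3 real_sqrt_le_mono order_trans by blast
  qed (use mat_trace_positive_op(2)[OF T] in simp)
  also have "\<dots> = sqrt ((real m - 1) * rtrace T * c * (\<Sum>k\<in>K. rtrace (x k)))"
  proof -
    have "real m * ((1 - 1 / real m) * y) = (real m - 1) * y" for y
      using m by (simp add: field_simps)
    then show ?thesis unfolding real_sqrt_mult[symmetric] sum_distrib_left[symmetric]
      by (simp add: mult_ac)
  qed
  finally have "(\<Sum>a<m. rtrace (fst (AB a)) + rtrace (snd (AB a)))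
     \<le> sqrt ((real m - 1) * rtrace T * c * (\<Sum>k\<in>K. rtrace (x k))) + 2 * (\<Sum>k\<in>K. e k)"
    using 1 2 by linarith
  then show ?thesis
    using f AB unfolding w_def e_def
    by (intro exI[of _ f] exI[of _ "\<lambda>a. fst (AB a)"] exI[of _ "\<lambda>a. snd (AB a)"] conjI) blast+
qed

section \<open>Rearranging and averaging sums\<close>

lemma mat_trace_congruence_mat_sum:
  assumes "B \<in> carrier_mat n n" "\<And>k. k \<in> I \<Longrightarrow> x k \<in> carrier_mat n n"
  shows "mat_trace (mat_adjoint B * mat_sum n x I * B) = (\<Sum>k\<in>I. mat_trace (mat_adjoint B * x k * B))"
proof -
  have *: "mat_trace (mat_adjoint B * X * B) = mat_trace (B * mat_adjoint B * X)"
    if "X \<in> carrier_mat n n" for X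
    using that assms(1) mat_trace_comm[of "mat_adjoint B * X" n n B]
    by (simp add: assoc_mult_mat[of _ n n _ n _ n])
  show ?thesis
    using assms * by (simp add: mat_trace_mult_mat_sum cong: sum.cong)
qed

lemma mat_trace_one [simp]: "mat_trace (1\<^sub>m n) = of_nat n"
  by (simp add: mat_trace_def)

lemma mat_trace_zero [simp]: "mat_trace (0\<^sub>m n n) = 0"
  by (simp add: mat_trace_def)

lemma sum_product_diagonal:
  fixes h :: "'a \<times> 'a \<Rightarrow> 'b :: comm_monoid_add"
  assumes "finite X" "finite Y"
  shows "sum h (X \<times> Y) = (\<Sum>k\<in>X \<inter> Y. h (k, k)) + sum h (X \<times> Y - Id)"
proof -
  have "sum h (X \<times> Y) = sum h ((X \<times> Y) \<inter> Id) + sum h (X \<times> Y - Id)"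
    using assms by (intro sum.Int_Diff) simp
  also have "(X \<times> Y) \<inter> Id = (\<lambda>k. (k, k)) ` (X \<inter> Y)" by auto
  also have "sum h \<dots> = (\<Sum>k\<in>X \<inter> Y. h (k, k))"
    by (subst sum.reindex) (auto simp: inj_on_def)
  finally show ?thesis .
qed

lemma sum_fibres:
  fixes h :: "nat \<times> nat \<Rightarrow> real" and f :: "nat \<Rightarrow> nat"
  assumes "\<And>k. k < N \<Longrightarrow> f k < m"
  shows "(\<Sum>a<m. \<Sum>b<m. sum h ({k. k < N \<and> f k = a} \<times> {k. k < N \<and> f k = b} - Id))
    = sum h ({..<N} \<times> {..<N} - Id)"
proof -
  let ?g = "\<lambda>(k, k'). (f k, f k')" and ?S = "{..<N} \<times> {..<N} - Id"
  have "(\<Sum>a<m. \<Sum>b<m. sum h ({k. k < N \<and> f k = a} \<times> {k. k < N \<and> f k = b} - Id))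
    = (\<Sum>ab\<in>{..<m} \<times> {..<m}. sum h {p \<in> ?S. ?g p = ab})"
    unfolding sum.cartesian_product
    by (rule sum.cong[OF refl]) (clarsimp, rule arg_cong[of _ _ "sum h"], auto)
  also have "\<dots> = sum h ?S"
    by (rule sum.group) (use assms in auto)
  finally show ?thesis .
qed

lemma exists_le_average:
  fixes G :: "nat \<Rightarrow> real"
  assumes "0 < s" "(\<Sum>t<s. G t) \<le> real s * c"
  shows "\<exists>t<s. G t \<le> c"
proof (rule ccontr)
  assume "\<not> ?thesis"
  then have "(\<Sum>t<s. c) < (\<Sum>t<s. G t)"
    using assms(1) by (intro sum_strict_mono) (auto simp: not_le)
  then show False using assms(2) by simp
qed

lemma sum_sqrt_mult_le:
  assumes "\<And>i. i \<in> I \<Longrightarrow> 0 \<le> (u i :: real)" "\<And>i. i \<in> I \<Longrightarrow> 0 \<le> (v i :: real)"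
    and "sum u I \<le> U" "sum v I \<le> V"
  shows "(\<Sum>i\<in>I. sqrt (u i) * sqrt (v i)) \<le> sqrt U * sqrt V"
proof -
  have "(\<Sum>i\<in>I. sqrt (u i) * sqrt (v i)) = (\<Sum>i\<in>I. \<bar>sqrt (u i)\<bar> * \<bar>sqrt (v i)\<bar>)"
    using assms(1,2) by (intro sum.cong) auto
  also have "\<dots> \<le> L2_set (\<lambda>i. sqrt (u i)) I * L2_set (\<lambda>i. sqrt (v i)) I"
    by (rule L2_set_mult_ineq)
  also have "\<dots> = sqrt (sum u I) * sqrt (sum v I)"
    using assms(1,2) by (simp add: L2_set_def cong: sum.cong)
  also have "\<dots> \<le> sqrt U * sqrt V"
    using assms order_trans[OF sum_nonneg assms(3)]
    by (intro mult_mono) (auto simp: sum_nonneg)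
  finally show ?thesis .
qed

text \<open>In the application, \<open>x t k k'\<close> is Eve's operator for seed \<open>t\<close>
  when Alice and Bob hold the raw keys \<open>k\<close> and \<open>k'\<close>, \<open>T\<close> is
  her operator for one value of the ideal key, and \<open>P\<close> is the excess of the averaged
  output over the ideal one. Agreeing pairs are treated by \<open>hash_trace_norm_le\<close>.
  Disagreeing pairs have weight of order \<open>\<epsilon>\<close> on average over the seeds and are
  charged in full. One seed must be good for both, so the sum of the two errors is averaged. The gap
  between \<open>\<epsilon>\<close> and \<open>\<epsilon>'\<close> leaves room to make the weights
  invertible.\<close>

theorem one_shot_key_extraction:
  fixes x :: "nat \<Rightarrow> nat \<Rightarrow> nat \<Rightarrow> complex mat"
  assumes m: "0 < m" and s: "0 < s" and T: "positive_op n T"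
    and P: "\<And>k k'. k < N \<Longrightarrow> k' < N \<Longrightarrow> positive_op n (P k k')"
    and P_trace: "(\<Sum>k<N. \<Sum>k'<N. rtrace (P k k')) \<le> \<epsilon>" and \<epsilon>: "\<epsilon> < \<epsilon>'"
    and x: "\<And>t k k'. t < s \<Longrightarrow> k < N \<Longrightarrow> k' < N \<Longrightarrow> positive_op n (x t k k')"
    and x_trace: "\<And>t. t < s \<Longrightarrow> (\<Sum>k<N. \<Sum>k'<N. rtrace (x t k k')) = 1"
    and le: "\<And>k k'. k < N \<Longrightarrow> k' < N \<Longrightarrow> positive_op n (of_real (real s) \<cdot>\<^sub>m
      ((if k = k' then T else 0\<^sub>m n n) + P k k') - mat_sum n (\<lambda>t. x t k k') {..<s})"
  shows "\<exists>t<s. \<exists>f A B. (\<forall>k<N. f k < m) \<and>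
    (\<forall>a<m. \<forall>b<m. positive_op n (A a b) \<and> positive_op n (B a b) \<and>
      A a b - B a b = mat_sum n (\<lambda>(k, k'). x t k k') ({k. k < N \<and> f k = a} \<times> {k. k < N \<and> f k = b}) -
        (if a = b then of_real (1 / real m) \<cdot>\<^sub>m mat_sum n (\<lambda>(k, k'). x t k k') ({..<N} \<times> {..<N})
         else 0\<^sub>m n n)) \<and>
    (\<Sum>a<m. \<Sum>b<m. rtrace (A a b) + rtrace (B a b))
      \<le> sqrt ((real m - 1) * rtrace T * real s) + 2 * sqrt \<epsilon>' + 2 * \<epsilon>'"
proof -
  note as = assoc_mult_mat[of _ n n _ n _ n]
  have Tc: "T \<in> carrier_mat n n" using T by (rule positive_op_carrier)
  have xc: "x t k k' \<in> carrier_mat n n" if "t < s" "k < N" "k' < N" for t k k'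
    using x[OF that] by (rule positive_op_carrier)
  have Pc: "P k k' \<in> carrier_mat n n" if "k < N" "k' < N" for k k'
    using P[OF that] by (rule positive_op_carrier)
  have x0: "0 \<le> rtrace (x t k k')" if "t < s" "k < N" "k' < N" for t k k'
    using x[OF that] by (rule mat_trace_positive_op(2))
  have P0: "0 \<le> rtrace (P k k')" if "k < N" "k' < N" for k k'
    using P[OF that] by (rule mat_trace_positive_op(2))
  let ?D = "{..<N} \<times> {..<N} - Id"
  have split_N: "(\<Sum>k<N. \<Sum>k'<N. h k k') = (\<Sum>k<N. h k k) + (\<Sum>(k, k')\<in>?D. h k k')"
    for h :: "nat \<Rightarrow> nat \<Rightarrow> real"
    using sum_product_diagonal[of "{..<N}" "{..<N}" "\<lambda>(k, k'). h k k'"]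
    by (simp add: sum.cartesian_product)
  \<comment> \<open>The shift adds trace \<open>\<eta> * n\<close> for each of the \<open>N\<close>
    agreeing pairs, hence at most \<open>\<epsilon>' - \<epsilon>\<close> in total. The summand 1 in
    the denominator covers \<open>N * n = 0\<close>.\<close>
  define \<eta> where "\<eta> = (\<epsilon>' - \<epsilon>) / (real N * real n + 1)"
  have \<eta>: "0 < \<eta>" using \<epsilon> by (simp add: \<eta>_def add_nonneg_pos)
  have \<eta>_small: "real N * real n * \<eta> \<le> \<epsilon>' - \<epsilon>"
  proof -
    have "real N * real n * \<eta> \<le> (real N * real n + 1) * \<eta>" using \<eta> by (simp add: algebra_simps)
    also have "\<dots> = \<epsilon>' - \<epsilon>"
    proof -
      have "0 < real N * real n + 1" by (simp add: add_nonneg_pos)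
      then show ?thesis by (simp add: \<eta>_def)
    qed
    finally show ?thesis .
  qed
  define E where "E = of_real \<eta> \<cdot>\<^sub>m (1\<^sub>m n :: complex mat)"
  have E: "positive_op n E" unfolding E_def using positive_op_smult[OF positive_op_one] \<eta> by simp
  have Ec: "E \<in> carrier_mat n n" by (simp add: E_def)
  define P' where "P' k = P k k + E" for k
  have P': "positive_op n (P' k)" if "k < N" for k
    unfolding P'_def using P that E by (intro positive_op_add)
  have P'c: "P' k \<in> carrier_mat n n" if "k < N" for k
    using P'[OF that] by (rule positive_op_carrier)
  have P'_trace: "rtrace (P' k) = rtrace (P k k) + \<eta> * real n" if "k < N" for k
    using that Pc Ec by (simp add: P'_def mat_trace_add[of _ n] E_def mat_trace_smult[of _ n])
  have "\<forall>k. \<exists>V. k < N \<longrightarrow> V \<in> carrier_mat n n \<and> mat_adjoint V = V \<and>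
      (T + P' k) * V = 1\<^sub>m n \<and> V * (T + P' k) = 1\<^sub>m n"
  proof (intro allI)
    fix k
    show "\<exists>V. k < N \<longrightarrow> V \<in> carrier_mat n n \<and> mat_adjoint V = V \<and>
      (T + P' k) * V = 1\<^sub>m n \<and> V * (T + P' k) = 1\<^sub>m n"
    proof (cases "k < N")
      case True
      have "T + P' k = (T + P k k) + E"
        unfolding P'_def using Tc Pc[OF True True] Ec by (simp add: assoc_add_mat[of _ n n])
      then show ?thesis
        using positive_op_shift_inverse[OF positive_op_add[OF T P[OF True True]] \<eta>]
        unfolding E_def by metis
    qed simp
  qed
  from choice[OF this] obtain V where V: "\<And>k. k < N \<Longrightarrow> V k \<in> carrier_mat n n"
    "\<And>k. k < N \<Longrightarrow> mat_adjoint (V k) = V k" "\<And>k. k < N \<Longrightarrow> (T + P' k) * V k = 1\<^sub>m n"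
    "\<And>k. k < N \<Longrightarrow> V k * (T + P' k) = 1\<^sub>m n"
    by blast
  define X where "X k = mat_sum n (\<lambda>t. x t k k) {..<s}" for k
  have Xc: "X k \<in> carrier_mat n n" for k by (simp add: X_def)
  have leX: "positive_op n (of_real (real s) \<cdot>\<^sub>m (T + P' k) - X k)" if k: "k < N" for k
  proof -
    have "of_real (real s) \<cdot>\<^sub>m (T + P' k) - X k = (of_real (real s) \<cdot>\<^sub>m (T + P k k) - X k) + of_real (real s) \<cdot>\<^sub>m E"
      unfolding P'_def using Tc Pc[OF k k] Ec Xc[of k]
      by (intro eq_matI) (auto simp: algebra_simps)
    then show ?thesis
      using le[OF k k] positive_op_smult[OF E, of "real s"] unfolding X_def
      by (simp add: positive_op_add)
  qed
  define \<alpha> where "\<alpha> t k = rtrace (P' k * V k * x t k k * V k * P' k)" for t k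
  define \<beta> where "\<beta> t k = rtrace (x t k k)" for t k
  have adjB: "mat_adjoint (V k * P' k) = P' k * V k" if "k < N" for k
    using V(1,2)[OF that] P'c[OF that] positive_op_hermitian[OF P'[OF that]]
    by (simp add: mat_adjoint_mult[of _ n n _ n])
  have Bc: "V k * P' k \<in> carrier_mat n n" if "k < N" for k using V(1)[OF that] P'c[OF that] by simp
  have sandwich: "mat_adjoint (V k * P' k) * Y * (V k * P' k) = P' k * V k * Y * V k * P' k"
    if "k < N" "Y \<in> carrier_mat n n" for k Y
    unfolding adjB[OF that(1)] using that V(1)[OF that(1)] P'c[OF that(1)] by (simp add: as)
  have \<alpha>0: "0 \<le> \<alpha> t k" if "t < s" "k < N" for t k
    using mat_trace_positive_op(2)[OF positive_op_congruence[OF x Bc], of t k k k] that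
    by (simp add: \<alpha>_def sandwich[OF that(2) xc] )
  \<comment> \<open>Summed over the seeds, the operators \<open>x t k k\<close> are at most
    \<open>s (T + P' k)\<close>, and this weight cancels one inverse. The remaining
    \<open>P' k * V k * P' k\<close> is bounded by \<open>trace_inverse_weight_le\<close> with
    constant 1, because \<open>P' k \<le> T + P' k\<close>.\<close>
  have \<alpha>_sum: "(\<Sum>t<s. \<alpha> t k) \<le> real s * rtrace (P' k)" if k: "k < N" for k
  proof -
    note cs = V(1)[OF k] P'c[OF k] Tc
    have "(\<Sum>t<s. \<alpha> t k) = (\<Sum>t<s. rtrace (mat_adjoint (V k * P' k) * x t k k * (V k * P' k)))"
      unfolding \<alpha>_def using k by (intro sum.cong) (auto simp: sandwich xc)
    also have "\<dots> = rtrace (mat_adjoint (V k * P' k) * X k * (V k * P' k))"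
      unfolding X_def using k
      by (subst mat_trace_congruence_mat_sum[OF Bc]) (auto simp: xc)
    also have "\<dots> \<le> rtrace (mat_adjoint (V k * P' k) * (of_real (real s) \<cdot>\<^sub>m (T + P' k)) * (V k * P' k))"
      using Xc cs by (intro positive_op_diff_trace_mono[OF leX[OF k]]) auto
    also have "mat_adjoint (V k * P' k) * (of_real (real s) \<cdot>\<^sub>m (T + P' k)) * (V k * P' k)
        = of_real (real s) \<cdot>\<^sub>m (P' k * (V k * (T + P' k)) * (V k * P' k))"
      unfolding adjB[OF k] using cs
      by (simp add: mult_smult_distrib[of _ n n _ n] mult_smult_assoc_mat[of _ n n _ n] as)
    also have "\<dots> = of_real (real s) \<cdot>\<^sub>m (P' k * V k * P' k)"
      unfolding V(4)[OF k] using cs by (simp add: as)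
    also have "rtrace \<dots> = real s * rtrace (P' k * V k * P' k)"
      using cs by (simp add: mat_trace_smult[of _ n])
    also have "\<dots> \<le> real s * (1 * rtrace (P' k))"
    proof (intro mult_left_mono trace_inverse_weight_le[OF P'[OF k] positive_op_add[OF T P'[OF k]] _ V(1-4)[OF k]])
      have "of_real 1 \<cdot>\<^sub>m (T + P' k) - P' k = T" using cs by (intro eq_matI) auto
      then show "positive_op n (of_real 1 \<cdot>\<^sub>m (T + P' k) - P' k)" using T by simp
    qed auto
    finally show ?thesis by simp
  qed
  \<comment> \<open>An ideal key has no weight on disagreeing pairs, so there the hypothesis bounds
    the sum over the seeds by \<open>P\<close> alone.\<close>
  have off: "(\<Sum>t<s. rtrace (x t k k')) \<le> real s * rtrace (P k k')"
    if kk: "k < N" "k' < N" "k \<noteq> k'" for k k'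
  proof -
    let ?X = "mat_sum n (\<lambda>t. x t k k') {..<s}"
    have "positive_op n (of_real (real s) \<cdot>\<^sub>m P k k' - ?X)"
      using le[OF kk(1,2)] kk Pc[OF kk(1,2)] by (simp add: left_add_zero_mat[of _ n n])
    from mat_trace_positive_op(2)[OF this] have "rtrace ?X \<le> real s * rtrace (P k k')"
      using Pc[OF kk(1,2)] by (simp add: mat_trace_minus[of _ n] mat_trace_smult[of _ n])
    moreover have "mat_trace ?X = (\<Sum>t<s. mat_trace (x t k k'))"
      by (intro mat_trace_mat_sum) (use xc kk in auto)
    ultimately show ?thesis by simp
  qed
  define \<delta> where "\<delta> t = (\<Sum>(k, k')\<in>?D. rtrace (x t k k'))" for t
  \<comment> \<open>\<open>G t\<close> is the part of the final error that depends on the seed; the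
    hashing term has a bound that is uniform in \<open>t\<close>.\<close>
  define G where "G t = 2 * (\<Sum>k<N. sqrt (\<alpha> t k) * sqrt (\<beta> t k)) + 2 * \<delta> t" for t
  have \<delta>0: "0 \<le> \<delta> t" if "t < s" for t unfolding \<delta>_def using that x0 by (intro sum_nonneg) auto
  have \<beta>_sum: "(\<Sum>k<N. \<beta> t k) \<le> 1" if "t < s" for t
    using x_trace[OF that] \<delta>0[OF that] unfolding split_N \<delta>_def \<beta>_def by simp
  have P_split: "(\<Sum>k<N. rtrace (P k k)) + (\<Sum>(k, k')\<in>?D. rtrace (P k k')) \<le> \<epsilon>"
    using P_trace unfolding split_N .
  have P_nonneg: "0 \<le> (\<Sum>k<N. rtrace (P k k))" "0 \<le> (\<Sum>(k, k')\<in>?D. rtrace (P k k'))"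
    using P0 by (auto intro!: sum_nonneg)
  have \<epsilon>0: "0 \<le> \<epsilon>'" using P_split P_nonneg \<epsilon> by linarith
  have "(\<Sum>t<s. G t) \<le> real s * (2 * sqrt \<epsilon>' + 2 * \<epsilon>')"
  proof -
    have "(\<Sum>t<s. \<Sum>k<N. sqrt (\<alpha> t k) * sqrt (\<beta> t k))
      = (\<Sum>(t, k)\<in>{..<s} \<times> {..<N}. sqrt (\<alpha> t k) * sqrt (\<beta> t k))"
      by (simp add: sum.cartesian_product)
    also have "\<dots> = (\<Sum>p\<in>{..<s} \<times> {..<N}. sqrt (\<alpha> (fst p) (snd p)) * sqrt (\<beta> (fst p) (snd p)))"
      by (simp add: case_prod_beta)
    also have "\<dots> \<le> sqrt (real s * \<epsilon>') * sqrt (real s)"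
    proof (rule sum_sqrt_mult_le)
      have "(\<Sum>p\<in>{..<s} \<times> {..<N}. \<alpha> (fst p) (snd p)) = (\<Sum>k<N. \<Sum>t<s. \<alpha> t k)"
        by (subst sum.swap) (simp add: sum.cartesian_product case_prod_beta)
      also have "\<dots> \<le> (\<Sum>k<N. real s * rtrace (P' k))"
        by (intro sum_mono \<alpha>_sum) simp
      also have "\<dots> = real s * ((\<Sum>k<N. rtrace (P k k)) + real N * real n * \<eta>)"
        by (simp add: P'_trace sum_distrib_left[symmetric] sum.distrib)
      also have "\<dots> \<le> real s * \<epsilon>'"
        using P_split P_nonneg \<eta>_small by (intro mult_left_mono) linarith+
      finally show "(\<Sum>p\<in>{..<s} \<times> {..<N}. \<alpha> (fst p) (snd p)) \<le> real s * \<epsilon>'" .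
      have "(\<Sum>p\<in>{..<s} \<times> {..<N}. \<beta> (fst p) (snd p)) = (\<Sum>t<s. \<Sum>k<N. \<beta> t k)"
        by (simp add: sum.cartesian_product case_prod_beta)
      also have "\<dots> \<le> (\<Sum>t<s. 1)" by (intro sum_mono \<beta>_sum) simp
      finally show "(\<Sum>p\<in>{..<s} \<times> {..<N}. \<beta> (fst p) (snd p)) \<le> real s" by simp
    qed (auto simp: \<alpha>0 \<beta>_def x0)
    also have "sqrt (real s * \<epsilon>') * sqrt (real s) = real s * sqrt \<epsilon>'"
      by (simp add: real_sqrt_mult)
    finally have 1: "(\<Sum>t<s. \<Sum>k<N. sqrt (\<alpha> t k) * sqrt (\<beta> t k)) \<le> real s * sqrt \<epsilon>'" .
    have "(\<Sum>t<s. \<delta> t) = (\<Sum>(k, k')\<in>?D. \<Sum>t<s. rtrace (x t k k'))"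
      unfolding \<delta>_def case_prod_beta by (rule sum.swap)
    also have "\<dots> \<le> (\<Sum>(k, k')\<in>?D. real s * rtrace (P k k'))"
      using off by (intro sum_mono) auto
    also have "\<dots> = real s * (\<Sum>(k, k')\<in>?D. rtrace (P k k'))"
      by (simp add: sum_distrib_left case_prod_beta)
    also have "\<dots> \<le> real s * \<epsilon>'"
      using P_split P_nonneg \<epsilon> by (intro mult_left_mono) linarith+
    finally have 2: "(\<Sum>t<s. \<delta> t) \<le> real s * \<epsilon>'" .
    have "(\<Sum>t<s. G t) = 2 * (\<Sum>t<s. \<Sum>k<N. sqrt (\<alpha> t k) * sqrt (\<beta> t k)) + 2 * (\<Sum>t<s. \<delta> t)"
      by (simp add: G_def sum.distrib sum_distrib_left)
    then show ?thesis using 1 2 by (simp add: algebra_simps)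
  qed
  then obtain t where t: "t < s" and Gt: "G t \<le> 2 * sqrt \<epsilon>' + 2 * \<epsilon>'"
    using exists_le_average[OF s] by blast
  \<comment> \<open>Dropping the positive operators of all other seeds costs the factor
    \<open>s\<close>. In the application this is the loss of \<open>l * n\<close> bits of
    key.\<close>
  have le_t: "positive_op n (of_real (real s) \<cdot>\<^sub>m (T + P' k) - x t k k)" if k: "k < N" for k
  proof -
    have split: "(\<Sum>r<s. h r) = h t + (\<Sum>r\<in>{..<s} - {t}. h r)" for h :: "nat \<Rightarrow> complex"
      using t by (simp add: sum.remove)
    have "of_real (real s) \<cdot>\<^sub>m (T + P' k) - x t k k
        = (of_real (real s) \<cdot>\<^sub>m (T + P' k) - X k) + mat_sum n (\<lambda>r. x r k k) ({..<s} - {t})"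
      unfolding X_def using Tc P'c[OF k] xc[OF t k k] by (intro eq_matI) (auto simp: split)
    moreover have "positive_op n (mat_sum n (\<lambda>r. x r k k) ({..<s} - {t}))"
      using x k by (intro positive_op_mat_sum) auto
    ultimately show ?thesis using leX[OF k] by (simp add: positive_op_add)
  qed
  have "\<exists>f A B. (\<forall>k\<in>{..<N}. f k < m) \<and>
    (\<forall>a<m. positive_op n (A a) \<and> positive_op n (B a) \<and>
      A a - B a = mat_sum n (\<lambda>k. of_real (of_bool (f k = a) - 1 / real m) \<cdot>\<^sub>m x t k k) {..<N}) \<and>
    (\<Sum>a<m. rtrace (A a) + rtrace (B a))
      \<le> sqrt ((real m - 1) * rtrace T * real s * (\<Sum>k<N. rtrace (x t k k))) +
        2 * (\<Sum>k<N. sqrt (rtrace (P' k * V k * x t k k * V k * P' k)) * sqrt (rtrace (x t k k)))"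
    by (rule hash_trace_norm_le[OF _ m T]) (use P' x t le_t V in auto)
  then obtain f A0 B0 where f': "\<forall>k\<in>{..<N}. f k < m"
    and AB': "\<forall>a<m. positive_op n (A0 a) \<and> positive_op n (B0 a) \<and>
      A0 a - B0 a = mat_sum n (\<lambda>k. of_real (of_bool (f k = a) - 1 / real m) \<cdot>\<^sub>m x t k k) {..<N}"
    and tr0: "(\<Sum>a<m. rtrace (A0 a) + rtrace (B0 a))
      \<le> sqrt ((real m - 1) * rtrace T * real s * (\<Sum>k<N. \<beta> t k)) +
        2 * (\<Sum>k<N. sqrt (\<alpha> t k) * sqrt (\<beta> t k))"
    unfolding \<alpha>_def \<beta>_def by blast
  have f: "f k < m" if "k < N" for k using f' that by simp
  have AB0: "positive_op n (A0 a)" "positive_op n (B0 a)"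
      "A0 a - B0 a = mat_sum n (\<lambda>k. of_real (of_bool (f k = a) - 1 / real m) \<cdot>\<^sub>m x t k k) {..<N}"
    if "a < m" for a
    using AB' that by blast+
  define F where "F a = {k. k < N \<and> f k = a}" for a
  have F: "finite (F a)" for a by (auto simp: F_def)
  have FN: "k < N" if "k \<in> F a" for k a using that by (simp add: F_def)
  let ?x = "\<lambda>(k, k'). x t k k'"
  \<comment> \<open>Disagreeing pairs occur twice: \<open>O1\<close> in the blocks of the actual
    output, and \<open>O2\<close> in the ideal key, since its Eve state sums over all pairs. Each
    contributes \<open>\<delta> t\<close>, hence the summand \<open>2 * \<delta> t\<close> in
    \<open>G\<close>.\<close>
  define O1 where "O1 a b = mat_sum n ?x (F a \<times> F b - Id)" for a b
  define O2 where "O2 = mat_sum n ?x ?D"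
  define A where "A a b = (if a = b then A0 a else 0\<^sub>m n n) + O1 a b" for a b
  define B where "B a b = (if a = b then B0 a + of_real (1 / real m) \<cdot>\<^sub>m O2 else 0\<^sub>m n n)" for a b
  have zero: "positive_op n (0\<^sub>m n n)"
    by (auto simp: positive_op_quad_form quad_form_def)
  have O1: "positive_op n (O1 a b)" for a b
    unfolding O1_def using FN x t by (intro positive_op_mat_sum) auto
  have O2: "positive_op n O2" unfolding O2_def using x t by (intro positive_op_mat_sum) auto
  have O2m: "positive_op n (of_real (1 / real m) \<cdot>\<^sub>m O2)" by (rule positive_op_smult[OF O2]) simp
  have tr_O1: "rtrace (O1 a b) = (\<Sum>(k, k')\<in>F a \<times> F b - Id. rtrace (x t k k'))" for a b
  proof -
    have "mat_trace (O1 a b) = (\<Sum>p\<in>F a \<times> F b - Id. mat_trace (?x p))"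
      unfolding O1_def
    proof (rule mat_trace_mat_sum)
      fix p assume "p \<in> F a \<times> F b - Id"
      then show "?x p \<in> carrier_mat n n" using xc[OF t FN FN] by (cases p) auto
    qed
    then show ?thesis by (simp add: case_prod_beta)
  qed
  have tr_O2: "rtrace O2 = \<delta> t"
    unfolding O2_def \<delta>_def
    by (subst mat_trace_mat_sum) (auto simp: xc t case_prod_beta)
  have A: "positive_op n (A a b)" if "a < m" for a b
    unfolding A_def using AB0(1)[OF that] O1 zero by (auto intro: positive_op_add)
  have B: "positive_op n (B a b)" if "a < m" for a b
    unfolding B_def using AB0(2)[OF that] O2m zero by (auto intro: positive_op_add)
  have AB: "A a b - B a b = mat_sum n ?x (F a \<times> F b) -
      (if a = b then of_real (1 / real m) \<cdot>\<^sub>m mat_sum n ?x ({..<N} \<times> {..<N}) else 0\<^sub>m n n)"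
    if a: "a < m" for a b
  proof (rule eq_matI)
    let ?rhs = "mat_sum n ?x (F a \<times> F b) -
      (if a = b then of_real (1 / real m) \<cdot>\<^sub>m mat_sum n ?x ({..<N} \<times> {..<N}) else 0\<^sub>m n n)"
    have c0: "A0 a \<in> carrier_mat n n" "B0 a \<in> carrier_mat n n"
      using AB0(1,2)[OF a] by (auto dest: positive_op_carrier)
    show "dim_row (A a b - B a b) = dim_row ?rhs" "dim_col (A a b - B a b) = dim_col ?rhs"
      using c0 by (auto simp: A_def B_def O2_def)
    fix i j assume "i < dim_row ?rhs" "j < dim_col ?rhs"
    then have ij: "i < n" "j < n" by (auto split: if_splits)
    let ?h = "\<lambda>p. ?x p $$ (i, j)"
    have 1: "sum ?h (F a \<times> F b) = (\<Sum>k\<in>F a \<inter> F b. x t k k $$ (i, j)) + sum ?h (F a \<times> F b - Id)"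
      using sum_product_diagonal[of "F a" "F b" ?h] F by simp
    have 2: "sum ?h ({..<N} \<times> {..<N}) = (\<Sum>k<N. x t k k $$ (i, j)) + sum ?h ?D"
      using sum_product_diagonal[of "{..<N}" "{..<N}" ?h] by simp
    show "(A a b - B a b) $$ (i, j) = ?rhs $$ (i, j)"
    proof (cases "a = b")
      case True
      have "(A0 a - B0 a) $$ (i, j) = (\<Sum>k<N. (of_real (of_bool (f k = a) - 1 / real m) \<cdot>\<^sub>m x t k k) $$ (i, j))"
        unfolding AB0(3)[OF a] using ij by simp
      also have "\<dots> = (\<Sum>k<N. (if f k = a then x t k k $$ (i, j) else 0) - of_real (1 / real m) * x t k k $$ (i, j))"
      proof (intro sum.cong refl)
        fix k assume "k \<in> {..<N}"
        then have "(of_real (of_bool (f k = a) - 1 / real m) \<cdot>\<^sub>m x t k k) $$ (i, j)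
          = of_real (of_bool (f k = a) - 1 / real m) * x t k k $$ (i, j)"
          using xc[OF t, of k k] ij by simp
        then show "(of_real (of_bool (f k = a) - 1 / real m) \<cdot>\<^sub>m x t k k) $$ (i, j)
          = (if f k = a then x t k k $$ (i, j) else 0) - of_real (1 / real m) * x t k k $$ (i, j)"
          by (simp add: algebra_simps)
      qed
      also have "\<dots> = (\<Sum>k\<in>F a. x t k k $$ (i, j)) - of_real (1 / real m) * (\<Sum>k<N. x t k k $$ (i, j))"
      proof -
        have "F a = {k \<in> {..<N}. f k = a}" by (auto simp: F_def)
        then have "(\<Sum>k\<in>F a. x t k k $$ (i, j)) = (\<Sum>k<N. if f k = a then x t k k $$ (i, j) else 0)"
          by (simp only: sum.inter_filter[OF finite_lessThan])
        then show ?thesis by (simp add: sum_subtractf sum_distrib_left)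
      qed
      finally have "A0 a $$ (i, j) - B0 a $$ (i, j)
        = (\<Sum>k\<in>F a. x t k k $$ (i, j)) - of_real (1 / real m) * (\<Sum>k<N. x t k k $$ (i, j))"
        using c0 ij by simp
      then show ?thesis
        using True ij c0 1 2 by (simp add: A_def B_def O1_def O2_def algebra_simps)
    next
      case False
      then have "F a \<inter> F b = {}" by (auto simp: F_def)
      then show ?thesis using False ij 1 by (simp add: A_def B_def O1_def)
    qed
  qed
  have trA: "rtrace (A a b) = (if a = b then rtrace (A0 a) else 0)
      + (\<Sum>(k, k')\<in>F a \<times> F b - Id. rtrace (x t k k'))" if "a < m" for a b
    using AB0(1)[OF that, THEN positive_op_carrier] O1[THEN positive_op_carrier, of a b]
    by (cases "a = b") (simp_all add: A_def mat_trace_add[of _ n] tr_O1[symmetric])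
  have trB: "rtrace (B a b) = (if a = b then rtrace (B0 a) + \<delta> t / real m else 0)"
    if "a < m" for a b
    using AB0(2)[OF that, THEN positive_op_carrier] O2[THEN positive_op_carrier]
    by (cases "a = b") (simp_all add: B_def mat_trace_add[of _ n] mat_trace_smult[of _ n] tr_O2[symmetric])
  have "(\<Sum>a<m. \<Sum>b<m. rtrace (A a b) + rtrace (B a b))
    = (\<Sum>a<m. rtrace (A0 a) + (rtrace (B0 a) + \<delta> t / real m)
        + (\<Sum>b<m. \<Sum>(k, k')\<in>F a \<times> F b - Id. rtrace (x t k k')))"
    by (intro sum.cong refl) (simp add: trA trB sum.distrib)
  also have "\<dots> = (\<Sum>a<m. rtrace (A0 a) + rtrace (B0 a)) + \<delta> t
      + (\<Sum>a<m. \<Sum>b<m. \<Sum>(k, k')\<in>F a \<times> F b - Id. rtrace (x t k k'))"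
    using m by (simp add: sum.distrib)
  also have "(\<Sum>a<m. \<Sum>b<m. \<Sum>(k, k')\<in>F a \<times> F b - Id. rtrace (x t k k')) = \<delta> t"
    unfolding F_def \<delta>_def by (rule sum_fibres) (rule f)
  finally have sum_eq: "(\<Sum>a<m. \<Sum>b<m. rtrace (A a b) + rtrace (B a b))
    = (\<Sum>a<m. rtrace (A0 a) + rtrace (B0 a)) + 2 * \<delta> t" by simp
  have "(real m - 1) * rtrace T * real s * (\<Sum>k<N. \<beta> t k)
    \<le> (real m - 1) * rtrace T * real s * 1"
    using m mat_trace_positive_op(2)[OF T] \<beta>_sum[OF t]
    by (intro mult_left_mono mult_nonneg_nonneg) auto
  then have "sqrt ((real m - 1) * rtrace T * real s * (\<Sum>k<N. \<beta> t k))
    \<le> sqrt ((real m - 1) * rtrace T * real s)"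
    by (intro real_sqrt_le_mono) simp
  then have total: "(\<Sum>a<m. \<Sum>b<m. rtrace (A a b) + rtrace (B a b))
    \<le> sqrt ((real m - 1) * rtrace T * real s) + 2 * sqrt \<epsilon>' + 2 * \<epsilon>'"
    using sum_eq tr0 Gt unfolding G_def by linarith
  show ?thesis
  proof (rule exI[of _ t], rule conjI[OF t], rule exI[of _ f], rule exI[of _ A], rule exI[of _ B],
      intro conjI allI impI total)
    fix a b assume "a < m"
    then show "positive_op n (A a b)" "positive_op n (B a b)" by (rule A, rule B)
    show "A a b - B a b = mat_sum n ?x ({k. k < N \<and> f k = a} \<times> {k. k < N \<and> f k = b}) -
      (if a = b then of_real (1 / real m) \<cdot>\<^sub>m mat_sum n ?x ({..<N} \<times> {..<N}) else 0\<^sub>m n n)"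
      using AB[OF \<open>a < m\<close>] unfolding F_def .
  qed (rule f)
qed

section \<open>Positive kernels and tripartite operators\<close>

text \<open>Positivity over an arbitrary index set treats matrices, tripartite indices, reference
  systems and single blocks alike, and a change of numbering becomes a pullback.\<close>

definition psd_kernel :: "'i set \<Rightarrow> ('i \<Rightarrow> 'i \<Rightarrow> complex) \<Rightarrow> bool" where
  "psd_kernel I k \<longleftrightarrow> (\<forall>v. 0 \<le> (\<Sum>s\<in>I. \<Sum>t\<in>I. cnj (v s) * k s t * v t))"

lemma psd_kernel_cong:
  assumes "\<And>s t. s \<in> I \<Longrightarrow> t \<in> I \<Longrightarrow> k s t = k' s t"
  shows "psd_kernel I k \<longleftrightarrow> psd_kernel I k'"
  using assms by (simp add: psd_kernel_def cong: sum.cong)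

lemma psd_kernel_congruence:
  assumes "psd_kernel I k"
  shows "psd_kernel J (\<lambda>s t. \<Sum>i\<in>I. \<Sum>j\<in>I. c s i * k i j * cnj (c t j))"
  unfolding psd_kernel_def
proof
  fix v :: "'b \<Rightarrow> complex"
  define w where "w i = (\<Sum>s\<in>J. cnj (c s i) * v s)" for i
  have "(\<Sum>s\<in>J. \<Sum>t\<in>J. cnj (v s) * (\<Sum>i\<in>I. \<Sum>j\<in>I. c s i * k i j * cnj (c t j)) * v t)
      = (\<Sum>s\<in>J. \<Sum>t\<in>J. \<Sum>i\<in>I. \<Sum>j\<in>I. cnj (cnj (c s i) * v s) * k i j * (cnj (c t j) * v t))"
    by (simp add: sum_distrib_left sum_distrib_right mult_ac)
  also have "\<dots> = (\<Sum>s\<in>J. \<Sum>i\<in>I. \<Sum>t\<in>J. \<Sum>j\<in>I. cnj (cnj (c s i) * v s) * k i j * (cnj (c t j) * v t))"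
    by (intro sum.cong refl sum.swap)
  also have "\<dots> = (\<Sum>i\<in>I. \<Sum>s\<in>J. \<Sum>t\<in>J. \<Sum>j\<in>I. cnj (cnj (c s i) * v s) * k i j * (cnj (c t j) * v t))"
    by (rule sum.swap)
  also have "\<dots> = (\<Sum>i\<in>I. \<Sum>s\<in>J. \<Sum>j\<in>I. \<Sum>t\<in>J. cnj (cnj (c s i) * v s) * k i j * (cnj (c t j) * v t))"
    by (intro sum.cong refl sum.swap)
  also have "\<dots> = (\<Sum>i\<in>I. \<Sum>j\<in>I. \<Sum>s\<in>J. \<Sum>t\<in>J. cnj (cnj (c s i) * v s) * k i j * (cnj (c t j) * v t))"
    by (intro sum.cong refl sum.swap)
  also have "\<dots> = (\<Sum>i\<in>I. \<Sum>j\<in>I. cnj (w i) * k i j * w j)"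
    by (simp only: w_def cnj_sum sum_distrib_right) (simp only: sum_distrib_left)
  also have "\<dots> \<ge> 0" using assms by (simp add: psd_kernel_def)
  finally show "0 \<le> (\<Sum>s\<in>J. \<Sum>t\<in>J. cnj (v s) * (\<Sum>i\<in>I. \<Sum>j\<in>I. c s i * k i j * cnj (c t j)) * v t)" .
qed

text \<open>Congruence with the 0/1 matrix of the partial map \<open>\<pi>\<close> on the domain
  \<open>q\<close>. The Kraus operators of the concrete maps below send basis vectors to basis
  vectors or to zero, so sums of masked pullbacks give their positivity.\<close>

lemma psd_kernel_masked_pullback:
  assumes "psd_kernel I k" "finite I" "\<And>s. s \<in> J \<Longrightarrow> q s \<Longrightarrow> \<pi> s \<in> I"
  shows "psd_kernel J (\<lambda>s t. if q s \<and> q t then k (\<pi> s) (\<pi> t) else 0)"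
proof -
  let ?c = "\<lambda>s i. if q s \<and> i = \<pi> s then 1 else (0 :: complex)"
  have "(\<Sum>i\<in>I. \<Sum>j\<in>I. ?c s i * k i j * cnj (?c t j)) = (if q s \<and> q t then k (\<pi> s) (\<pi> t) else 0)"
    if "s \<in> J" "t \<in> J" for s t
  proof -
    have "(\<Sum>i\<in>I. \<Sum>j\<in>I. ?c s i * k i j * cnj (?c t j))
        = (\<Sum>i\<in>I. if i = \<pi> s then (\<Sum>j\<in>I. if j = \<pi> t then (if q s \<and> q t then k i j else 0) else 0) else 0)"
      by (intro sum.cong refl) (auto intro!: sum.cong sum.neutral)
    also have "\<dots> = (if q s \<and> q t then k (\<pi> s) (\<pi> t) else 0)"
      using assms(2) assms(3)[of s] assms(3)[of t] that by auto
    finally show ?thesis .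
  qed
  then show ?thesis
    using psd_kernel_congruence[OF assms(1), of J ?c] by (simp cong: psd_kernel_cong)
qed

lemma psd_kernel_pullback:
  assumes "psd_kernel I k" "finite I" "\<And>s. s \<in> J \<Longrightarrow> \<pi> s \<in> I"
  shows "psd_kernel J (\<lambda>s t. k (\<pi> s) (\<pi> t))"
  using psd_kernel_masked_pullback[OF assms(1,2), of J "\<lambda>_. True" \<pi>] assms(3) by simp

lemma psd_kernel_sum:
  assumes "\<And>g. g \<in> G \<Longrightarrow> psd_kernel I (k g)"
  shows "psd_kernel I (\<lambda>s t. \<Sum>g\<in>G. k g s t)"
  unfolding psd_kernel_def
proof
  fix v
  have "(\<Sum>s\<in>I. \<Sum>t\<in>I. cnj (v s) * (\<Sum>g\<in>G. k g s t) * v t)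
      = (\<Sum>s\<in>I. \<Sum>t\<in>I. \<Sum>g\<in>G. cnj (v s) * k g s t * v t)"
    by (simp add: sum_distrib_left sum_distrib_right)
  also have "\<dots> = (\<Sum>s\<in>I. \<Sum>g\<in>G. \<Sum>t\<in>I. cnj (v s) * k g s t * v t)"
    by (intro sum.cong refl sum.swap)
  also have "\<dots> = (\<Sum>g\<in>G. \<Sum>s\<in>I. \<Sum>t\<in>I. cnj (v s) * k g s t * v t)"
    by (rule sum.swap)
  also have "\<dots> \<ge> 0" by (rule sum_nonneg) (use assms psd_kernel_def in blast)
  finally show "0 \<le> (\<Sum>s\<in>I. \<Sum>t\<in>I. cnj (v s) * (\<Sum>g\<in>G. k g s t) * v t)" .
qed

lemma positive_op_psd_kernel:
  "positive_op n X \<longleftrightarrow> X \<in> carrier_mat n n \<and> psd_kernel {..<n} (\<lambda>i j. X $$ (i, j))"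
  by (simp add: positive_op_quad_form psd_kernel_def quad_form_def)

section \<open>Tripartite indices and entries\<close>

fun idx :: "dims \<Rightarrow> (nat \<times> nat \<times> nat) set" where
  "idx (dA, dB, dE) = {..<dA} \<times> {..<dB} \<times> {..<dE}"

lemma finite_idx [simp]: "finite (idx D)" by (cases D) auto

lemma nat_pair_less:
  assumes "a < m" "b < (n :: nat)"
  shows "a * n + b < m * n"
proof -
  have "a * n + b < Suc a * n" using assms(2) by simp
  also have "\<dots> \<le> m * n" using assms(1) by (intro mult_le_mono1) simp
  finally show ?thesis .
qed

abbreviation tri_carrier :: "dims \<Rightarrow> complex mat set" where
  "tri_carrier D \<equiv> carrier_mat (total_dim D) (total_dim D)"

lemma index_of_less: "s \<in> idx D \<Longrightarrow> index_of D s < total_dim D"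
proof (cases D, cases s)
  fix dA dB dE a b e assume D: "D = (dA, dB, dE)" "s = (a, b, e)" and "s \<in> idx D"
  then have l: "a < dA" "b < dB" "e < dE" by auto
  have "(a * dB + b) * dE + e < dA * dB * dE" using l by (intro nat_pair_less)
  then show ?thesis by (simp add: D)
qed

lemma triple_of_index_of: "s \<in> idx D \<Longrightarrow> triple_of D (index_of D s) = s"
  by (cases D, cases s) auto

lemma index_of_triple_of: "i < total_dim D \<Longrightarrow> index_of D (triple_of D i) = i"
proof (cases D)
  fix dA dB dE assume D: "D = (dA, dB, dE)" and "i < total_dim D"
  show ?thesis unfolding D by (simp add: mult.commute)
qed

lemma triple_of_idx: "i < total_dim D \<Longrightarrow> triple_of D i \<in> idx D"
proof (cases D)
  fix dA dB dE assume D: "D = (dA, dB, dE)" and i: "i < total_dim D"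
  then have "0 < dB" "0 < dE" by (auto intro: Nat.gr0I)
  then show ?thesis using i unfolding D
    by (auto simp: less_mult_imp_div_less mult.assoc)
qed

lemma bij_betw_index_of: "bij_betw (index_of D) (idx D) {..<total_dim D}"
  by (rule bij_betw_byWitness[where f' = "triple_of D"])
    (auto simp: triple_of_index_of index_of_triple_of index_of_less triple_of_idx)

lemma tri_mat_carrier [simp]: "tri_mat D f \<in> tri_carrier D"
  by (simp add: tri_mat_def)

lemma tri_entry_tri_mat:
  "s \<in> idx D \<Longrightarrow> t \<in> idx D \<Longrightarrow> tri_entry D (tri_mat D f) s t = f s t"
  by (simp add: tri_entry_def tri_mat_def index_of_less triple_of_index_of)

lemma tri_mat_eqI:
  assumes "X \<in> tri_carrier D" "Y \<in> tri_carrier D"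
    and "\<And>s t. s \<in> idx D \<Longrightarrow> t \<in> idx D \<Longrightarrow> tri_entry D X s t = tri_entry D Y s t"
  shows "X = Y"
proof (rule eq_matI)
  fix i j assume "i < dim_row Y" "j < dim_col Y"
  then have "i < total_dim D" "j < total_dim D" using assms(2) by auto
  then show "X $$ (i, j) = Y $$ (i, j)"
    using assms(3)[of "triple_of D i" "triple_of D j"]
    by (simp add: tri_entry_def triple_of_idx index_of_triple_of)
qed (use assms in auto)

lemma mat_trace_tri:
  assumes "X \<in> tri_carrier D"
  shows "mat_trace X = (\<Sum>s\<in>idx D. tri_entry D X s s)"
proof -
  have "mat_trace X = (\<Sum>i<total_dim D. X $$ (i, i))" using assms by (simp add: mat_trace_def)
  also have "\<dots> = (\<Sum>s\<in>idx D. X $$ (index_of D s, index_of D s))"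
    by (rule sum.reindex_bij_betw[OF bij_betw_index_of, symmetric])
  finally show ?thesis by (simp add: tri_entry_def)
qed

lemma positive_op_tri:
  "positive_op (total_dim D) X \<longleftrightarrow>
    X \<in> tri_carrier D \<and> psd_kernel (idx D) (tri_entry D X)"
proof (cases "X \<in> tri_carrier D")
  case True
  have "psd_kernel {..<total_dim D} (\<lambda>i j. X $$ (i, j)) \<longleftrightarrow> psd_kernel (idx D) (tri_entry D X)"
  proof
    assume "psd_kernel {..<total_dim D} (\<lambda>i j. X $$ (i, j))"
    from psd_kernel_pullback[OF this, of "idx D" "index_of D"]
    have "psd_kernel (idx D) (\<lambda>s t. X $$ (index_of D s, index_of D t))" by (simp add: index_of_less)
    then show "psd_kernel (idx D) (tri_entry D X)" by (simp add: tri_entry_def[abs_def])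
  next
    assume "psd_kernel (idx D) (tri_entry D X)"
    from psd_kernel_pullback[OF this, of "{..<total_dim D}" "triple_of D"]
    have "psd_kernel {..<total_dim D} (\<lambda>i j. tri_entry D X (triple_of D i) (triple_of D j))"
      by (simp add: triple_of_idx)
    also have "?this \<longleftrightarrow> psd_kernel {..<total_dim D} (\<lambda>i j. X $$ (i, j))"
      by (rule psd_kernel_cong) (simp add: tri_entry_def index_of_triple_of)
    finally show "psd_kernel {..<total_dim D} (\<lambda>i j. X $$ (i, j))" .
  qed
  then show ?thesis using True by (simp add: positive_op_psd_kernel)
qed (simp add: positive_op_def)

text \<open>The map with Kraus operators \<open>K_g\<close>, \<open>g < G\<close>, where
  \<open>K_g\<close> sends the basis vector \<open>\<pi> g a\<close> to \<open>a\<close> for every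
  \<open>a\<close> with \<open>q g a\<close>.\<close>

definition relabel :: "nat \<Rightarrow> nat \<Rightarrow> (nat \<Rightarrow> nat \<Rightarrow> bool) \<Rightarrow> (nat \<Rightarrow> nat \<Rightarrow> nat) \<Rightarrow> complex mat \<Rightarrow> complex mat" where
  "relabel d' G q \<pi> X =
     mat d' d' (\<lambda>(a, b). \<Sum>g<G. if q g a \<and> q g b then X $$ (\<pi> g a, \<pi> g b) else 0)"

lemma relabel_carrier [simp]: "relabel d' G q \<pi> X \<in> carrier_mat d' d'"
  by (simp add: relabel_def)

text \<open>The bijection says that every input basis vector is used by exactly one pair of a Kraus
  index and an output vector. This is the trace condition: the products of the adjoint of
  \<open>K_g\<close> with \<open>K_g\<close> sum to the identity. Complete positivity holds because
  each summand is a masked pullback.\<close>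

lemma cptp_relabel:
  assumes bij: "bij_betw (\<lambda>(g, a). \<pi> g a) {(g, a). g < G \<and> a < d' \<and> q g a} {..<d}"
  shows "cptp d d' (relabel d' G q \<pi>)"
proof -
  have \<pi>: "\<pi> g a < d" if "g < G" "a < d'" "q g a" for g a
    using bij_betwE[OF bij] that by auto
  have add: "relabel d' G q \<pi> (X + Y) = relabel d' G q \<pi> X + relabel d' G q \<pi> Y"
    if "X \<in> carrier_mat d d" "Y \<in> carrier_mat d d" for X Y
  proof (rule eq_matI)
    fix i j assume "i < dim_row (relabel d' G q \<pi> X + relabel d' G q \<pi> Y)"
      "j < dim_col (relabel d' G q \<pi> X + relabel d' G q \<pi> Y)"
    then have ij: "i < d'" "j < d'" by (auto simp: relabel_def)
    show "relabel d' G q \<pi> (X + Y) $$ (i, j) = (relabel d' G q \<pi> X + relabel d' G q \<pi> Y) $$ (i, j)"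
    proof -
      have "(\<Sum>g<G. if q g i \<and> q g j then (X + Y) $$ (\<pi> g i, \<pi> g j) else 0)
        = (\<Sum>g<G. (if q g i \<and> q g j then X $$ (\<pi> g i, \<pi> g j) else 0) +
            (if q g i \<and> q g j then Y $$ (\<pi> g i, \<pi> g j) else 0))"
        using ij that \<pi> by (intro sum.cong refl) auto
      then show ?thesis using ij by (simp add: relabel_def sum.distrib)
    qed
  qed (auto simp: relabel_def)
  have smult: "relabel d' G q \<pi> (c \<cdot>\<^sub>m X) = c \<cdot>\<^sub>m relabel d' G q \<pi> X"
    if "X \<in> carrier_mat d d" for X c
  proof (rule eq_matI)
    fix i j assume "i < dim_row (c \<cdot>\<^sub>m relabel d' G q \<pi> X)" "j < dim_col (c \<cdot>\<^sub>m relabel d' G q \<pi> X)"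
    then have ij: "i < d'" "j < d'" by (auto simp: relabel_def)
    show "relabel d' G q \<pi> (c \<cdot>\<^sub>m X) $$ (i, j) = (c \<cdot>\<^sub>m relabel d' G q \<pi> X) $$ (i, j)"
    proof -
      have "(\<Sum>g<G. if q g i \<and> q g j then (c \<cdot>\<^sub>m X) $$ (\<pi> g i, \<pi> g j) else 0)
        = (\<Sum>g<G. c * (if q g i \<and> q g j then X $$ (\<pi> g i, \<pi> g j) else 0))"
        using ij that \<pi> by (intro sum.cong refl) auto
      then show ?thesis using ij by (simp add: relabel_def sum_distrib_left)
    qed
  qed (auto simp: relabel_def)
  have pos: "positive_op (k * d') (bob_local (k, d, 1) d' (relabel d' G q \<pi>) X)"
    if X: "positive_op (k * d) X" for k X
  proof -
    let ?Y = "bob_local (k, d, 1) d' (relabel d' G q \<pi>) X"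
    have X': "psd_kernel (idx (k, d, 1)) (tri_entry (k, d, 1) X)"
      using X positive_op_tri[of "(k, d, 1)" X] by simp
    have "psd_kernel (idx (k, d', 1)) (\<lambda>s t. \<Sum>g<G. if q g (fst (snd s)) \<and> q g (fst (snd t))
        then tri_entry (k, d, 1) X (fst s, \<pi> g (fst (snd s)), snd (snd s))
          (fst t, \<pi> g (fst (snd t)), snd (snd t)) else 0)"
      by (intro psd_kernel_sum psd_kernel_masked_pullback[OF X', where q = "\<lambda>s. q g (fst (snd s))"
          and \<pi> = "\<lambda>s. (fst s, \<pi> g (fst (snd s)), snd (snd s))" for g]) (auto simp: \<pi>)
    also have "?this \<longleftrightarrow> psd_kernel (idx (k, d', 1)) (tri_entry (k, d', 1) ?Y)"
    proof (rule psd_kernel_cong)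
      fix s t assume st: "s \<in> idx (k, d', 1)" "t \<in> idx (k, d', 1)"
      obtain a1 b1 e1 a2 b2 e2 where eq: "s = (a1, b1, e1)" "t = (a2, b2, e2)" by (metis prod_cases3)
      show "(\<Sum>g<G. if q g (fst (snd s)) \<and> q g (fst (snd t))
        then tri_entry (k, d, 1) X (fst s, \<pi> g (fst (snd s)), snd (snd s))
          (fst t, \<pi> g (fst (snd t)), snd (snd t)) else 0) = tri_entry (k, d', 1) ?Y s t"
      proof -
        have "tri_entry (k, d', 1) ?Y s t
          = relabel d' G q \<pi> (mat d d (\<lambda>(x, y). tri_entry (k, d, 1) X (a1, x, e1) (a2, y, e2))) $$ (b1, b2)"
          unfolding bob_local.simps by (subst tri_entry_tri_mat[OF st]) (simp add: eq)
        then show ?thesis using st unfolding eq by (auto simp: relabel_def \<pi> intro!: sum.cong)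
      qed
    qed
    finally show ?thesis
      using positive_op_tri[of "(k, d', 1)" ?Y] tri_mat_carrier[of "(k, d', 1)"] by simp
  qed
  have tr: "mat_trace (relabel d' G q \<pi> X) = mat_trace X" if X: "X \<in> carrier_mat d d" for X
  proof -
    have S: "{(g, a). g < G \<and> a < d' \<and> q g a} = {p \<in> {..<G} \<times> {..<d'}. q (fst p) (snd p)}" by auto
    have "mat_trace (relabel d' G q \<pi> X) = (\<Sum>a<d'. \<Sum>g<G. if q g a then X $$ (\<pi> g a, \<pi> g a) else 0)"
      by (simp add: mat_trace_def relabel_def)
    also have "\<dots> = (\<Sum>p\<in>{..<G} \<times> {..<d'}. if q (fst p) (snd p)
        then X $$ (\<pi> (fst p) (snd p), \<pi> (fst p) (snd p)) else 0)"
      by (subst sum.swap) (simp add: sum.cartesian_product case_prod_beta)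
    also have "\<dots> = (\<Sum>p\<in>{(g, a). g < G \<and> a < d' \<and> q g a}. (\<lambda>x. X $$ (x, x)) ((\<lambda>(g, a). \<pi> g a) p))"
      unfolding S by (simp add: sum.inter_filter case_prod_beta)
    also have "\<dots> = (\<Sum>x<d. X $$ (x, x))" by (rule sum.reindex_bij_betw[OF bij])
    finally show ?thesis using X by (simp add: mat_trace_def)
  qed
  show ?thesis
    unfolding cptp_def by (intro conjI ballI allI impI relabel_carrier add smult pos tr)
qed

text \<open>Complete positivity is stated with \<open>{..<k}\<close> as index set of the reference system; here it is
  transferred to an arbitrary finite index set.\<close>

lemma cptp_psd_kernel:
  assumes \<Lambda>: "cptp d d' \<Lambda>" and R: "finite R" and k: "psd_kernel (R \<times> {..<d}) k"
  shows "psd_kernel (R \<times> {..<d'}) (\<lambda>s t. \<Lambda> (mat d d (\<lambda>(x, y). k (fst s, x) (fst t, y))) $$ (snd s, snd t))"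
proof -
  let ?K = "card R"
  obtain h where h: "bij_betw h {..<?K} R"
    using ex_bij_betw_nat_finite[OF R] by (auto simp: lessThan_atLeast0)
  define h' where "h' = inv_into {..<?K} h"
  have surj: "h ` {..<?K} = R" using h by (rule bij_betw_imp_surj_on)
  have h'R: "h' r < ?K" "h (h' r) = r" if "r \<in> R" for r
    using inv_into_into[of r h "{..<?K}"] f_inv_into_f[of r h "{..<?K}"] that
    unfolding h'_def surj by auto
  have hR: "i < ?K \<Longrightarrow> h i \<in> R" for i using bij_betwE[OF h] by auto
  define X where "X = tri_mat (?K, d, 1) (\<lambda>(r1, x, _) (r2, y, _). k (h r1, x) (h r2, y))"
  let ?Y = "bob_local (?K, d, 1) d' \<Lambda> X"
  have "psd_kernel (idx (?K, d, 1)) (\<lambda>s t. k (h (fst s), fst (snd s)) (h (fst t), fst (snd t)))"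
    by (rule psd_kernel_pullback[OF k, where \<pi> = "\<lambda>s. (h (fst s), fst (snd s))"]) (auto simp: R hR)
  also have "?this \<longleftrightarrow> psd_kernel (idx (?K, d, 1)) (tri_entry (?K, d, 1) X)"
    by (intro psd_kernel_cong) (auto simp: X_def tri_entry_tri_mat)
  finally have "positive_op (total_dim (?K, d, 1)) X"
    unfolding positive_op_tri by (simp only: X_def tri_mat_carrier simp_thms)
  then have "positive_op (?K * d') ?Y" using \<Lambda> unfolding cptp_def by simp
  then have Y: "psd_kernel (idx (?K, d', 1)) (tri_entry (?K, d', 1) ?Y)"
    using positive_op_tri[of "(?K, d', 1)" ?Y] by simp
  have "psd_kernel (R \<times> {..<d'}) (\<lambda>s t. tri_entry (?K, d', 1) ?Y (h' (fst s), snd s, 0) (h' (fst t), snd t, 0))"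
    by (rule psd_kernel_pullback[OF Y, where \<pi> = "\<lambda>s. (h' (fst s), snd s, 0)"]) (auto simp: h'R)
  also have "?this \<longleftrightarrow> ?thesis"
  proof (rule psd_kernel_cong)
    fix s t assume st: "s \<in> R \<times> {..<d'}" "t \<in> R \<times> {..<d'}"
    have "tri_entry (?K, d', 1) ?Y (h' (fst s), snd s, 0) (h' (fst t), snd t, 0)
      = \<Lambda> (mat d d (\<lambda>(x, y). tri_entry (?K, d, 1) X (h' (fst s), x, 0) (h' (fst t), y, 0))) $$ (snd s, snd t)"
    proof -
      have "(h' (fst s), snd s, 0) \<in> idx (?K, d', 1)" "(h' (fst t), snd t, 0) \<in> idx (?K, d', 1)"
        using st h'R(1)[of "fst s"] h'R(1)[of "fst t"] by auto
      then show ?thesis unfolding bob_local.simps by (simp add: tri_entry_tri_mat del: idx.simps)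
    qed
    also have "mat d d (\<lambda>(x, y). tri_entry (?K, d, 1) X (h' (fst s), x, 0) (h' (fst t), y, 0))
      = mat d d (\<lambda>(x, y). k (fst s, x) (fst t, y))"
    proof (rule eq_matI)
      fix x y assume "x < dim_row (mat d d (\<lambda>(x, y). k (fst s, x) (fst t, y)))"
        "y < dim_col (mat d d (\<lambda>(x, y). k (fst s, x) (fst t, y)))"
      then have xy: "x < d" "y < d" by auto
      then have "(h' (fst s), x, 0) \<in> idx (?K, d, 1)" "(h' (fst t), y, 0) \<in> idx (?K, d, 1)"
        using st h'R(1)[of "fst s"] h'R(1)[of "fst t"] by auto
      then show "mat d d (\<lambda>(x, y). tri_entry (?K, d, 1) X (h' (fst s), x, 0) (h' (fst t), y, 0)) $$ (x, y)
        = mat d d (\<lambda>(x, y). k (fst s, x) (fst t, y)) $$ (x, y)"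
        using st xy h'R(2)[of "fst s"] h'R(2)[of "fst t"]
        by (auto simp: X_def tri_entry_tri_mat simp del: idx.simps)
    qed auto
    finally show "tri_entry (?K, d', 1) ?Y (h' (fst s), snd s, 0) (h' (fst t), snd t, 0)
      = \<Lambda> (mat d d (\<lambda>(x, y). k (fst s, x) (fst t, y))) $$ (snd s, snd t)" .
  qed
  finally show ?thesis .
qed

section \<open>Properties of LOPC operations\<close>

definition linear_op :: "nat \<Rightarrow> nat \<Rightarrow> (complex mat \<Rightarrow> complex mat) \<Rightarrow> bool" where
  "linear_op d d' \<Lambda> \<longleftrightarrow>
     (\<forall>X\<in>carrier_mat d d. \<Lambda> X \<in> carrier_mat d' d') \<and>
     (\<forall>X\<in>carrier_mat d d. \<forall>Y\<in>carrier_mat d d. \<Lambda> (X + Y) = \<Lambda> X + \<Lambda> Y) \<and>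
     (\<forall>c. \<forall>X\<in>carrier_mat d d. \<Lambda> (c \<cdot>\<^sub>m X) = c \<cdot>\<^sub>m \<Lambda> X)"

lemma linear_opD:
  assumes "linear_op d d' \<Lambda>" "X \<in> carrier_mat d d"
  shows "\<Lambda> X \<in> carrier_mat d' d'" "Y \<in> carrier_mat d d \<Longrightarrow> \<Lambda> (X + Y) = \<Lambda> X + \<Lambda> Y"
    "\<Lambda> (c \<cdot>\<^sub>m X) = c \<cdot>\<^sub>m \<Lambda> X"
  using assms by (auto simp: linear_op_def)

lemma linear_op_mat_sum:
  assumes lin: "linear_op d d' \<Lambda>" and "finite J" "\<And>j. j \<in> J \<Longrightarrow> x j \<in> carrier_mat d d"
  shows "\<Lambda> (mat_sum d x J) = mat_sum d' (\<lambda>j. \<Lambda> (x j)) J"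
  using assms(2,3)
proof (induction J rule: finite_induct)
  case empty
  have "mat_sum d x {} = 0 \<cdot>\<^sub>m 0\<^sub>m d d" by (rule eq_matI) auto
  then have "\<Lambda> (mat_sum d x {}) = 0 \<cdot>\<^sub>m \<Lambda> (0\<^sub>m d d)"
    by (simp only: linear_opD(3)[OF lin zero_carrier_mat])
  also have "\<dots> = mat_sum d' (\<lambda>j. \<Lambda> (x j)) {}"
    using linear_opD(1)[OF lin, of "0\<^sub>m d d"] by (intro eq_matI) auto
  finally show ?case .
next
  case (insert j J)
  have ins: "mat_sum e y (insert j J) = y j + mat_sum e y J" if "y j \<in> carrier_mat e e" for e y
    using that insert.hyps by (intro eq_matI) auto
  have xj: "x j \<in> carrier_mat d d" using insert.prems by simp
  have "\<Lambda> (mat_sum d x (insert j J)) = \<Lambda> (x j) + \<Lambda> (mat_sum d x J)"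
    unfolding ins[of x, OF xj] using linear_opD(2)[OF lin xj] by simp
  also have "\<dots> = mat_sum d' (\<lambda>j. \<Lambda> (x j)) (insert j J)"
    using ins[of "\<lambda>j. \<Lambda> (x j)", OF linear_opD(1)[OF lin xj]] insert by simp
  finally show ?case .
qed

lemma cptp_linear_op: "cptp d d' \<Lambda> \<Longrightarrow> linear_op d d' \<Lambda>"
  unfolding cptp_def linear_op_def by blast

section \<open>Entrywise linearity and local maps\<close>

lemma tri_entry_add:
  assumes "X \<in> tri_carrier D" "Y \<in> tri_carrier D"
    "s \<in> idx D" "t \<in> idx D"
  shows "tri_entry D (X + Y) s t = tri_entry D X s t + tri_entry D Y s t"
  using assms index_of_less[OF assms(3)] index_of_less[OF assms(4)] by (simp add: tri_entry_def)

lemma tri_entry_minus: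
  assumes "X \<in> tri_carrier D" "Y \<in> tri_carrier D"
    "s \<in> idx D" "t \<in> idx D"
  shows "tri_entry D (X - Y) s t = tri_entry D X s t - tri_entry D Y s t"
  using assms index_of_less[OF assms(3)] index_of_less[OF assms(4)] by (simp add: tri_entry_def)

lemma tri_entry_smult:
  assumes "X \<in> tri_carrier D" "s \<in> idx D" "t \<in> idx D"
  shows "tri_entry D (c \<cdot>\<^sub>m X) s t = c * tri_entry D X s t"
  using assms index_of_less[OF assms(2)] index_of_less[OF assms(3)] by (simp add: tri_entry_def)

lemma tri_entry_mat_sum:
  assumes "s \<in> idx D" "t \<in> idx D"
  shows "tri_entry D (mat_sum (total_dim D) x J) s t = (\<Sum>j\<in>J. tri_entry D (x j) s t)"
  using index_of_less[OF assms(1)] index_of_less[OF assms(2)] by (simp add: tri_entry_def)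

lemma linear_op_triI:
  assumes "\<And>X. X \<in> tri_carrier D \<Longrightarrow>
      \<Lambda> X \<in> tri_carrier D'"
    and "\<And>X Y s t. X \<in> tri_carrier D \<Longrightarrow> Y \<in> tri_carrier D
      \<Longrightarrow> s \<in> idx D' \<Longrightarrow> t \<in> idx D' \<Longrightarrow>
      tri_entry D' (\<Lambda> (X + Y)) s t = tri_entry D' (\<Lambda> X) s t + tri_entry D' (\<Lambda> Y) s t"
    and "\<And>X c s t. X \<in> tri_carrier D \<Longrightarrow> s \<in> idx D' \<Longrightarrow> t \<in> idx D' \<Longrightarrow>
      tri_entry D' (\<Lambda> (c \<cdot>\<^sub>m X)) s t = c * tri_entry D' (\<Lambda> X) s t"
  shows "linear_op (total_dim D) (total_dim D') \<Lambda>"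
  unfolding linear_op_def
proof (intro conjI ballI allI assms(1))
  fix X Y :: "complex mat" assume XY: "X \<in> tri_carrier D" "Y \<in> tri_carrier D"
  then have XY': "X + Y \<in> tri_carrier D" by simp
  note c = XY[THEN assms(1)] XY'[THEN assms(1)]
  show "\<Lambda> (X + Y) = \<Lambda> X + \<Lambda> Y"
    by (rule tri_mat_eqI[where D = D']) (use c in \<open>auto simp: assms(2)[OF XY] tri_entry_add\<close>)
next
  fix c and X :: "complex mat" assume X: "X \<in> tri_carrier D"
  then have X': "c \<cdot>\<^sub>m X \<in> tri_carrier D" by simp
  show "\<Lambda> (c \<cdot>\<^sub>m X) = c \<cdot>\<^sub>m \<Lambda> X"
    by (rule tri_mat_eqI[where D = D'])
      (use assms(1)[OF X] assms(1)[OF X'] in \<open>auto simp: assms(3)[OF X] tri_entry_smult\<close>)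
qed

lemma sum_idx_bob:
  "sum g (idx (dA, dB, dE)) = (\<Sum>p\<in>{..<dA} \<times> {..<dE}. \<Sum>b<dB. g (fst p, b, snd p))"
  unfolding sum.cartesian_product
  by (rule sum.reindex_bij_witness[where i = "\<lambda>(p, b). (fst p, b, snd p)" and j = "\<lambda>(a, b, e). ((a, e), b)"])
    auto

abbreviation alice_block :: "dims \<Rightarrow> complex mat \<Rightarrow> nat \<Rightarrow> nat \<Rightarrow> nat \<Rightarrow> nat \<Rightarrow> complex mat" where
  "alice_block D X b1 e1 b2 e2 \<equiv>
    mat (fst D) (fst D) (\<lambda>(x, y). tri_entry D X (x, b1, e1) (y, b2, e2))"

abbreviation bob_block :: "dims \<Rightarrow> complex mat \<Rightarrow> nat \<Rightarrow> nat \<Rightarrow> nat \<Rightarrow> nat \<Rightarrow> complex mat" where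
  "bob_block D X a1 e1 a2 e2 \<equiv>
    mat (fst (snd D)) (fst (snd D)) (\<lambda>(x, y). tri_entry D X (a1, x, e1) (a2, y, e2))"

lemma tri_entry_alice_local:
  assumes "(a1, b1, e1) \<in> idx (d', dB, dE)" "(a2, b2, e2) \<in> idx (d', dB, dE)"
  shows "tri_entry (d', dB, dE) (alice_local (dA, dB, dE) d' \<Lambda> X) (a1, b1, e1) (a2, b2, e2)
    = \<Lambda> (alice_block (dA, dB, dE) X b1 e1 b2 e2) $$ (a1, a2)"
  unfolding alice_local.simps by (subst tri_entry_tri_mat[OF assms]) simp

lemma tri_entry_bob_local:
  assumes "(a1, b1, e1) \<in> idx (dA, d', dE)" "(a2, b2, e2) \<in> idx (dA, d', dE)"
  shows "tri_entry (dA, d', dE) (bob_local (dA, dB, dE) d' \<Lambda> X) (a1, b1, e1) (a2, b2, e2)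
    = \<Lambda> (bob_block (dA, dB, dE) X a1 e1 a2 e2) $$ (b1, b2)"
  unfolding bob_local.simps by (subst tri_entry_tri_mat[OF assms]) simp

lemma linear_op_bob_local:
  assumes "linear_op dB d' \<Lambda>"
  shows "linear_op (total_dim (dA, dB, dE)) (total_dim (dA, d', dE)) (bob_local (dA, dB, dE) d' \<Lambda>)"
proof (rule linear_op_triI)
  fix X :: "complex mat" assume X: "X \<in> tri_carrier (dA, dB, dE)"
  show "bob_local (dA, dB, dE) d' \<Lambda> X \<in> tri_carrier (dA, d', dE)"
    unfolding bob_local.simps by (rule tri_mat_carrier)
  fix s t assume st: "s \<in> idx (dA, d', dE)" "t \<in> idx (dA, d', dE)"
  obtain a1 b1 e1 a2 b2 e2 where eq: "s = (a1, b1, e1)" "t = (a2, b2, e2)" by (metis prod_cases3)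
  have l: "a1 < fst (dA, d', dE)" "a2 < fst (dA, d', dE)" "b1 < fst (snd (dA, d', dE))" "b2 < fst (snd (dA, d', dE))" "e1 < dE" "e2 < dE"
    using st eq by auto
  let ?b = "\<lambda>X. bob_block (dA, dB, dE) X a1 e1 a2 e2"
  have bc: "?b X \<in> carrier_mat dB dB" for X by simp
  note lin = linear_opD[OF assms bc]
  note entry = tri_entry_bob_local[OF st[unfolded eq]]
  {
    fix Y :: "complex mat"
    assume Y: "Y \<in> tri_carrier (dA, dB, dE)"
    have "?b (X + Y) = ?b X + ?b Y"
      using l by (intro eq_matI) (auto simp: tri_entry_add[OF X Y])
    then show "tri_entry (dA, d', dE) (bob_local (dA, dB, dE) d' \<Lambda> (X + Y)) s t
      = tri_entry (dA, d', dE) (bob_local (dA, dB, dE) d' \<Lambda> X) s t + tri_entry (dA, d', dE) (bob_local (dA, dB, dE) d' \<Lambda> Y) s t"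
      unfolding eq entry using lin(1)[of X] lin(1)[of Y] lin(2)[OF bc, of X Y] l by simp
  }
  fix c
  have "?b (c \<cdot>\<^sub>m X) = c \<cdot>\<^sub>m ?b X"
    using l by (intro eq_matI) (auto simp: tri_entry_smult[OF X])
  then show "tri_entry (dA, d', dE) (bob_local (dA, dB, dE) d' \<Lambda> (c \<cdot>\<^sub>m X)) s t
    = c * tri_entry (dA, d', dE) (bob_local (dA, dB, dE) d' \<Lambda> X) s t"
    unfolding eq entry using lin(1)[of X] lin(3)[of c X] l by simp
qed

text \<open>Alice and Eve together form the reference system of complete positivity; its index set
  consists of pairs, which is why \<open>cptp_psd_kernel\<close> allows arbitrary finite
  sets.\<close>

lemma positive_op_bob_local:
  assumes \<Lambda>: "cptp dB d' \<Lambda>" and X: "positive_op (total_dim (dA, dB, dE)) X"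
  shows "positive_op (total_dim (dA, d', dE)) (bob_local (dA, dB, dE) d' \<Lambda> X)"
proof -
  let ?R = "{..<dA} \<times> {..<dE}"
  let ?k = "\<lambda>s t. tri_entry (dA, dB, dE) X (fst (fst s), snd s, snd (fst s)) (fst (fst t), snd t, snd (fst t))"
  let ?k' = "\<lambda>s t. \<Lambda> (mat dB dB (\<lambda>(x, y). ?k (fst s, x) (fst t, y))) $$ (snd s, snd t)"
  let ?Y = "bob_local (dA, dB, dE) d' \<Lambda> X"
  have "psd_kernel (idx (dA, dB, dE)) (tri_entry (dA, dB, dE) X)"
    using X positive_op_tri by blast
  then have "psd_kernel (?R \<times> {..<dB}) ?k"
    by (rule psd_kernel_pullback[where \<pi> = "\<lambda>s. (fst (fst s), snd s, snd (fst s))"]) auto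
  from cptp_psd_kernel[OF \<Lambda> _ this] have "psd_kernel (?R \<times> {..<d'}) ?k'" by blast
  then have "psd_kernel (idx (dA, d', dE)) (\<lambda>s t. ?k' ((fst s, snd (snd s)), fst (snd s)) ((fst t, snd (snd t)), fst (snd t)))"
    by (rule psd_kernel_pullback[where \<pi> = "\<lambda>s. ((fst s, snd (snd s)), fst (snd s))"]) auto
  also have "?this \<longleftrightarrow> psd_kernel (idx (dA, d', dE)) (tri_entry (dA, d', dE) ?Y)"
  proof (rule psd_kernel_cong)
    fix s t assume st: "s \<in> idx (dA, d', dE)" "t \<in> idx (dA, d', dE)"
    obtain a1 b1 e1 a2 b2 e2 where eq: "s = (a1, b1, e1)" "t = (a2, b2, e2)" by (metis prod_cases3)
    show "?k' ((fst s, snd (snd s)), fst (snd s)) ((fst t, snd (snd t)), fst (snd t)) = tri_entry (dA, d', dE) ?Y s t"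
      using st tri_entry_bob_local unfolding eq by simp
  qed
  finally show ?thesis using positive_op_tri tri_mat_carrier unfolding bob_local.simps by blast
qed

lemma mat_trace_bob_local:
  assumes \<Lambda>: "cptp dB d' \<Lambda>" and X: "X \<in> tri_carrier (dA, dB, dE)"
  shows "mat_trace (bob_local (dA, dB, dE) d' \<Lambda> X) = mat_trace X"
proof -
  let ?Y = "bob_local (dA, dB, dE) d' \<Lambda> X"
  let ?b = "\<lambda>a e. bob_block (dA, dB, dE) X a e a e"
  have Yc: "?Y \<in> tri_carrier (dA, d', dE)"
    unfolding bob_local.simps by (rule tri_mat_carrier)
  have tr: "mat_trace (\<Lambda> (?b a e)) = mat_trace (?b a e)" "\<Lambda> (?b a e) \<in> carrier_mat d' d'" for a e
    using \<Lambda> unfolding cptp_def by auto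
  have "mat_trace ?Y = (\<Sum>p\<in>{..<dA} \<times> {..<dE}. \<Sum>b<d'. \<Lambda> (?b (fst p) (snd p)) $$ (b, b))"
    unfolding mat_trace_tri[OF Yc] sum_idx_bob
    by (intro sum.cong refl tri_entry_bob_local) auto
  also have "\<dots> = (\<Sum>p\<in>{..<dA} \<times> {..<dE}. mat_trace (\<Lambda> (?b (fst p) (snd p))))"
    by (intro sum.cong refl) (simp only: mat_trace_def carrier_matD(1)[OF tr(2)])
  also have "\<dots> = (\<Sum>p\<in>{..<dA} \<times> {..<dE}. \<Sum>b<dB. tri_entry (dA, dB, dE) X (fst p, b, snd p) (fst p, b, snd p))"
    unfolding tr(1) by (simp add: mat_trace_def)
  also have "\<dots> = mat_trace X" unfolding mat_trace_tri[OF X] sum_idx_bob ..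
  finally show ?thesis .
qed

section \<open>Public communication as a masked sum\<close>

definition same_mod :: "nat \<Rightarrow> nat \<times> nat \<times> nat \<Rightarrow> nat \<Rightarrow> bool" where
  "same_mod m s i \<longleftrightarrow> fst s mod m = i \<and> fst (snd s) mod m = i \<and> snd (snd s) mod m = i"

text \<open>At most one \<open>i\<close> satisfies the condition in \<open>bob_sends\<close>, so the
  conditional may be written as a sum over messages. This is the Kraus form required by
  \<open>tri_masked_sum_facts\<close>.\<close>

lemma tri_entry_bob_sends:
  assumes "s \<in> idx (dA * m, dB * m, dE * m)" "t \<in> idx (dA * m, dB * m, dE * m)"
  shows "tri_entry (dA * m, dB * m, dE * m) (bob_sends m (dA, dB * m, dE) X) s t
    = (\<Sum>i<m. if same_mod m s i \<and> same_mod m t i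
        then tri_entry (dA, dB * m, dE) X (fst s div m, fst (snd s), snd (snd s) div m)
          (fst t div m, fst (snd t), snd (snd t) div m) else 0)"
proof -
  obtain a1 b1 e1 a2 b2 e2 where eq: "s = (a1, b1, e1)" "t = (a2, b2, e2)" by (metis prod_cases3)
  let ?x = "tri_entry (dA, dB * m, dE) X (a1 div m, b1, e1 div m) (a2 div m, b2, e2 div m)"
  have m: "0 < m" using assms eq by (auto intro: Nat.gr0I)
  have "(\<Sum>i<m. if same_mod m s i \<and> same_mod m t i then ?x else 0)
      = (\<Sum>i<m. if i = a1 mod m then (if same_mod m s i \<and> same_mod m t i then ?x else 0) else 0)"
    by (intro sum.cong refl) (auto simp: same_mod_def eq)
  also have "\<dots> = (if same_mod m s (a1 mod m) \<and> same_mod m t (a1 mod m) then ?x else 0)"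
    using m by simp
  also have "\<dots> = (if \<exists>i. a1 mod m = i \<and> b1 mod m = i \<and> e1 mod m = i \<and>
      a2 mod m = i \<and> b2 mod m = i \<and> e2 mod m = i then ?x else 0)"
    by (intro if_cong refl) (auto simp: same_mod_def eq)
  finally show ?thesis
    unfolding bob_sends.simps tri_entry_tri_mat[OF assms] unfolding eq fst_conv snd_conv case_prod_conv by (rule sym)
qed

text \<open>The counterpart of \<open>cptp_relabel\<close> for maps that act on all three parties at
  once: the bijection again encodes trace preservation. It serves public messages, the exchange of
  Alice and Bob, and the partial trace.\<close>

lemma tri_masked_sum_facts:
  assumes entry: "\<And>X s t. s \<in> idx D' \<Longrightarrow> t \<in> idx D' \<Longrightarrow>
      tri_entry D' (\<Gamma> X) s t = (\<Sum>i<m. if q s i \<and> q t i then tri_entry D X (\<pi> i s) (\<pi> i t) else 0)"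
    and carrier: "\<And>X. \<Gamma> X \<in> tri_carrier D'"
    and bij: "bij_betw (\<lambda>(i, s). \<pi> i s) {(i, s). i < (m :: nat) \<and> s \<in> idx D' \<and> q s i} (idx D)"
  shows "linear_op (total_dim D) (total_dim D') \<Gamma>"
    and "positive_op (total_dim D) X \<Longrightarrow> positive_op (total_dim D') (\<Gamma> X)"
    and "X \<in> tri_carrier D \<Longrightarrow> mat_trace (\<Gamma> X) = mat_trace X"
proof -
  have \<pi>: "\<pi> i s \<in> idx D" if "i < m" "s \<in> idx D'" "q s i" for i s
    using bij_betwE[OF bij, rule_format, of "(i, s)"] that by simp
  show "linear_op (total_dim D) (total_dim D') \<Gamma>"
  proof (rule linear_op_triI[OF carrier])
    fix X Y :: "complex mat" and c s t
    assume X: "X \<in> tri_carrier D" and st: "s \<in> idx D'" "t \<in> idx D'"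
    {
      assume Y: "Y \<in> tri_carrier D"
      show "tri_entry D' (\<Gamma> (X + Y)) s t = tri_entry D' (\<Gamma> X) s t + tri_entry D' (\<Gamma> Y) s t"
        unfolding entry[OF st] sum.distrib[symmetric]
        using \<pi> st by (intro sum.cong refl) (auto simp: tri_entry_add[OF X Y])
    }
    show "tri_entry D' (\<Gamma> (c \<cdot>\<^sub>m X)) s t = c * tri_entry D' (\<Gamma> X) s t"
      unfolding entry[OF st] sum_distrib_left
      using \<pi> st by (intro sum.cong refl) (auto simp: tri_entry_smult[OF X])
  qed
  show "positive_op (total_dim D') (\<Gamma> X)" if X: "positive_op (total_dim D) X"
  proof -
    have k: "psd_kernel (idx D) (tri_entry D X)" using X positive_op_tri by blast
    have "psd_kernel (idx D') (\<lambda>s t. \<Sum>i<m. if q s i \<and> q t i then tri_entry D X (\<pi> i s) (\<pi> i t) else 0)"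
    proof (rule psd_kernel_sum)
      fix i assume "i \<in> {..<m}"
      then show "psd_kernel (idx D') (\<lambda>s t. if q s i \<and> q t i then tri_entry D X (\<pi> i s) (\<pi> i t) else 0)"
        using \<pi> by (intro psd_kernel_masked_pullback[OF k, where q = "\<lambda>s. q s i" and \<pi> = "\<pi> i"]) auto
    qed
    also have "?this \<longleftrightarrow> psd_kernel (idx D') (tri_entry D' (\<Gamma> X))"
      by (rule psd_kernel_cong) (simp add: entry)
    finally show ?thesis using positive_op_tri carrier by blast
  qed
  show "mat_trace (\<Gamma> X) = mat_trace X" if X: "X \<in> tri_carrier D"
  proof -
    have S: "{(i, s). i < m \<and> s \<in> idx D' \<and> q s i} = {p \<in> {..<m} \<times> idx D'. q (snd p) (fst p)}" by auto
    have "mat_trace (\<Gamma> X) = (\<Sum>s\<in>idx D'. \<Sum>i<m. if q s i then tri_entry D X (\<pi> i s) (\<pi> i s) else 0)"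
      unfolding mat_trace_tri[OF carrier] by (intro sum.cong refl) (simp add: entry)
    also have "\<dots> = (\<Sum>p\<in>{..<m} \<times> idx D'. if q (snd p) (fst p) then tri_entry D X (\<pi> (fst p) (snd p)) (\<pi> (fst p) (snd p)) else 0)"
      by (subst sum.swap) (simp add: sum.cartesian_product case_prod_beta)
    also have "\<dots> = (\<Sum>p\<in>{(i, s). i < m \<and> s \<in> idx D' \<and> q s i}. (\<lambda>x. tri_entry D X x x) ((\<lambda>(i, s). \<pi> i s) p))"
      unfolding S by (simp only: sum.inter_filter finite_cartesian_product finite_lessThan finite_idx case_prod_beta)
    also have "\<dots> = (\<Sum>x\<in>idx D. tri_entry D X x x)" by (rule sum.reindex_bij_betw[OF bij])
    finally show ?thesis unfolding mat_trace_tri[OF X] .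
  qed
qed

lemma mult_add_mod_div:
  assumes "y < z * (m :: nat)"
  shows "(x * m + y mod m) div m = x"
proof -
  have "0 < m" using assms by (auto intro: Nat.gr0I)
  then show ?thesis by simp
qed

text \<open>The message is the last digit \<open>b mod m\<close> of Bob's index; the inverse map
  copies it into the registers of Alice and Eve.\<close>

lemma bij_bob_sends:
  "bij_betw (\<lambda>(i, s). (fst s div m, fst (snd s), snd (snd s) div m))
    {(i, s). i < m \<and> s \<in> idx (dA * m, dB * m, dE * m) \<and> same_mod m s i} (idx (dA, dB * m, dE))"
proof (rule bij_betw_byWitness[where f' = "\<lambda>(a, b, e). (b mod m, (a * m + b mod m, b, e * m + b mod m))"])
  show "\<forall>p\<in>{(i, s). i < m \<and> s \<in> idx (dA * m, dB * m, dE * m) \<and> same_mod m s i}.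
    (case case p of (i, s) \<Rightarrow> (fst s div m, fst (snd s), snd (snd s) div m) of
      (a, b, e) \<Rightarrow> (b mod m, (a * m + b mod m, b, e * m + b mod m))) = p"
    by (auto simp: same_mod_def) (metis div_mult_mod_eq)+
  show "\<forall>p\<in>idx (dA, dB * m, dE). (case (case p of (a, b, e) \<Rightarrow> (b mod m, (a * m + b mod m, b, e * m + b mod m))) of
      (i, s) \<Rightarrow> (fst s div m, fst (snd s), snd (snd s) div m)) = p"
    by (auto simp: mult_add_mod_div)
  show "(\<lambda>(i, s). (fst s div m, fst (snd s), snd (snd s) div m)) `
    {(i, s). i < m \<and> s \<in> idx (dA * m, dB * m, dE * m) \<and> same_mod m s i} \<subseteq> idx (dA, dB * m, dE)"
    by (auto simp: less_mult_imp_div_less)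
  have "(b mod m, (a * m + b mod m, b, e * m + b mod m))
      \<in> {(i, s). i < m \<and> s \<in> idx (dA * m, dB * m, dE * m) \<and> same_mod m s i}"
    if "a < dA" "b < dB * m" "e < dE" for a b e
  proof -
    have "0 < m" using that by (auto intro: Nat.gr0I)
    then show ?thesis using that by (auto simp: same_mod_def nat_pair_less)
  qed
  then show "(\<lambda>(a, b, e). (b mod m, (a * m + b mod m, b, e * m + b mod m))) ` idx (dA, dB * m, dE)
    \<subseteq> {(i, s). i < m \<and> s \<in> idx (dA * m, dB * m, dE * m) \<and> same_mod m s i}"
    by (auto simp del: mem_Collect_eq)
qed

fun swap_idx :: "nat \<times> nat \<times> nat \<Rightarrow> nat \<times> nat \<times> nat" where
  "swap_idx (a, b, e) = (b, a, e)"

text \<open>With this exchange a step of Alice is a step of Bob between two swaps, so only Bob's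
  steps need a direct analysis.\<close>

fun swap_parties :: "dims \<Rightarrow> complex mat \<Rightarrow> complex mat" where
  "swap_parties (dA, dB, dE) X =
     tri_mat (dB, dA, dE) (\<lambda>s t. tri_entry (dA, dB, dE) X (swap_idx s) (swap_idx t))"

lemma swap_parties_carrier:
  "swap_parties (dA, dB, dE) X \<in> tri_carrier (dB, dA, dE)"
  unfolding swap_parties.simps by (rule tri_mat_carrier)

lemma tri_entry_swap_parties:
  "s \<in> idx (dB, dA, dE) \<Longrightarrow> t \<in> idx (dB, dA, dE) \<Longrightarrow>
    tri_entry (dB, dA, dE) (swap_parties (dA, dB, dE) X) s t = tri_entry (dA, dB, dE) X (swap_idx s) (swap_idx t)"
  unfolding swap_parties.simps by (rule tri_entry_tri_mat)

text \<open>Plain positivity is the right invariant for composed maps: complete positivity enters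
  only inside a local step, where the other parties are the reference system.\<close>

definition ptp_map :: "dims \<Rightarrow> dims \<Rightarrow> (complex mat \<Rightarrow> complex mat) \<Rightarrow> bool" where
  "ptp_map D D' \<Gamma> \<longleftrightarrow> linear_op (total_dim D) (total_dim D') \<Gamma> \<and>
    (\<forall>X. positive_op (total_dim D) X \<longrightarrow> positive_op (total_dim D') (\<Gamma> X)) \<and>
    (\<forall>X\<in>tri_carrier D. mat_trace (\<Gamma> X) = mat_trace X)"

lemma ptp_map_comp:
  assumes "ptp_map D D' \<Lambda>" "ptp_map D' D'' \<Gamma>"
  shows "ptp_map D D'' (\<lambda>X. \<Gamma> (\<Lambda> X))"
proof -
  have "linear_op (total_dim D) (total_dim D'') (\<lambda>X. \<Gamma> (\<Lambda> X))"
    using assms unfolding ptp_map_def linear_op_def by simp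
  moreover have "mat_trace (\<Gamma> (\<Lambda> X)) = mat_trace X"
    if "X \<in> tri_carrier D" for X
    using that assms linear_opD(1) unfolding ptp_map_def by metis
  ultimately show ?thesis using assms unfolding ptp_map_def by blast
qed

lemma ptp_map_swap_parties: "ptp_map (dA, dB, dE) (dB, dA, dE) (swap_parties (dA, dB, dE))"
proof -
  have bij: "bij_betw (\<lambda>(i, s). swap_idx s)
      {(i :: nat, s). i < 1 \<and> s \<in> idx (dB, dA, dE) \<and> True} (idx (dA, dB, dE))"
    by (rule bij_betw_byWitness[where f' = "\<lambda>s. (0, swap_idx s)"]) auto
  have entry: "tri_entry (dB, dA, dE) (swap_parties (dA, dB, dE) X) s t
      = (\<Sum>i<(1 :: nat). if True \<and> True then tri_entry (dA, dB, dE) X (swap_idx s) (swap_idx t) else 0)"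
    if "s \<in> idx (dB, dA, dE)" "t \<in> idx (dB, dA, dE)" for X s t
    unfolding tri_entry_swap_parties[OF that] by simp
  show ?thesis
    unfolding ptp_map_def
    using tri_masked_sum_facts[where q = "\<lambda>_ _. True" and \<pi> = "\<lambda>_. swap_idx",
        OF entry swap_parties_carrier bij] by blast
qed

lemma alice_local_swap_parties:
  "alice_local (dA, dB, dE) d' \<Lambda> X
    = swap_parties (dB, d', dE) (bob_local (dB, dA, dE) d' \<Lambda> (swap_parties (dA, dB, dE) X))"
proof (rule tri_mat_eqI[where D = "(d', dB, dE)"])
  fix s t assume st: "s \<in> idx (d', dB, dE)" "t \<in> idx (d', dB, dE)"
  obtain a1 b1 e1 a2 b2 e2 where eq: "s = (a1, b1, e1)" "t = (a2, b2, e2)" by (metis prod_cases3)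
  have l: "a1 < d'" "b1 < dB" "e1 < dE" "a2 < d'" "b2 < dB" "e2 < dE" using st eq by auto
  have "alice_block (dA, dB, dE) X b1 e1 b2 e2 = bob_block (dB, dA, dE) (swap_parties (dA, dB, dE) X) b1 e1 b2 e2"
    using l by (intro eq_matI) (auto simp: tri_entry_swap_parties simp del: swap_parties.simps)
  then show "tri_entry (d', dB, dE) (alice_local (dA, dB, dE) d' \<Lambda> X) s t = tri_entry (d', dB, dE)
    (swap_parties (dB, d', dE) (bob_local (dB, dA, dE) d' \<Lambda> (swap_parties (dA, dB, dE) X))) s t"
    unfolding tri_entry_swap_parties[OF st] unfolding eq swap_idx.simps
    using l by (subst tri_entry_alice_local, simp, simp, subst tri_entry_bob_local) auto
qed (unfold alice_local.simps, rule tri_mat_carrier, rule swap_parties_carrier)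

lemma alice_sends_swap_parties:
  "alice_sends m (dA, dB, dE) X
    = swap_parties (dB * m, dA, dE * m) (bob_sends m (dB, dA, dE) (swap_parties (dA, dB, dE) X))"
proof (rule tri_mat_eqI[where D = "(dA, dB * m, dE * m)"])
  fix s t assume st: "s \<in> idx (dA, dB * m, dE * m)" "t \<in> idx (dA, dB * m, dE * m)"
  obtain a1 b1 e1 a2 b2 e2 where eq: "s = (a1, b1, e1)" "t = (a2, b2, e2)" by (metis prod_cases3)
  have i: "(b1, a1, e1) \<in> idx (dB * m, dA, dE * m)" "(b2, a2, e2) \<in> idx (dB * m, dA, dE * m)"
    "(b1 div m, a1, e1 div m) \<in> idx (dB, dA, dE)" "(b2 div m, a2, e2 div m) \<in> idx (dB, dA, dE)"
    using st eq by (auto simp: less_mult_imp_div_less)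
  show "tri_entry (dA, dB * m, dE * m) (alice_sends m (dA, dB, dE) X) s t = tri_entry (dA, dB * m, dE * m)
    (swap_parties (dB * m, dA, dE * m) (bob_sends m (dB, dA, dE) (swap_parties (dA, dB, dE) X))) s t"
    unfolding tri_entry_swap_parties[OF st] alice_sends.simps tri_entry_tri_mat[OF st]
    unfolding eq swap_idx.simps bob_sends.simps tri_entry_tri_mat[OF i(1,2)] case_prod_conv
      tri_entry_swap_parties[OF i(3,4)]
    by (intro if_cong refl) auto
qed (unfold alice_sends.simps, rule tri_mat_carrier, rule swap_parties_carrier)

section \<open>LOPC operations preserve positivity and trace\<close>

lemma ptp_map_bob_local:
  assumes "cptp dB d' \<Lambda>"
  shows "ptp_map (dA, dB, dE) (dA, d', dE) (bob_local (dA, dB, dE) d' \<Lambda>)"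
  using assms linear_op_bob_local[OF cptp_linear_op] positive_op_bob_local mat_trace_bob_local
  unfolding ptp_map_def by blast

lemma ptp_map_bob_sends:
  "ptp_map (dA, dB * m, dE) (dA * m, dB * m, dE * m) (bob_sends m (dA, dB * m, dE))"
proof -
  have c: "bob_sends m (dA, dB * m, dE) X
    \<in> tri_carrier (dA * m, dB * m, dE * m)" for X
    unfolding bob_sends.simps by (rule tri_mat_carrier)
  show ?thesis
    unfolding ptp_map_def using tri_masked_sum_facts[OF tri_entry_bob_sends c bij_bob_sends] by blast
qed

lemma lopc_step_facts: "lopc_step D D' \<Gamma> \<Longrightarrow> ptp_map D D' \<Gamma>"
proof (induction rule: lopc_step.induct)
  case (alice_local dA d' \<Lambda> dB dE)
  show ?case
    using ptp_map_comp[OF ptp_map_comp[OF ptp_map_swap_parties ptp_map_bob_local[OF alice_local]]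
        ptp_map_swap_parties]
    unfolding alice_local_swap_parties[symmetric] .
next
  case (alice_sends dA m dB dE)
  show ?case
    using ptp_map_comp[OF ptp_map_comp[OF ptp_map_swap_parties ptp_map_bob_sends]
        ptp_map_swap_parties]
    unfolding alice_sends_swap_parties[symmetric] .
qed (rule ptp_map_bob_local, assumption, rule ptp_map_bob_sends)

lemma lopc_facts: "lopc D D' \<Lambda> \<Longrightarrow> ptp_map D D' \<Lambda>"
proof (induction rule: lopc.induct)
  case (lopc_none D)
  then show ?case by (simp add: ptp_map_def linear_op_def)
next
  case (lopc_append D D' \<Lambda> D'' \<Gamma>)
  then show ?case using ptp_map_comp lopc_step_facts by blast
qed

lemma lopc_trans:
  assumes "lopc D' D'' \<Gamma>" "lopc D D' \<Lambda>"
  shows "lopc D D'' (\<lambda>X. \<Gamma> (\<Lambda> X))"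
  using assms
proof (induction rule: lopc.induct)
  case (lopc_none D')
  then show ?case by simp
next
  case (lopc_append D1 D2 \<Lambda>' D3 \<Gamma>')
  then show ?case using lopc.lopc_append[of D D2 "\<lambda>X. \<Lambda>' (\<Lambda> X)" D3 \<Gamma>'] by simp
qed

lemma lopc_single: "lopc_step D D' \<Gamma> \<Longrightarrow> lopc D D' \<Gamma>"
  using lopc.lopc_append[OF lopc.lopc_none] by simp

section \<open>Partial traces of Eve's system\<close>

text \<open>Partial trace over a factor of Eve's system, which is split by the bijection
  \<open>(e, g) \<mapsto> u e g\<close>.\<close>

fun eve_trace :: "dims \<Rightarrow> nat \<Rightarrow> (nat \<Rightarrow> nat \<Rightarrow> nat) \<Rightarrow> nat \<Rightarrow> complex mat \<Rightarrow> complex mat" where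
  "eve_trace (dA, dB, dE) G u d' X = tri_mat (dA, dB, d') (\<lambda>(a1, b1, e1) (a2, b2, e2).
     \<Sum>g<G. tri_entry (dA, dB, dE) X (a1, b1, u e1 g) (a2, b2, u e2 g))"

text \<open>The splitting is an arbitrary bijection instead of a quotient and a remainder: in
  \<open>n\<close> copies the traced factors are interleaved with the kept ones, and every public
  message appends another digit to Eve's index.\<close>

definition splits :: "nat \<Rightarrow> nat \<Rightarrow> nat \<Rightarrow> (nat \<Rightarrow> nat \<Rightarrow> nat) \<Rightarrow> bool" where
  "splits dE d' G u \<longleftrightarrow> bij_betw (\<lambda>(e, g). u e g) ({..<d'} \<times> {..<G}) {..<dE}"

lemma splits_less: "splits dE d' G u \<Longrightarrow> e < d' \<Longrightarrow> g < G \<Longrightarrow> u e g < dE"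
  unfolding splits_def by (drule bij_betwE) force

lemma tri_entry_eve_trace:
  assumes "s \<in> idx (dA, dB, d')" "t \<in> idx (dA, dB, d')"
  shows "tri_entry (dA, dB, d') (eve_trace (dA, dB, dE) G u d' X) s t
    = (\<Sum>g<G. tri_entry (dA, dB, dE) X (fst s, fst (snd s), u (snd (snd s)) g)
        (fst t, fst (snd t), u (snd (snd t)) g))"
  unfolding eve_trace.simps tri_entry_tri_mat[OF assms] by (simp add: case_prod_beta)

lemma eve_trace_carrier:
  "eve_trace (dA, dB, dE) G u d' X \<in> tri_carrier (dA, dB, d')"
  unfolding eve_trace.simps by (rule tri_mat_carrier)

lemma eve_trace_facts:
  assumes u: "splits dE d' G u"
  shows "linear_op (total_dim (dA, dB, dE)) (total_dim (dA, dB, d')) (eve_trace (dA, dB, dE) G u d')"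
    and "positive_op (total_dim (dA, dB, dE)) X \<Longrightarrow>
      positive_op (total_dim (dA, dB, d')) (eve_trace (dA, dB, dE) G u d' X)"
    and "X \<in> tri_carrier (dA, dB, dE) \<Longrightarrow>
      mat_trace (eve_trace (dA, dB, dE) G u d' X) = mat_trace X"
proof -
  let ?\<pi> = "\<lambda>g s. (fst s, fst (snd s), u (snd (snd s)) g)"
  have bij: "bij_betw (\<lambda>(g, s). ?\<pi> g s) {(g, s). g < G \<and> s \<in> idx (dA, dB, d') \<and> True} (idx (dA, dB, dE))"
    unfolding bij_betw_def
  proof
    have inj: "u e g = u e' g' \<Longrightarrow> e = e' \<and> g = g'" if "e < d'" "g < G" "e' < d'" "g' < G" for e g e' g'
      using u that unfolding splits_def bij_betw_def inj_on_def by force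
    show "inj_on (\<lambda>(g, s). ?\<pi> g s) {(g, s). g < G \<and> s \<in> idx (dA, dB, d') \<and> True}"
      by (rule inj_onI) (auto dest: inj)
    have surj: "\<exists>e<d'. \<exists>g<G. f = u e g" if "f < dE" for f
    proof -
      have "f \<in> (\<lambda>(e, g). u e g) ` ({..<d'} \<times> {..<G})"
        using u that unfolding splits_def bij_betw_def by simp
      then show ?thesis by auto
    qed
    show "(\<lambda>(g, s). ?\<pi> g s) ` {(g, s). g < G \<and> s \<in> idx (dA, dB, d') \<and> True} = idx (dA, dB, dE)"
    proof
      show "(\<lambda>(g, s). ?\<pi> g s) ` {(g, s). g < G \<and> s \<in> idx (dA, dB, d') \<and> True} \<subseteq> idx (dA, dB, dE)"
        using splits_less[OF u] by auto
      show "idx (dA, dB, dE) \<subseteq> (\<lambda>(g, s). ?\<pi> g s) ` {(g, s). g < G \<and> s \<in> idx (dA, dB, d') \<and> True}"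
      proof
        fix s assume "s \<in> idx (dA, dB, dE)"
        then obtain a b f where s: "s = (a, b, f)" "a < dA" "b < dB" "f < dE" by auto
        obtain e g where eg: "e < d'" "g < G" "f = u e g" using surj[OF s(4)] by blast
        then show "s \<in> (\<lambda>(g, s). ?\<pi> g s) ` {(g, s). g < G \<and> s \<in> idx (dA, dB, d') \<and> True}"
          using s by (intro image_eqI[of _ _ "(g, (a, b, e))"]) auto
      qed
    qed
  qed
  have entry: "tri_entry (dA, dB, d') (eve_trace (dA, dB, dE) G u d' X) s t
    = (\<Sum>g<G. if True \<and> True then tri_entry (dA, dB, dE) X (?\<pi> g s) (?\<pi> g t) else 0)"
    if "s \<in> idx (dA, dB, d')" "t \<in> idx (dA, dB, d')" for s t X
    unfolding tri_entry_eve_trace[OF that] by simp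
  note facts = tri_masked_sum_facts[where q = "\<lambda>_ _. True" and \<pi> = ?\<pi> and m = G and D = "(dA, dB, dE)"
      and D' = "(dA, dB, d')" and \<Gamma> = "eve_trace (dA, dB, dE) G u d'", OF entry eve_trace_carrier bij]
  show "linear_op (total_dim (dA, dB, dE)) (total_dim (dA, dB, d')) (eve_trace (dA, dB, dE) G u d')"
    by (rule facts(1))
  show "positive_op (total_dim (dA, dB, dE)) X \<Longrightarrow>
      positive_op (total_dim (dA, dB, d')) (eve_trace (dA, dB, dE) G u d' X)"
    by (rule facts(2))
  show "X \<in> tri_carrier (dA, dB, dE) \<Longrightarrow>
      mat_trace (eve_trace (dA, dB, dE) G u d' X) = mat_trace X"
    by (rule facts(3))
qed

text \<open>The message digit \<open>e mod m\<close> stays in the kept factor, and the digits in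
  front of it are split as before.\<close>

lemma splits_register:
  assumes u: "splits dE d' G u"
  shows "splits (dE * m) (d' * m) G (\<lambda>e g. u (e div m) g * m + e mod m)"
  unfolding splits_def bij_betw_def
proof
  let ?u = "\<lambda>e g. u (e div m) g * m + e mod m"
  have inj: "u e g = u e' g' \<Longrightarrow> e = e' \<and> g = g'" if "e < d'" "g < G" "e' < d'" "g' < G" for e g e' g'
    using u that unfolding splits_def bij_betw_def inj_on_def by force
  show "inj_on (\<lambda>(e, g). ?u e g) ({..<d' * m} \<times> {..<G})"
  proof (rule inj_onI, clarify)
    fix e g e' g' assume l: "e < d' * m" "g < G" "e' < d' * m" "g' < G" and eq: "?u e g = ?u e' g'"
    have m: "0 < m" using l by (auto intro: Nat.gr0I)
    have "e mod m = e' mod m" using arg_cong[OF eq, of "\<lambda>x. x mod m"] by simp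
    moreover have "u (e div m) g = u (e' div m) g'" using arg_cong[OF eq, of "\<lambda>x. x div m"] m by simp
    then have "e div m = e' div m \<and> g = g'"
      using l by (intro inj) (auto simp: less_mult_imp_div_less)
    ultimately show "e = e' \<and> g = g'" by (metis div_mult_mod_eq)
  qed
  show "(\<lambda>(e, g). ?u e g) ` ({..<d' * m} \<times> {..<G}) = {..<dE * m}"
  proof
    have "?u e g < dE * m" if l: "e < d' * m" "g < G" for e g
    proof -
      have "0 < m" using l by (auto intro: Nat.gr0I)
      then show ?thesis
        using l splits_less[OF u, of "e div m" g] by (intro nat_pair_less) (auto simp: less_mult_imp_div_less)
    qed
    then show "(\<lambda>(e, g). ?u e g) ` ({..<d' * m} \<times> {..<G}) \<subseteq> {..<dE * m}" by auto
    show "{..<dE * m} \<subseteq> (\<lambda>(e, g). ?u e g) ` ({..<d' * m} \<times> {..<G})"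
    proof
      fix f assume "f \<in> {..<dE * m}"
      then have f: "f < dE * m" by simp
      have m: "0 < m" using f by (auto intro: Nat.gr0I)
      have "f div m \<in> (\<lambda>(e, g). u e g) ` ({..<d'} \<times> {..<G})"
        using u f unfolding splits_def bij_betw_def by (simp add: less_mult_imp_div_less)
      then obtain e g where eg: "e < d'" "g < G" "f div m = u e g" by auto
      have "f = ?u (e * m + f mod m) g"
        using m eg(3)[symmetric] by simp
      moreover have "e * m + f mod m < d' * m" using eg m by (intro nat_pair_less) auto
      ultimately show "f \<in> (\<lambda>(e, g). ?u e g) ` ({..<d' * m} \<times> {..<G})"
        using eg(2) by (intro image_eqI[of _ _ "(e * m + f mod m, g)"]) auto
    qed
  qed
qed

text \<open>A block of the traced operator is a sum of blocks of \<open>X\<close>, so linearity of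
  the local map is all that the exchange requires.\<close>

lemma eve_trace_bob_local:
  assumes lin: "linear_op dB d2 \<Lambda>" and u: "splits dE d' G u"
  shows "bob_local (dA, dB, d') d2 \<Lambda> (eve_trace (dA, dB, dE) G u d' X)
    = eve_trace (dA, d2, dE) G u d' (bob_local (dA, dB, dE) d2 \<Lambda> X)" (is "?l = ?r")
proof (rule tri_mat_eqI[where D = "(dA, d2, d')"])
  let ?Y = "eve_trace (dA, dB, dE) G u d' X"
  fix s t assume st: "s \<in> idx (dA, d2, d')" "t \<in> idx (dA, d2, d')"
  obtain a1 b1 e1 a2 b2 e2 where eq: "s = (a1, b1, e1)" "t = (a2, b2, e2)" by (metis prod_cases3)
  have l: "a1 < dA" "a2 < dA" "b1 < d2" "b2 < d2" "e1 < d'" "e2 < d'" using st eq by auto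
  let ?x = "\<lambda>g. bob_block (dA, dB, dE) X a1 (u e1 g) a2 (u e2 g)"
  have "bob_block (dA, dB, d') ?Y a1 e1 a2 e2 = mat_sum dB ?x {..<G}"
    using l by (intro eq_matI) (auto simp: tri_entry_eve_trace simp del: eve_trace.simps)
  then have "\<Lambda> (bob_block (dA, dB, d') ?Y a1 e1 a2 e2) = mat_sum d2 (\<lambda>g. \<Lambda> (?x g)) {..<G}"
    using linear_op_mat_sum[OF lin, of "{..<G}" ?x] by simp
  then have "tri_entry (dA, d2, d') (bob_local (dA, dB, d') d2 \<Lambda> ?Y) s t
      = (\<Sum>g<G. \<Lambda> (?x g) $$ (b1, b2))"
    using l unfolding eq tri_entry_bob_local[OF st[unfolded eq]] by simp
  also have "\<dots> = tri_entry (dA, d2, d') ?r s t"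
    unfolding tri_entry_eve_trace[OF st] unfolding eq fst_conv snd_conv
  proof (intro sum.cong refl)
    fix g assume "g \<in> {..<G}"
    then have i: "(a1, b1, u e1 g) \<in> idx (dA, d2, dE)" "(a2, b2, u e2 g) \<in> idx (dA, d2, dE)"
      using l splits_less[OF u] by auto
    show "\<Lambda> (mat dB dB (\<lambda>(x, y). tri_entry (dA, dB, dE) X (a1, x, u e1 g) (a2, y, u e2 g))) $$ (b1, b2) = tri_entry (dA, d2, dE) (bob_local (dA, dB, dE) d2 \<Lambda> X) (a1, b1, u e1 g) (a2, b2, u e2 g)"
      unfolding tri_entry_bob_local[OF i] by simp
  qed
  finally show "tri_entry (dA, d2, d') (bob_local (dA, dB, d') d2 \<Lambda> ?Y) s t
    = tri_entry (dA, d2, d') ?r s t" .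
qed (unfold bob_local.simps eve_trace.simps, rule tri_mat_carrier, rule tri_mat_carrier)

text \<open>The message digit of the split index does not depend on the traced index
  \<open>g\<close>, so the sum over messages and the sum over \<open>g\<close> can be
  exchanged.\<close>

lemma eve_trace_bob_sends:
  fixes m :: nat
  assumes u: "splits dE d' G u"
  defines "u' \<equiv> \<lambda>e g. u (e div m) g * m + e mod m"
  shows "bob_sends m (dA, dB * m, d') (eve_trace (dA, dB * m, dE) G u d' X)
    = eve_trace (dA * m, dB * m, dE * m) G u' (d' * m) (bob_sends m (dA, dB * m, dE) X)" (is "?l = ?r")
proof (rule tri_mat_eqI[where D = "(dA * m, dB * m, d' * m)"])
  let ?D = "(dA * m, dB * m, d' * m)"
  fix s t assume st: "s \<in> idx ?D" "t \<in> idx ?D"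
  obtain a1 b1 e1 a2 b2 e2 where eq: "s = (a1, b1, e1)" "t = (a2, b2, e2)" by (metis prod_cases3)
  have l: "a1 < dA * m" "a2 < dA * m" "b1 < dB * m" "b2 < dB * m" "e1 < d' * m" "e2 < d' * m"
    using st eq by auto
  have m: "0 < m" using l by (auto intro: Nat.gr0I)
  have u': "u' e g mod m = e mod m" "u' e g div m = u (e div m) g" for e g
    using m by (auto simp: u'_def)
  let ?x = "\<lambda>g. tri_entry (dA, dB * m, dE) X (a1 div m, b1, u (e1 div m) g) (a2 div m, b2, u (e2 div m) g)"
  let ?q = "\<lambda>i. same_mod m s i \<and> same_mod m t i"
  have "tri_entry ?D ?l s t
    = (\<Sum>i<m. if ?q i then (\<Sum>g<G. ?x g) else 0)"
    unfolding tri_entry_bob_sends[OF st] unfolding eq fst_conv snd_conv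
    using l by (intro sum.cong refl if_cong, subst tri_entry_eve_trace)
      (auto simp: less_mult_imp_div_less)
  also have "\<dots> = (\<Sum>g<G. \<Sum>i<m. if ?q i then ?x g else 0)"
    by (subst sum.swap, intro sum.cong refl) (auto intro!: sum.neutral)
  also have "\<dots> = (\<Sum>g<G. tri_entry (dA * m, dB * m, dE * m) (bob_sends m (dA, dB * m, dE) X)
      (a1, b1, u' e1 g) (a2, b2, u' e2 g))"
  proof (intro sum.cong refl)
    fix g assume "g \<in> {..<G}"
    then have "u' e1 g < dE * m" "u' e2 g < dE * m"
      using splits_less[OF splits_register[OF u], of _ m g] l unfolding u'_def by auto
    then have i: "(a1, b1, u' e1 g) \<in> idx (dA * m, dB * m, dE * m)" "(a2, b2, u' e2 g) \<in> idx (dA * m, dB * m, dE * m)"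
      using l by auto
    show "(\<Sum>i<m. if ?q i then ?x g else 0)
      = tri_entry (dA * m, dB * m, dE * m) (bob_sends m (dA, dB * m, dE) X) (a1, b1, u' e1 g) (a2, b2, u' e2 g)"
      unfolding tri_entry_bob_sends[OF i] fst_conv snd_conv u' by (simp add: same_mod_def eq u')
  qed
  also have "\<dots> = tri_entry ?D ?r s t"
    unfolding tri_entry_eve_trace[OF st] unfolding eq fst_conv snd_conv ..
  finally show "tri_entry ?D ?l s t
    = tri_entry ?D ?r s t" .
qed (unfold bob_sends.simps eve_trace.simps, rule tri_mat_carrier, rule tri_mat_carrier)

lemma eve_trace_swap_parties:
  assumes u: "splits dE d' G u"
  shows "swap_parties (dA, dB, d') (eve_trace (dA, dB, dE) G u d' X)
    = eve_trace (dB, dA, dE) G u d' (swap_parties (dA, dB, dE) X)" (is "?l = ?r")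
proof (rule tri_mat_eqI[where D = "(dB, dA, d')", OF swap_parties_carrier eve_trace_carrier])
  fix s t assume st: "s \<in> idx (dB, dA, d')" "t \<in> idx (dB, dA, d')"
  then have st': "swap_idx s \<in> idx (dA, dB, d')" "swap_idx t \<in> idx (dA, dB, d')" by auto
  show "tri_entry (dB, dA, d') ?l s t
    = tri_entry (dB, dA, d') ?r s t"
    unfolding tri_entry_swap_parties[OF st] tri_entry_eve_trace[OF st'] tri_entry_eve_trace[OF st]
    using st splits_less[OF u]
    by (intro sum.cong refl, subst tri_entry_swap_parties) auto
qed

text \<open>Eve performs no operation and only receives messages, so no step touches the factor that
  is traced out. Local steps keep the splitting; messages replace it by that of
  \<open>splits_register\<close>.\<close>

lemma lopc_step_eve_trace:
  assumes "lopc_step (dA, dB, dE) (dA', dB', dE') \<Gamma>" and u: "splits dE d G u"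
  shows "\<exists>d' u' \<Gamma>'. lopc_step (dA, dB, d) (dA', dB', d') \<Gamma>' \<and> splits dE' d' G u' \<and>
    (\<forall>X. \<Gamma>' (eve_trace (dA, dB, dE) G u d X) = eve_trace (dA', dB', dE') G u' d' (\<Gamma> X))"
  using assms(1)
proof (cases rule: lopc_step.cases)
  case (alice_local \<Lambda>)
  have "lopc_step (dA, dB, d) (dA', dB', d) (alice_local (dA, dB, d) dA' \<Lambda>)"
    using lopc_step.alice_local[OF alice_local(4), of dB d] unfolding alice_local(1,2) .
  moreover have "splits dE' d G u" using u unfolding alice_local(1,2) .
  moreover have "\<forall>X. alice_local (dA, dB, d) dA' \<Lambda> (eve_trace (dA, dB, dE) G u d X)
      = eve_trace (dA', dB', dE') G u d (\<Gamma> X)"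
    unfolding alice_local(1-3) alice_local_swap_parties eve_trace_swap_parties[OF u]
      eve_trace_bob_local[OF cptp_linear_op[OF alice_local(4)] u] by blast
  ultimately show ?thesis by blast
next
  case (bob_local \<Lambda>)
  have "lopc_step (dA, dB, d) (dA', dB', d) (bob_local (dA, dB, d) dB' \<Lambda>)"
    using lopc_step.bob_local[OF bob_local(4), of dA d] unfolding bob_local(1,2) .
  moreover have "splits dE' d G u" using u unfolding bob_local(1,2) .
  moreover have "\<forall>X. bob_local (dA, dB, d) dB' \<Lambda> (eve_trace (dA, dB, dE) G u d X)
      = eve_trace (dA', dB', dE') G u d (\<Gamma> X)"
    unfolding bob_local(1-3) using eve_trace_bob_local[OF cptp_linear_op[OF bob_local(4)] u] by blast
  ultimately show ?thesis by blast
next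
  case (alice_sends dA2 m)
  have "alice_sends m (dA2 * m, dB, d) (eve_trace (dA2 * m, dB, dE) G u d X)
    = eve_trace (dA2 * m, dB * m, dE * m) G (\<lambda>e g. u (e div m) g * m + e mod m) (d * m)
        (alice_sends m (dA2 * m, dB, dE) X)" for X
    unfolding alice_sends_swap_parties eve_trace_swap_parties[OF u] eve_trace_bob_sends[OF u]
      eve_trace_swap_parties[OF splits_register[OF u]] ..
  then show ?thesis
    using lopc_step.alice_sends splits_register[OF u] unfolding alice_sends by blast
next
  case (bob_sends dB2 m)
  then show ?thesis
    using eve_trace_bob_sends[OF u] lopc_step.bob_sends splits_register[OF u]
    by blast
qed

section \<open>Tensor powers\<close>

text \<open>The dimension triples are single variables here, as the induction over
  \<open>lopc\<close> requires; the version with explicit components follows.\<close>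

lemma lopc_eve_trace_aux:
  assumes "lopc D D' \<Lambda>" "splits (snd (snd D)) d G u"
  shows "\<exists>d' u' \<Lambda>'. lopc (fst D, fst (snd D), d) (fst D', fst (snd D'), d') \<Lambda>' \<and>
    splits (snd (snd D')) d' G u' \<and>
    (\<forall>X. \<Lambda>' (eve_trace D G u d X) = eve_trace D' G u' d' (\<Lambda> X))"
  using assms
proof (induction rule: lopc.induct)
  case (lopc_none D)
  then show ?case using lopc.lopc_none by blast
next
  case (lopc_append D D' \<Lambda> D'' \<Gamma>)
  obtain d' u' \<Lambda>' where 1: "lopc (fst D, fst (snd D), d) (fst D', fst (snd D'), d') \<Lambda>'"
    "splits (snd (snd D')) d' G u'" "\<forall>X. \<Lambda>' (eve_trace D G u d X) = eve_trace D' G u' d' (\<Lambda> X)"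
    using lopc_append by blast
  obtain dA dB dE dA' dB' dE' where D: "D' = (dA, dB, dE)" "D'' = (dA', dB', dE')"
    by (metis prod_cases3)
  obtain d'' u'' \<Gamma>' where 2: "lopc_step (dA, dB, d') (dA', dB', d'') \<Gamma>'" "splits dE' d'' G u''"
    "\<forall>X. \<Gamma>' (eve_trace D' G u' d' X) = eve_trace D'' G u'' d'' (\<Gamma> X)"
    using lopc_step_eve_trace[of dA dB dE dA' dB' dE' \<Gamma> d' G u'] lopc_append.hyps(2) 1(2)
    unfolding D by auto
  have "lopc (fst D, fst (snd D), d) (fst D'', fst (snd D''), d'') (\<lambda>X. \<Gamma>' (\<Lambda>' X))"
    using lopc.lopc_append[OF 1(1)] 2(1) unfolding D by simp
  moreover have "splits (snd (snd D'')) d'' G u''" using 2(2) unfolding D by simp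
  moreover have "\<forall>X. \<Gamma>' (\<Lambda>' (eve_trace D G u d X)) = eve_trace D'' G u'' d'' (\<Gamma> (\<Lambda> X))"
    using 1(3) 2(3) by simp
  ultimately show ?case by blast
qed

lemma lopc_eve_trace:
  assumes "lopc (dA, dB, dE) (dA', dB', dE') \<Lambda>" "splits dE d G u"
  shows "\<exists>d' u' \<Lambda>'. lopc (dA, dB, d) (dA', dB', d') \<Lambda>' \<and> splits dE' d' G u' \<and>
    (\<forall>X. \<Lambda>' (eve_trace (dA, dB, dE) G u d X) = eve_trace (dA', dB', dE') G u' d' (\<Lambda> X))"
  using lopc_eve_trace_aux[OF assms(1), of d G u] assms(2) by simp

text \<open>A basis index of \<open>n\<close> copies of \<open>H \<otimes> H'\<close> is a number with \<open>n\<close> digits in base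
  \<open>d * d'\<close>.  Each digit \<open>x * d' + x'\<close> is split into \<open>x\<close> and \<open>x'\<close>.\<close>

primrec left_digits :: "nat \<Rightarrow> nat \<Rightarrow> nat \<Rightarrow> nat \<Rightarrow> nat" where
  "left_digits d d' 0 z = 0"
| "left_digits d d' (Suc n) z = left_digits d d' n (z div (d * d')) * d + (z mod (d * d')) div d'"

primrec right_digits :: "nat \<Rightarrow> nat \<Rightarrow> nat \<Rightarrow> nat \<Rightarrow> nat" where
  "right_digits d d' 0 z = 0"
| "right_digits d d' (Suc n) z = right_digits d d' n (z div (d * d')) * d' + (z mod (d * d')) mod d'"

primrec join_digits :: "nat \<Rightarrow> nat \<Rightarrow> nat \<Rightarrow> nat \<Rightarrow> nat \<Rightarrow> nat" where
  "join_digits d d' 0 x y = 0"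
| "join_digits d d' (Suc n) x y =
    join_digits d d' n (x div d) (y div d') * (d * d') + ((x mod d) * d' + y mod d')"

section \<open>Digit arithmetic\<close>

lemma mult_add_div_eq: "r < d \<Longrightarrow> (q * d + r) div d = (q :: nat)"
  by auto

lemma mult_add_mod_eq: "r < d \<Longrightarrow> (q * d + r) mod d = (r :: nat)"
  by auto

lemma div_less_power: "z < (d :: nat) ^ Suc n \<Longrightarrow> z div d < d ^ n"
  by (simp add: less_mult_imp_div_less mult.commute)

lemma less_power_Suc_pos: "z < (d :: nat) ^ Suc n \<Longrightarrow> 0 < d"
  by (auto intro: Nat.gr0I)

lemma split_digits:
  assumes "z < (d * d') ^ n"
  shows "left_digits d d' n z < d ^ n" "right_digits d d' n z < d' ^ n"
    "join_digits d d' n (left_digits d d' n z) (right_digits d d' n z) = z"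
proof -
  have "left_digits d d' n z < d ^ n \<and> right_digits d d' n z < d' ^ n \<and>
    join_digits d d' n (left_digits d d' n z) (right_digits d d' n z) = z"
    using assms
  proof (induction n arbitrary: z)
    case 0
    then show ?case by simp
  next
    case (Suc n)
    have pos: "0 < d * d'" using Suc.prems by (rule less_power_Suc_pos)
    then have p: "0 < d" "0 < d'" by auto
    let ?q = "z div (d * d')" and ?r = "z mod (d * d')"
    have r: "?r div d' < d" "?r mod d' < d'" using pos p by (auto simp: less_mult_imp_div_less)
    have IH: "left_digits d d' n ?q < d ^ n" "right_digits d d' n ?q < d' ^ n"
      "join_digits d d' n (left_digits d d' n ?q) (right_digits d d' n ?q) = ?q"
      using Suc.IH[OF div_less_power[OF Suc.prems]] by auto
    have "left_digits d d' (Suc n) z < d ^ n * d" "right_digits d d' (Suc n) z < d' ^ n * d'"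
      using IH r by (auto intro: nat_pair_less)
    moreover have "join_digits d d' (Suc n) (left_digits d d' (Suc n) z) (right_digits d d' (Suc n) z) = z"
      using IH(3) r p by (simp add: div_mult_mod_eq)
    ultimately show ?case by (simp add: mult.commute)
  qed
  then show "left_digits d d' n z < d ^ n" "right_digits d d' n z < d' ^ n"
    "join_digits d d' n (left_digits d d' n z) (right_digits d d' n z) = z" by auto
qed

lemma join_digits:
  assumes "x < d ^ n" "y < d' ^ n"
  shows "join_digits d d' n x y < (d * d') ^ n" "left_digits d d' n (join_digits d d' n x y) = x"
    "right_digits d d' n (join_digits d d' n x y) = y"
proof -
  have "join_digits d d' n x y < (d * d') ^ n \<and> left_digits d d' n (join_digits d d' n x y) = x \<and>
    right_digits d d' n (join_digits d d' n x y) = y"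
    using assms
  proof (induction n arbitrary: x y)
    case 0
    then show ?case by simp
  next
    case (Suc n)
    have p: "0 < d" "0 < d'" using less_power_Suc_pos Suc.prems by blast+
    let ?j = "join_digits d d' n (x div d) (y div d')" and ?r = "(x mod d) * d' + y mod d'"
    have IH: "?j < (d * d') ^ n" "left_digits d d' n ?j = x div d" "right_digits d d' n ?j = y div d'"
      using Suc.IH[OF div_less_power div_less_power, OF Suc.prems] by auto
    have r: "?r < d * d'" using p by (intro nat_pair_less) auto
    have z: "join_digits d d' (Suc n) x y = ?j * (d * d') + ?r" by simp
    have "?j * (d * d') + ?r < (d * d') ^ n * (d * d')" by (rule nat_pair_less[OF IH(1) r])
    moreover have "(?j * (d * d') + ?r) div (d * d') = ?j" "(?j * (d * d') + ?r) mod (d * d') = ?r"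
      by (rule mult_add_div_eq[OF r], rule mult_add_mod_eq[OF r])
    moreover have "?r div d' = x mod d" "?r mod d' = y mod d'" using p by auto
    ultimately show ?case
      unfolding left_digits.simps right_digits.simps z
      by (simp add: IH(2,3) div_mult_mod_eq mult.commute)
  qed
  then show "join_digits d d' n x y < (d * d') ^ n" "left_digits d d' n (join_digits d d' n x y) = x"
    "right_digits d d' n (join_digits d d' n x y) = y" by auto
qed

text \<open>This is the initial splitting for the partial trace: in the \<open>n\<close>-th power of
  a product system it separates all copies of the second factor from those of the first.\<close>

lemma splits_join_digits:
  "splits ((d * d') ^ n) (d ^ n) (d' ^ n) (join_digits d d' n)"
  unfolding splits_def
  by (rule bij_betw_byWitness[where f' = "\<lambda>z. (left_digits d d' n z, right_digits d d' n z)"])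
    (auto simp: split_digits join_digits)

lemma dims_power_eq: "dims_power (dA, dB, dE) n = (dA ^ n, dB ^ n, dE ^ n)"
  by (induction n) (auto simp: mult.commute)

section \<open>Entries of tensor products and powers\<close>

definition tri_map :: "(nat \<Rightarrow> nat) \<Rightarrow> (nat \<Rightarrow> nat) \<Rightarrow> (nat \<Rightarrow> nat) \<Rightarrow> nat \<times> nat \<times> nat \<Rightarrow> nat \<times> nat \<times> nat" where
  "tri_map f g h s = (f (fst s), g (fst (snd s)), h (snd (snd s)))"

lemma tri_entry_tensor:
  assumes "s \<in> idx (dA * kA, dB * kB, dE * kE)" "t \<in> idx (dA * kA, dB * kB, dE * kE)"
  shows "tri_entry (dA * kA, dB * kB, dE * kE) (tri_tensor (dA, dB, dE) (kA, kB, kE) X Y) s t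
    = tri_entry (dA, dB, dE) X (tri_map (\<lambda>a. a div kA) (\<lambda>b. b div kB) (\<lambda>e. e div kE) s)
        (tri_map (\<lambda>a. a div kA) (\<lambda>b. b div kB) (\<lambda>e. e div kE) t) *
      tri_entry (kA, kB, kE) Y (tri_map (\<lambda>a. a mod kA) (\<lambda>b. b mod kB) (\<lambda>e. e mod kE) s)
        (tri_map (\<lambda>a. a mod kA) (\<lambda>b. b mod kB) (\<lambda>e. e mod kE) t)"
  unfolding tri_tensor.simps tri_entry_tri_mat[OF assms] by (simp add: tri_map_def case_prod_beta)

lemma tri_entry_power_Suc:
  assumes "s \<in> idx (dA ^ Suc n, dB ^ Suc n, dE ^ Suc n)" "t \<in> idx (dA ^ Suc n, dB ^ Suc n, dE ^ Suc n)"
  shows "tri_entry (dA ^ Suc n, dB ^ Suc n, dE ^ Suc n) (tri_power (dA, dB, dE) X (Suc n)) s t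
    = tri_entry (dA ^ n, dB ^ n, dE ^ n) (tri_power (dA, dB, dE) X n)
        (tri_map (\<lambda>a. a div dA) (\<lambda>b. b div dB) (\<lambda>e. e div dE) s)
        (tri_map (\<lambda>a. a div dA) (\<lambda>b. b div dB) (\<lambda>e. e div dE) t) *
      tri_entry (dA, dB, dE) X (tri_map (\<lambda>a. a mod dA) (\<lambda>b. b mod dB) (\<lambda>e. e mod dE) s)
        (tri_map (\<lambda>a. a mod dA) (\<lambda>b. b mod dB) (\<lambda>e. e mod dE) t)"
  using tri_entry_tensor[of s "dA ^ n" dA "dB ^ n" dB "dE ^ n" dE t] assms
  unfolding tri_power.simps dims_power_eq by (simp add: mult.commute)

lemma tri_tensor_carrier:
  "tri_tensor (dA, dB, dE) (kA, kB, kE) X Y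
    \<in> tri_carrier (dA * kA, dB * kB, dE * kE)"
  unfolding tri_tensor.simps by (rule tri_mat_carrier)

text \<open>The Schur product with the rank-one kernel of \<open>w\<close>.\<close>

lemma psd_kernel_weight:
  assumes "psd_kernel I k"
  shows "psd_kernel I (\<lambda>s t. cnj (w s) * k s t * w t)"
  unfolding psd_kernel_def
proof
  fix v
  have "(\<Sum>s\<in>I. \<Sum>t\<in>I. cnj (v s) * (cnj (w s) * k s t * w t) * v t)
      = (\<Sum>s\<in>I. \<Sum>t\<in>I. cnj (w s * v s) * k s t * (w t * v t))"
    by (simp add: mult_ac)
  also have "\<dots> \<ge> 0"
    using assms[unfolded psd_kernel_def, rule_format, of "\<lambda>s. w s * v s"] .
  finally show "0 \<le> (\<Sum>s\<in>I. \<Sum>t\<in>I. cnj (v s) * (cnj (w s) * k s t * w t) * v t)" .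
qed

lemma div_mod_idx:
  assumes "s \<in> idx (dA * kA, dB * kB, dE * kE)"
  shows "tri_map (\<lambda>a. a div kA) (\<lambda>b. b div kB) (\<lambda>e. e div kE) s \<in> idx (dA, dB, dE)"
    "tri_map (\<lambda>a. a mod kA) (\<lambda>b. b mod kB) (\<lambda>e. e mod kE) s \<in> idx (kA, kB, kE)"
proof -
  obtain a b e where s: "s = (a, b, e)" "a < dA * kA" "b < dB * kB" "e < dE * kE" using assms by auto
  then have "0 < kA" "0 < kB" "0 < kE" by (auto intro: Nat.gr0I)
  then show "tri_map (\<lambda>a. a div kA) (\<lambda>b. b div kB) (\<lambda>e. e div kE) s \<in> idx (dA, dB, dE)"
    "tri_map (\<lambda>a. a mod kA) (\<lambda>b. b mod kB) (\<lambda>e. e mod kE) s \<in> idx (kA, kB, kE)"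
    using s by (auto simp: tri_map_def less_mult_imp_div_less)
qed

text \<open>Schur product argument: the factorisation \<open>Y = mat_adjoint C * C\<close> writes
  the entries of \<open>Y\<close> as a sum of rank-one kernels, one for each row of
  \<open>C\<close>, and entrywise multiplication by each of them preserves positivity.\<close>

lemma density_op_tensor:
  assumes X: "density_op (total_dim (dA, dB, dE)) X" and Y: "density_op (total_dim (kA, kB, kE)) Y"
  shows "density_op (total_dim (dA * kA, dB * kB, dE * kE)) (tri_tensor (dA, dB, dE) (kA, kB, kE) X Y)"
proof -
  let ?D = "(dA * kA, dB * kB, dE * kE)"
  let ?Z = "tri_tensor (dA, dB, dE) (kA, kB, kE) X Y"
  let ?p = "tri_map (\<lambda>a. a div kA) (\<lambda>b. b div kB) (\<lambda>e. e div kE)"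
  let ?q = "tri_map (\<lambda>a. a mod kA) (\<lambda>b. b mod kB) (\<lambda>e. e mod kE)"
  let ?N = "total_dim (kA, kB, kE)"
  have pX: "positive_op (total_dim (dA, dB, dE)) X" and trX: "mat_trace X = 1"
    and pY: "positive_op ?N Y" and trY: "mat_trace Y = 1"
    using X Y by (auto simp: density_op_def)
  obtain C where C: "C \<in> carrier_mat ?N ?N" "Y = mat_adjoint C * C" using positive_op_gramE[OF pY] .
  have YC: "tri_entry (kA, kB, kE) Y s t
    = (\<Sum>r<?N. cnj (C $$ (r, index_of (kA, kB, kE) s)) * C $$ (r, index_of (kA, kB, kE) t))"
    if "s \<in> idx (kA, kB, kE)" "t \<in> idx (kA, kB, kE)" for s t
    unfolding tri_entry_def C(2)
    using C(1) index_of_less[OF that(1)] index_of_less[OF that(2)]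
    by (subst index_mult_mat_sum[of _ ?N ?N _ ?N]) (auto simp del: total_dim.simps index_of.simps)
  have kX: "psd_kernel (idx (dA, dB, dE)) (tri_entry (dA, dB, dE) X)" using pX positive_op_tri by blast
  have "psd_kernel (idx ?D) (\<lambda>s t. tri_entry (dA, dB, dE) X (?p s) (?p t))"
    by (rule psd_kernel_pullback[OF kX, where \<pi> = ?p]) (auto simp: div_mod_idx simp del: idx.simps)
  then have "psd_kernel (idx ?D) (\<lambda>s t. \<Sum>r<?N. cnj (C $$ (r, index_of (kA, kB, kE) (?q s))) *
      tri_entry (dA, dB, dE) X (?p s) (?p t) * C $$ (r, index_of (kA, kB, kE) (?q t)))"
    by (intro psd_kernel_sum psd_kernel_weight[where w = "\<lambda>s. C $$ (r, index_of (kA, kB, kE) (?q s))" for r])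
  also have "?this \<longleftrightarrow> psd_kernel (idx ?D) (tri_entry ?D ?Z)"
  proof (rule psd_kernel_cong)
    fix s t assume st: "s \<in> idx ?D" "t \<in> idx ?D"
    show "(\<Sum>r<?N. cnj (C $$ (r, index_of (kA, kB, kE) (?q s))) *
      tri_entry (dA, dB, dE) X (?p s) (?p t) * C $$ (r, index_of (kA, kB, kE) (?q t))) = tri_entry ?D ?Z s t"
      unfolding tri_entry_tensor[OF st] YC[OF div_mod_idx(2)[OF st(1)] div_mod_idx(2)[OF st(2)]]
      by (simp add: sum_distrib_left mult_ac)
  qed
  finally have pos: "positive_op (total_dim ?D) ?Z" using positive_op_tri tri_tensor_carrier by blast
  have bij: "bij_betw (\<lambda>s. (?p s, ?q s)) (idx ?D) (idx (dA, dB, dE) \<times> idx (kA, kB, kE))"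
  proof (rule bij_betw_byWitness[where f' = "\<lambda>(s, t). (fst s * kA + fst t, fst (snd s) * kB + fst (snd t),
      snd (snd s) * kE + snd (snd t))"])
    show "(\<lambda>s. (?p s, ?q s)) ` idx ?D \<subseteq> idx (dA, dB, dE) \<times> idx (kA, kB, kE)"
      using div_mod_idx by blast
  qed (auto simp: tri_map_def nat_pair_less)
  have "mat_trace ?Z = (\<Sum>s\<in>idx ?D. tri_entry (dA, dB, dE) X (?p s) (?p s) * tri_entry (kA, kB, kE) Y (?q s) (?q s))"
    unfolding mat_trace_tri[OF tri_tensor_carrier] by (intro sum.cong refl tri_entry_tensor)
  also have "\<dots> = (\<Sum>p\<in>idx (dA, dB, dE) \<times> idx (kA, kB, kE).
      tri_entry (dA, dB, dE) X (fst p) (fst p) * tri_entry (kA, kB, kE) Y (snd p) (snd p))"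
    using sum.reindex_bij_betw[OF bij, of "\<lambda>p. tri_entry (dA, dB, dE) X (fst p) (fst p) * tri_entry (kA, kB, kE) Y (snd p) (snd p)"]
    by simp
  also have "\<dots> = mat_trace X * mat_trace Y"
    unfolding mat_trace_tri[OF pX[THEN positive_op_carrier]] mat_trace_tri[OF pY[THEN positive_op_carrier]]
      sum_product sum.cartesian_product by (simp add: case_prod_beta)
  finally have "mat_trace ?Z = 1" using trX trY by simp
  then show ?thesis using pos by (simp add: density_op_def)
qed

lemma density_op_power:
  assumes "density_op (total_dim (dA, dB, dE)) X"
  shows "density_op (total_dim (dA ^ n, dB ^ n, dE ^ n)) (tri_power (dA, dB, dE) X n)"
proof (induction n)
  case 0
  then show ?case using positive_op_one[of 1] by (simp add: density_op_def)
next
  case (Suc n)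
  have "density_op (total_dim (dA ^ n * dA, dB ^ n * dB, dE ^ n * dE)) (tri_power (dA, dB, dE) X (Suc n))"
    using density_op_tensor[OF Suc assms] unfolding tri_power.simps dims_power_eq .
  then show ?case by (simp only: power_Suc2)
qed

text \<open>\<open>tri_power\<close> of a tensor product interleaves the digits of both factors; the
  induction peels off the last digit of every party and splits it.\<close>

lemma tri_entry_tensor_power:
  assumes "s \<in> idx ((dA * kA) ^ n, (dB * kB) ^ n, (dE * kE) ^ n)"
    "t \<in> idx ((dA * kA) ^ n, (dB * kB) ^ n, (dE * kE) ^ n)"
  shows "tri_entry ((dA * kA) ^ n, (dB * kB) ^ n, (dE * kE) ^ n)
      (tri_power (dA * kA, dB * kB, dE * kE) (tri_tensor (dA, dB, dE) (kA, kB, kE) X Y) n) s t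
    = tri_entry (dA ^ n, dB ^ n, dE ^ n) (tri_power (dA, dB, dE) X n)
        (tri_map (left_digits dA kA n) (left_digits dB kB n) (left_digits dE kE n) s)
        (tri_map (left_digits dA kA n) (left_digits dB kB n) (left_digits dE kE n) t) *
      tri_entry (kA ^ n, kB ^ n, kE ^ n) (tri_power (kA, kB, kE) Y n)
        (tri_map (right_digits dA kA n) (right_digits dB kB n) (right_digits dE kE n) s)
        (tri_map (right_digits dA kA n) (right_digits dB kB n) (right_digits dE kE n) t)"
  using assms
proof (induction n arbitrary: s t)
  case 0
  then show ?case by (auto simp: tri_entry_def tri_map_def)
next
  case (Suc n)
  let ?div = "tri_map (\<lambda>a. a div (dA * kA)) (\<lambda>b. b div (dB * kB)) (\<lambda>e. e div (dE * kE))"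
  let ?mod = "tri_map (\<lambda>a. a mod (dA * kA)) (\<lambda>b. b mod (dB * kB)) (\<lambda>e. e mod (dE * kE))"
  let ?l = "\<lambda>n. tri_map (left_digits dA kA n) (left_digits dB kB n) (left_digits dE kE n)"
  let ?r = "\<lambda>n. tri_map (right_digits dA kA n) (right_digits dB kB n) (right_digits dE kE n)"
  have i: "?div s \<in> idx ((dA * kA) ^ n, (dB * kB) ^ n, (dE * kE) ^ n)" "?mod s \<in> idx (dA * kA, dB * kB, dE * kE)"
    "?l (Suc n) s \<in> idx (dA ^ Suc n, dB ^ Suc n, dE ^ Suc n)" "?r (Suc n) s \<in> idx (kA ^ Suc n, kB ^ Suc n, kE ^ Suc n)"
    "tri_map (\<lambda>a. a div dA) (\<lambda>b. b div dB) (\<lambda>e. e div dE) (?l (Suc n) s) = ?l n (?div s)"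
    "tri_map (\<lambda>a. a div kA) (\<lambda>b. b div kB) (\<lambda>e. e div kE) (?r (Suc n) s) = ?r n (?div s)"
    "tri_map (\<lambda>a. a mod dA) (\<lambda>b. b mod dB) (\<lambda>e. e mod dE) (?l (Suc n) s)
      = tri_map (\<lambda>a. a div kA) (\<lambda>b. b div kB) (\<lambda>e. e div kE) (?mod s)"
    "tri_map (\<lambda>a. a mod kA) (\<lambda>b. b mod kB) (\<lambda>e. e mod kE) (?r (Suc n) s)
      = tri_map (\<lambda>a. a mod kA) (\<lambda>b. b mod kB) (\<lambda>e. e mod kE) (?mod s)"
    if s: "s \<in> idx ((dA * kA) ^ Suc n, (dB * kB) ^ Suc n, (dE * kE) ^ Suc n)" for s
  proof -
    obtain a b e where eq: "s = (a, b, e)" and l: "a < (dA * kA) ^ Suc n" "b < (dB * kB) ^ Suc n" "e < (dE * kE) ^ Suc n"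
      using s by (cases s) auto
    have p: "0 < dA" "0 < kA" "0 < dB" "0 < kB" "0 < dE" "0 < kE"
      using l[THEN less_power_Suc_pos] by auto
    have digit: "(z mod (d * k)) div k < d" "(z mod (d * k)) mod k < k" if "0 < d" "0 < k" for z d k :: nat
      using that by (auto simp: less_mult_imp_div_less)
    show "?div s \<in> idx ((dA * kA) ^ n, (dB * kB) ^ n, (dE * kE) ^ n)" "?mod s \<in> idx (dA * kA, dB * kB, dE * kE)"
      using l[THEN div_less_power] p by (auto simp: eq tri_map_def)
    show "?l (Suc n) s \<in> idx (dA ^ Suc n, dB ^ Suc n, dE ^ Suc n)" "?r (Suc n) s \<in> idx (kA ^ Suc n, kB ^ Suc n, kE ^ Suc n)"
      using l[THEN split_digits(1)] l[THEN split_digits(2)]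
      by (auto simp: eq tri_map_def simp del: left_digits.simps right_digits.simps power_Suc)
    show "tri_map (\<lambda>a. a div dA) (\<lambda>b. b div dB) (\<lambda>e. e div dE) (?l (Suc n) s) = ?l n (?div s)"
      "tri_map (\<lambda>a. a div kA) (\<lambda>b. b div kB) (\<lambda>e. e div kE) (?r (Suc n) s) = ?r n (?div s)"
      "tri_map (\<lambda>a. a mod dA) (\<lambda>b. b mod dB) (\<lambda>e. e mod dE) (?l (Suc n) s)
        = tri_map (\<lambda>a. a div kA) (\<lambda>b. b div kB) (\<lambda>e. e div kE) (?mod s)"
      "tri_map (\<lambda>a. a mod kA) (\<lambda>b. b mod kB) (\<lambda>e. e mod kE) (?r (Suc n) s)
        = tri_map (\<lambda>a. a mod kA) (\<lambda>b. b mod kB) (\<lambda>e. e mod kE) (?mod s)"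
      unfolding eq tri_map_def fst_conv snd_conv left_digits.simps right_digits.simps
      by (simp_all only: mult_add_div_eq mult_add_mod_eq digit p)
  qed
  show ?case
    unfolding tri_entry_power_Suc[OF Suc.prems] tri_entry_tensor[OF i(2,2), OF Suc.prems]
      Suc.IH[OF i(1,1), OF Suc.prems]
      tri_entry_power_Suc[OF i(3,3), OF Suc.prems] tri_entry_power_Suc[OF i(4,4), OF Suc.prems]
      i(5-8)[OF Suc.prems(1)] i(5-8)[OF Suc.prems(2)]
    by (simp only: mult_ac)
qed

lemma sum_div_mod:
  fixes F :: "nat \<Rightarrow> nat \<Rightarrow> 'a :: comm_monoid_add"
  shows "(\<Sum>z<p * q. F (z div q) (z mod q)) = (\<Sum>x<p. \<Sum>y<q. F x y)"
proof -
  have "(\<Sum>z<p * q. F (z div q) (z mod q)) = (\<Sum>(x, y)\<in>{..<p} \<times> {..<q}. F x y)"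
  proof (rule sum.reindex_bij_witness[where i = "\<lambda>(x, y). x * q + y" and j = "\<lambda>z. (z div q, z mod q)"])
    fix z assume "z \<in> {..<p * q}"
    moreover from this have "0 < q" by (auto intro: Nat.gr0I)
    ultimately show "(z div q, z mod q) \<in> {..<p} \<times> {..<q}" by (auto simp: less_mult_imp_div_less)
  qed (auto simp: nat_pair_less)
  then show ?thesis by (simp add: sum.cartesian_product)
qed

lemma density_op_trace_sum:
  assumes "density_op d \<tau>"
  shows "(\<Sum>g<d. \<tau> $$ (g, g)) = 1"
  using assms by (auto simp: density_op_def positive_op_def mat_trace_def)

lemma tri_entry_perfect_key:
  assumes "a1 < 2 ^ l" "b1 < 2 ^ l" "e1 < d" "a2 < 2 ^ l" "b2 < 2 ^ l" "e2 < d"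
  shows "tri_entry (2 ^ l, 2 ^ l, d) (perfect_key l d \<tau>) (a1, b1, e1) (a2, b2, e2)
    = (if a1 = b1 \<and> a2 = b2 \<and> a1 = a2 then \<tau> $$ (e1, e2) / 2 ^ l else 0)"
  unfolding perfect_key_def key_dims_def using assms by (subst tri_entry_tri_mat) auto

text \<open>In each copy Eve's factor contributes its trace, which is 1. What remains is a uniform,
  perfectly correlated string of \<open>l * n\<close> bits, that is, an equal mixture of fixed
  seeds.\<close>

lemma key_power_marginal:
  assumes \<tau>: "density_op d \<tau>"
    and "a1 < (2 ^ l) ^ n" "b1 < (2 ^ l) ^ n" "a2 < (2 ^ l) ^ n" "b2 < (2 ^ l) ^ n"
  shows "(\<Sum>g<d ^ n. tri_entry ((2 ^ l) ^ n, (2 ^ l) ^ n, d ^ n)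
      (tri_power (2 ^ l, 2 ^ l, d) (perfect_key l d \<tau>) n) (a1, b1, g) (a2, b2, g))
    = (if a1 = b1 \<and> a2 = b2 \<and> a1 = a2 then 1 / (2 ^ l) ^ n else 0)"
  using assms(2-)
proof (induction n arbitrary: a1 b1 a2 b2)
  case 0
  then show ?case by (simp add: tri_entry_def)
next
  case (Suc n)
  let ?d = "2 ^ l :: nat"
  let ?Q = "tri_entry (?d ^ n, ?d ^ n, d ^ n) (tri_power (?d, ?d, d) (perfect_key l d \<tau>) n)"
  let ?K = "tri_entry (?d, ?d, d) (perfect_key l d \<tau>)"
  have "(\<Sum>g<d ^ Suc n. tri_entry (?d ^ Suc n, ?d ^ Suc n, d ^ Suc n)
      (tri_power (?d, ?d, d) (perfect_key l d \<tau>) (Suc n)) (a1, b1, g) (a2, b2, g))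
    = (\<Sum>g<d ^ n * d. ?Q (a1 div ?d, b1 div ?d, g div d) (a2 div ?d, b2 div ?d, g div d) *
        ?K (a1 mod ?d, b1 mod ?d, g mod d) (a2 mod ?d, b2 mod ?d, g mod d))"
  proof (rule sum.cong)
    fix g assume "g \<in> {..<d ^ n * d}"
    then have g: "g < d ^ Suc n" by (simp add: mult.commute)
    show "tri_entry (?d ^ Suc n, ?d ^ Suc n, d ^ Suc n)
      (tri_power (?d, ?d, d) (perfect_key l d \<tau>) (Suc n)) (a1, b1, g) (a2, b2, g)
      = ?Q (a1 div ?d, b1 div ?d, g div d) (a2 div ?d, b2 div ?d, g div d) *
        ?K (a1 mod ?d, b1 mod ?d, g mod d) (a2 mod ?d, b2 mod ?d, g mod d)"
      using Suc.prems g by (subst tri_entry_power_Suc) (auto simp: tri_map_def simp del: power_Suc tri_power.simps)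
  qed (simp add: mult.commute)
  also have "\<dots> = (\<Sum>x<d ^ n. \<Sum>y<d. ?Q (a1 div ?d, b1 div ?d, x) (a2 div ?d, b2 div ?d, x) *
        ?K (a1 mod ?d, b1 mod ?d, y) (a2 mod ?d, b2 mod ?d, y))"
    by (rule sum_div_mod)
  also have "\<dots> = (\<Sum>x<d ^ n. ?Q (a1 div ?d, b1 div ?d, x) (a2 div ?d, b2 div ?d, x)) *
      (\<Sum>y<d. ?K (a1 mod ?d, b1 mod ?d, y) (a2 mod ?d, b2 mod ?d, y))"
    by (simp add: sum_product)
  also have "(\<Sum>x<d ^ n. ?Q (a1 div ?d, b1 div ?d, x) (a2 div ?d, b2 div ?d, x))
    = (if a1 div ?d = b1 div ?d \<and> a2 div ?d = b2 div ?d \<and> a1 div ?d = a2 div ?d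
       then 1 / (2 ^ l :: complex) ^ n else 0)"
    using Suc.IH[OF Suc.prems[THEN div_less_power]] by simp
  also have "(\<Sum>y<d. ?K (a1 mod ?d, b1 mod ?d, y) (a2 mod ?d, b2 mod ?d, y))
    = (if a1 mod ?d = b1 mod ?d \<and> a2 mod ?d = b2 mod ?d \<and> a1 mod ?d = a2 mod ?d
       then 1 / (2 ^ l :: complex) else 0)"
    using density_op_trace_sum[OF \<tau>]
    by (auto simp: tri_entry_perfect_key sum_divide_distrib[symmetric] intro!: sum.neutral)
  also have "(if a1 div ?d = b1 div ?d \<and> a2 div ?d = b2 div ?d \<and> a1 div ?d = a2 div ?d
       then 1 / (2 ^ l :: complex) ^ n else 0) *
      (if a1 mod ?d = b1 mod ?d \<and> a2 mod ?d = b2 mod ?d \<and> a1 mod ?d = a2 mod ?d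
       then 1 / (2 ^ l :: complex) else 0)
    = (if a1 = b1 \<and> a2 = b2 \<and> a1 = a2 then 1 / (2 ^ l) ^ Suc n else 0)"
  proof -
    have eq: "x = y \<longleftrightarrow> x div ?d = y div ?d \<and> x mod ?d = y mod ?d" for x y
      using div_mult_mod_eq[of x ?d] div_mult_mod_eq[of y ?d] by metis
    show ?thesis unfolding eq[of a1 b1] eq[of a2 b2] eq[of a1 a2] by (auto simp: mult.commute)
  qed
  finally show ?case .
qed

section \<open>The new protocol\<close>

lemma tri_entry_alice_relabel:
  assumes "(a1, b1, e1) \<in> idx (d', dB, dE)" "(a2, b2, e2) \<in> idx (d', dB, dE)"
    and "\<And>g a. g < G \<Longrightarrow> a < d' \<Longrightarrow> q g a \<Longrightarrow> \<pi> g a < dA"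
  shows "tri_entry (d', dB, dE) (alice_local (dA, dB, dE) d' (relabel d' G q \<pi>) X) (a1, b1, e1) (a2, b2, e2)
    = (\<Sum>g<G. if q g a1 \<and> q g a2 then tri_entry (dA, dB, dE) X (\<pi> g a1, b1, e1) (\<pi> g a2, b2, e2) else 0)"
proof -
  have "(\<Sum>g<G. if q g a1 \<and> q g a2 then mat dA dA (\<lambda>(x, y). tri_entry (dA, dB, dE) X (x, b1, e1) (y, b2, e2)) $$ (\<pi> g a1, \<pi> g a2) else 0)
    = (\<Sum>g<G. if q g a1 \<and> q g a2 then tri_entry (dA, dB, dE) X (\<pi> g a1, b1, e1) (\<pi> g a2, b2, e2) else 0)"
    using assms by (intro sum.cong refl) auto
  then show ?thesis
    unfolding tri_entry_alice_local[OF assms(1,2)] using assms(1,2) by (simp add: relabel_def)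
qed

lemma tri_entry_bob_relabel:
  assumes "(a1, b1, e1) \<in> idx (dA, d', dE)" "(a2, b2, e2) \<in> idx (dA, d', dE)"
    and "\<And>g b. g < G \<Longrightarrow> b < d' \<Longrightarrow> q g b \<Longrightarrow> \<pi> g b < dB"
  shows "tri_entry (dA, d', dE) (bob_local (dA, dB, dE) d' (relabel d' G q \<pi>) X) (a1, b1, e1) (a2, b2, e2)
    = (\<Sum>g<G. if q g b1 \<and> q g b2 then tri_entry (dA, dB, dE) X (a1, \<pi> g b1, e1) (a2, \<pi> g b2, e2) else 0)"
proof -
  have "(\<Sum>g<G. if q g b1 \<and> q g b2 then mat dB dB (\<lambda>(x, y). tri_entry (dA, dB, dE) X (a1, x, e1) (a2, y, e2)) $$ (\<pi> g b1, \<pi> g b2) else 0)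
    = (\<Sum>g<G. if q g b1 \<and> q g b2 then tri_entry (dA, dB, dE) X (a1, \<pi> g b1, e1) (a2, \<pi> g b2, e2) else 0)"
    using assms by (intro sum.cong refl) auto
  then show ?thesis
    unfolding tri_entry_bob_local[OF assms(1,2)] using assms(1,2) by (simp add: relabel_def)
qed

text \<open>Adjoins the pure state \<open>t\<close> on the interleaved key digits. This is an
  isometry, hence the single Kraus index in \<open>relabel\<close>.\<close>

definition insert_seed :: "nat \<Rightarrow> nat \<Rightarrow> nat \<Rightarrow> nat \<Rightarrow> complex mat \<Rightarrow> complex mat" where
  "insert_seed d k n t = relabel ((d * k) ^ n) 1 (\<lambda>_ a. right_digits d k n a = t) (\<lambda>_ a. left_digits d k n a)"

lemma cptp_insert_seed:
  assumes "t < k ^ n"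
  shows "cptp (d ^ n) ((d * k) ^ n) (insert_seed d k n t)"
  unfolding insert_seed_def
proof (rule cptp_relabel, rule bij_betw_byWitness[where f' = "\<lambda>x. (0, join_digits d k n x t)"])
qed (use assms in \<open>auto simp: split_digits join_digits\<close>)

text \<open>The Kraus operators are \<open>|f k><k|\<close>: a measurement in the computational
  basis followed by the classical function \<open>f\<close>.\<close>

definition hash_channel :: "nat \<Rightarrow> nat \<Rightarrow> (nat \<Rightarrow> nat) \<Rightarrow> complex mat \<Rightarrow> complex mat" where
  "hash_channel N m f = relabel m N (\<lambda>k a. f k = a) (\<lambda>k _. k)"

lemma cptp_hash_channel:
  assumes "\<And>k. k < N \<Longrightarrow> f k < m"
  shows "cptp N m (hash_channel N m f)"
  unfolding hash_channel_def
proof (rule cptp_relabel, rule bij_betw_byWitness[where f' = "\<lambda>k. (k, f k)"])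
qed (use assms in auto)

text \<open>Eve's unnormalised state given that measurements of Alice and Bob yield \<open>k\<close>
  and \<open>k'\<close>; its trace is the probability of this event when \<open>X\<close> is a
  state.\<close>

definition eve_block :: "dims \<Rightarrow> complex mat \<Rightarrow> nat \<Rightarrow> nat \<Rightarrow> complex mat" where
  "eve_block D X k k' =
    mat (snd (snd D)) (snd (snd D)) (\<lambda>(e1, e2). tri_entry D X (k, k', e1) (k, k', e2))"

lemma positive_op_eve_block:
  assumes "positive_op (total_dim (dA, dB, dE)) X" "k < dA" "k' < dB"
  shows "positive_op dE (eve_block (dA, dB, dE) X k k')"
proof -
  have "psd_kernel (idx (dA, dB, dE)) (tri_entry (dA, dB, dE) X)"
    using assms(1) positive_op_tri by blast
  then have "psd_kernel {..<dE} (\<lambda>e1 e2. tri_entry (dA, dB, dE) X (k, k', e1) (k, k', e2))"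
    by (rule psd_kernel_pullback[where \<pi> = "\<lambda>e. (k, k', e)"]) (use assms in auto)
  also have "?this \<longleftrightarrow> psd_kernel {..<dE} (\<lambda>e1 e2. eve_block (dA, dB, dE) X k k' $$ (e1, e2))"
    by (rule psd_kernel_cong) (simp add: eve_block_def)
  finally show ?thesis by (simp add: positive_op_psd_kernel eve_block_def)
qed

lemma sum_idx: "sum g (idx (dA, dB, dE)) = (\<Sum>a<dA. \<Sum>b<dB. \<Sum>e<dE. g (a, b, e))"
  by (simp add: sum.cartesian_product)

lemma mat_trace_eve_blocks:
  assumes "X \<in> tri_carrier (dA, dB, dE)"
  shows "(\<Sum>k<dA. \<Sum>k'<dB. mat_trace (eve_block (dA, dB, dE) X k k')) = mat_trace X"
  unfolding mat_trace_tri[OF assms] sum_idx by (simp add: eve_block_def mat_trace_def)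

text \<open>After both parties have measured, the output has this shape, and so does the perfect
  key. Positive splittings of Eve's blocks therefore assemble to one of the whole
  difference.\<close>

definition block_diagonal :: "dims \<Rightarrow> (nat \<Rightarrow> nat \<Rightarrow> complex mat) \<Rightarrow> complex mat" where
  "block_diagonal D A = tri_mat D (\<lambda>(a1, b1, e1) (a2, b2, e2).
     if a1 = a2 \<and> b1 = b2 then A a1 b1 $$ (e1, e2) else 0)"

lemma block_diagonal_facts:
  assumes A: "\<And>a b. a < dA \<Longrightarrow> b < dB \<Longrightarrow> positive_op dE (A a b)"
  shows "positive_op (total_dim (dA, dB, dE)) (block_diagonal (dA, dB, dE) A)"
    and "mat_trace (block_diagonal (dA, dB, dE) A) = (\<Sum>a<dA. \<Sum>b<dB. mat_trace (A a b))"
proof -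
  let ?D = "(dA, dB, dE)"
  have carrier: "block_diagonal ?D A \<in> tri_carrier ?D"
    unfolding block_diagonal_def by (rule tri_mat_carrier)
  have "psd_kernel (idx ?D) (\<lambda>s t. \<Sum>p\<in>{..<dA} \<times> {..<dB}.
      if (fst s, fst (snd s)) = p \<and> (fst t, fst (snd t)) = p
      then A (fst p) (snd p) $$ (snd (snd s), snd (snd t)) else 0)"
  proof (rule psd_kernel_sum)
    fix p assume "p \<in> {..<dA} \<times> {..<dB}"
    then have "psd_kernel {..<dE} (\<lambda>i j. A (fst p) (snd p) $$ (i, j))"
      using A unfolding positive_op_psd_kernel by auto
    then show "psd_kernel (idx ?D) (\<lambda>s t. if (fst s, fst (snd s)) = p \<and> (fst t, fst (snd t)) = p
      then A (fst p) (snd p) $$ (snd (snd s), snd (snd t)) else 0)"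
      by (rule psd_kernel_masked_pullback[where \<pi> = "\<lambda>s. snd (snd s)" and q = "\<lambda>s. (fst s, fst (snd s)) = p"]) auto
  qed
  also have "?this \<longleftrightarrow> psd_kernel (idx ?D) (tri_entry ?D (block_diagonal ?D A))"
  proof (rule psd_kernel_cong)
    fix s t assume st: "s \<in> idx ?D" "t \<in> idx ?D"
    have "(\<Sum>p\<in>{..<dA} \<times> {..<dB}. if (fst s, fst (snd s)) = p \<and> (fst t, fst (snd t)) = p
        then A (fst p) (snd p) $$ (snd (snd s), snd (snd t)) else 0)
      = (\<Sum>p\<in>{..<dA} \<times> {..<dB}. if p = (fst s, fst (snd s)) then
          (if (fst t, fst (snd t)) = p then A (fst p) (snd p) $$ (snd (snd s), snd (snd t)) else 0) else 0)"
      by (intro sum.cong refl) auto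
    also have "\<dots> = tri_entry ?D (block_diagonal ?D A) s t"
      unfolding block_diagonal_def tri_entry_tri_mat[OF st] using st by (auto simp: sum.delta)
    finally show "(\<Sum>p\<in>{..<dA} \<times> {..<dB}. if (fst s, fst (snd s)) = p \<and> (fst t, fst (snd t)) = p
        then A (fst p) (snd p) $$ (snd (snd s), snd (snd t)) else 0)
      = tri_entry ?D (block_diagonal ?D A) s t" .
  qed
  finally show "positive_op (total_dim ?D) (block_diagonal ?D A)"
    using positive_op_tri carrier by blast
  have "mat_trace (block_diagonal ?D A) = (\<Sum>s\<in>idx ?D. A (fst s) (fst (snd s)) $$ (snd (snd s), snd (snd s)))"
    unfolding mat_trace_tri[OF carrier] unfolding block_diagonal_def
    by (intro sum.cong refl, subst tri_entry_tri_mat) auto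
  also have "\<dots> = (\<Sum>a<dA. \<Sum>b<dB. \<Sum>e<dE. A a b $$ (e, e))" unfolding sum_idx by simp
  also have "\<dots> = (\<Sum>a<dA. \<Sum>b<dB. mat_trace (A a b))"
    using A by (intro sum.cong refl) (auto simp: mat_trace_def dest!: positive_op_carrier)
  finally show "mat_trace (block_diagonal ?D A) = (\<Sum>a<dA. \<Sum>b<dB. mat_trace (A a b))" .
qed

section \<open>Ideal keys and the output of the inserted channels\<close>

lemma density_op_perfect_key:
  assumes \<tau>: "density_op d \<tau>"
  shows "density_op (total_dim (2 ^ l, 2 ^ l, d)) (perfect_key l d \<tau>)"
proof -
  let ?D = "(2 ^ l, 2 ^ l, d) :: dims"
  have c: "perfect_key l d \<tau> \<in> tri_carrier ?D"
    unfolding perfect_key_def key_dims_def by (rule tri_mat_carrier)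
  have \<tau>p: "positive_op d \<tau>" using \<tau> by (simp add: density_op_def)
  have \<tau>': "psd_kernel {..<d} (\<lambda>i j. (of_real (1 / 2 ^ l) \<cdot>\<^sub>m \<tau>) $$ (i, j))"
    using positive_op_smult[OF \<tau>p, of "1 / 2 ^ l"] unfolding positive_op_psd_kernel by simp
  have \<tau>e: "(of_real (1 / 2 ^ l) \<cdot>\<^sub>m \<tau>) $$ (i, j) = \<tau> $$ (i, j) / 2 ^ l" if "i < d" "j < d" for i j
    using that positive_op_carrier[OF \<tau>p] by simp
  have "psd_kernel (idx ?D) (\<lambda>s t. \<Sum>i<2 ^ l. if (fst s = i \<and> fst (snd s) = i) \<and> (fst t = i \<and> fst (snd t) = i)
      then (of_real (1 / 2 ^ l) \<cdot>\<^sub>m \<tau>) $$ (snd (snd s), snd (snd t)) else 0)"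
    by (rule psd_kernel_sum, rule psd_kernel_masked_pullback[OF \<tau>', where \<pi> = "\<lambda>s. snd (snd s)"]) auto
  also have "?this \<longleftrightarrow> psd_kernel (idx ?D) (tri_entry ?D (perfect_key l d \<tau>))"
  proof (rule psd_kernel_cong)
    fix s t assume "s \<in> idx ?D" "t \<in> idx ?D"
    then obtain a1 b1 e1 a2 b2 e2 where eq: "s = (a1, b1, e1)" "t = (a2, b2, e2)"
      and l: "a1 < 2 ^ l" "b1 < 2 ^ l" "e1 < d" "a2 < 2 ^ l" "b2 < 2 ^ l" "e2 < d"
      by auto
    have "(\<Sum>i<2 ^ l. if (fst s = i \<and> fst (snd s) = i) \<and> (fst t = i \<and> fst (snd t) = i)
      then (of_real (1 / 2 ^ l) \<cdot>\<^sub>m \<tau>) $$ (snd (snd s), snd (snd t)) else 0)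
      = (\<Sum>i<2 ^ l. if i = a1 then (if b1 = i \<and> a2 = i \<and> b2 = i then \<tau> $$ (e1, e2) / 2 ^ l else 0) else 0)"
      unfolding eq fst_conv snd_conv using \<tau>e[OF l(3,6)] by (intro sum.cong refl) auto
    also have "\<dots> = tri_entry ?D (perfect_key l d \<tau>) s t"
      unfolding eq tri_entry_perfect_key[OF l] using l by auto
    finally show "(\<Sum>i<2 ^ l. if (fst s = i \<and> fst (snd s) = i) \<and> (fst t = i \<and> fst (snd t) = i)
      then (of_real (1 / 2 ^ l) \<cdot>\<^sub>m \<tau>) $$ (snd (snd s), snd (snd t)) else 0) = tri_entry ?D (perfect_key l d \<tau>) s t" .
  qed
  finally have pos: "positive_op (total_dim ?D) (perfect_key l d \<tau>)" using positive_op_tri c by blast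
  have "mat_trace (perfect_key l d \<tau>)
    = (\<Sum>a<2 ^ l. \<Sum>b<2 ^ l. \<Sum>e<d. tri_entry ?D (perfect_key l d \<tau>) (a, b, e) (a, b, e))"
    unfolding mat_trace_tri[OF c] sum_idx ..
  also have "\<dots> = (\<Sum>a<(2 :: nat) ^ l. \<Sum>b<2 ^ l. if b = a then (\<Sum>e<d. \<tau> $$ (e, e)) / 2 ^ l else 0)"
    by (intro sum.cong refl) (auto simp: tri_entry_perfect_key sum_divide_distrib)
  also have "\<dots> = (\<Sum>a<(2 :: nat) ^ l. 1 / 2 ^ l)"
    by (intro sum.cong refl) (auto simp: density_op_trace_sum[OF \<tau>])
  also have "\<dots> = 1" by simp
  finally show ?thesis using pos by (simp add: density_op_def)
qed

lemma density_op_partial_trace: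
  assumes u: "splits d0 d G u" and \<tau>: "density_op d0 \<tau>"
  shows "density_op d (mat d d (\<lambda>(e1, e2). \<Sum>g<G. \<tau> $$ (u e1 g, u e2 g)))"
proof -
  have k: "psd_kernel {..<d0} (\<lambda>i j. \<tau> $$ (i, j))"
    using \<tau> unfolding density_op_def positive_op_psd_kernel by blast
  have "psd_kernel {..<d} (\<lambda>e1 e2. \<Sum>g<G. \<tau> $$ (u e1 g, u e2 g))"
  proof (rule psd_kernel_sum)
    fix g assume "g \<in> {..<G}"
    then show "psd_kernel {..<d} (\<lambda>e1 e2. \<tau> $$ (u e1 g, u e2 g))"
      using splits_less[OF u] by (intro psd_kernel_pullback[OF k, where \<pi> = "\<lambda>e. u e g"]) auto
  qed
  also have "?this \<longleftrightarrow> psd_kernel {..<d} (\<lambda>i j. mat d d (\<lambda>(e1, e2). \<Sum>g<G. \<tau> $$ (u e1 g, u e2 g)) $$ (i, j))"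
    by (rule psd_kernel_cong) simp
  finally have pos: "positive_op d (mat d d (\<lambda>(e1, e2). \<Sum>g<G. \<tau> $$ (u e1 g, u e2 g)))"
    unfolding positive_op_psd_kernel by simp
  have "mat_trace (mat d d (\<lambda>(e1, e2). \<Sum>g<G. \<tau> $$ (u e1 g, u e2 g))) = (\<Sum>e<d. \<Sum>g<G. \<tau> $$ (u e g, u e g))"
    by (simp add: mat_trace_def)
  also have "\<dots> = (\<Sum>p\<in>{..<d} \<times> {..<G}. (\<lambda>x. \<tau> $$ (x, x)) ((\<lambda>(e, g). u e g) p))"
    by (simp add: sum.cartesian_product case_prod_beta)
  also have "\<dots> = (\<Sum>x<d0. \<tau> $$ (x, x))"
    using u unfolding splits_def by (rule sum.reindex_bij_betw)
  also have "\<dots> = 1" by (rule density_op_trace_sum[OF \<tau>])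
  finally show ?thesis using pos by (simp add: density_op_def)
qed

lemma tri_entry_insert_seeds:
  fixes dA dB dE k n t :: nat and X :: "complex mat"
  defines "A \<equiv> (dA * k) ^ n" and "B \<equiv> (dB * k) ^ n" and "E \<equiv> dE ^ n"
  assumes "a1 < A" "b1 < B" "e1 < E" "a2 < A" "b2 < B" "e2 < E"
  shows "tri_entry (A, B, E) (bob_local (A, dB ^ n, E) B (insert_seed dB k n t)
      (alice_local (dA ^ n, dB ^ n, E) A (insert_seed dA k n t) X)) (a1, b1, e1) (a2, b2, e2)
    = (if right_digits dA k n a1 = t \<and> right_digits dA k n a2 = t \<and>
          right_digits dB k n b1 = t \<and> right_digits dB k n b2 = t
       then tri_entry (dA ^ n, dB ^ n, E) X (left_digits dA k n a1, left_digits dB k n b1, e1)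
         (left_digits dA k n a2, left_digits dB k n b2, e2) else 0)"
proof -
  have l: "left_digits dA k n a < dA ^ n" if "a < A" for a using split_digits(1) that unfolding A_def .
  have l': "left_digits dB k n b < dB ^ n" if "b < B" for b using split_digits(1) that unfolding B_def .
  have "tri_entry (A, B, E) (bob_local (A, dB ^ n, E) B (insert_seed dB k n t)
      (alice_local (dA ^ n, dB ^ n, E) A (insert_seed dA k n t) X)) (a1, b1, e1) (a2, b2, e2)
    = (if right_digits dB k n b1 = t \<and> right_digits dB k n b2 = t
       then tri_entry (A, dB ^ n, E) (alice_local (dA ^ n, dB ^ n, E) A (insert_seed dA k n t) X)
         (a1, left_digits dB k n b1, e1) (a2, left_digits dB k n b2, e2) else 0)"
    unfolding insert_seed_def B_def[symmetric]
    by (subst tri_entry_bob_relabel) (use assms(4-) l' in auto)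
  also have "tri_entry (A, dB ^ n, E) (alice_local (dA ^ n, dB ^ n, E) A (insert_seed dA k n t) X)
         (a1, left_digits dB k n b1, e1) (a2, left_digits dB k n b2, e2)
    = (if right_digits dA k n a1 = t \<and> right_digits dA k n a2 = t
       then tri_entry (dA ^ n, dB ^ n, E) X (left_digits dA k n a1, left_digits dB k n b1, e1)
         (left_digits dA k n a2, left_digits dB k n b2, e2) else 0)"
    unfolding insert_seed_def A_def[symmetric]
    by (subst tri_entry_alice_relabel) (use assms(4-) l l' in auto)
  finally show ?thesis by simp
qed

text \<open>Both parties apply the same \<open>f\<close>, so an output pair collects a product of
  two fibres. Blocks off the diagonal vanish because the raw keys are measured.\<close>

lemma tri_entry_hash_channels:
  assumes "a1 < m" "b1 < m" "e1 < d" "a2 < m" "b2 < m" "e2 < d"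
  shows "tri_entry (m, m, d) (bob_local (m, N, d) m (hash_channel N m f)
      (alice_local (N, N, d) m (hash_channel N m f) X)) (a1, b1, e1) (a2, b2, e2)
    = (if a1 = a2 \<and> b1 = b2
       then mat_sum d (\<lambda>(k, k'). eve_block (N, N, d) X k k') ({k. k < N \<and> f k = a1} \<times> {k. k < N \<and> f k = b1}) $$ (e1, e2)
       else 0)"
proof -
  let ?x = "\<lambda>k k'. tri_entry (N, N, d) X (k, k', e1) (k, k', e2)"
  let ?F = "\<lambda>a. {k. k < N \<and> f k = a}"
  have F: "?F a = {k \<in> {..<N}. f k = a}" for a by auto
  have filt: "(\<Sum>k<N. if f k = a1 \<and> f k = a2 then h k else 0)
      = (if a1 = a2 then sum h (?F a1) else 0)" for h :: "nat \<Rightarrow> complex" and a1 a2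
  proof (cases "a1 = a2")
    case True
    have "sum h (?F a1) = (\<Sum>k<N. if f k = a1 then h k else 0)"
      unfolding F by (rule sum.inter_filter) simp
    then show ?thesis using True by simp
  qed (auto intro!: sum.neutral)
  have al: "tri_entry (m, N, d) (alice_local (N, N, d) m (hash_channel N m f) X) (a1, k', e1) (a2, k', e2)
    = (if a1 = a2 then (\<Sum>k\<in>?F a1. ?x k k') else 0)" if "k' < N" for k'
    unfolding hash_channel_def filt[symmetric]
    by (subst tri_entry_alice_relabel) (use that assms in auto)
  have "tri_entry (m, m, d) (bob_local (m, N, d) m (hash_channel N m f)
      (alice_local (N, N, d) m (hash_channel N m f) X)) (a1, b1, e1) (a2, b2, e2)
    = (\<Sum>k'<N. if f k' = b1 \<and> f k' = b2 then
        tri_entry (m, N, d) (alice_local (N, N, d) m (hash_channel N m f) X) (a1, k', e1) (a2, k', e2) else 0)"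
    unfolding hash_channel_def[of N m f]
    by (subst tri_entry_bob_relabel) (use assms in auto)
  also have "\<dots> = (if b1 = b2 then (\<Sum>k'\<in>?F b1.
      tri_entry (m, N, d) (alice_local (N, N, d) m (hash_channel N m f) X) (a1, k', e1) (a2, k', e2)) else 0)"
    by (rule filt)
  also have "\<dots> = (if b1 = b2 then (\<Sum>k'\<in>?F b1. if a1 = a2 then (\<Sum>k\<in>?F a1. ?x k k') else 0) else 0)"
    by (intro if_cong refl sum.cong al) simp
  also have "\<dots> = (if a1 = a2 \<and> b1 = b2 then (\<Sum>k\<in>?F a1. \<Sum>k'\<in>?F b1. ?x k k') else 0)"
    by (subst sum.swap) auto
  also have "(\<Sum>k\<in>?F a1. \<Sum>k'\<in>?F b1. ?x k k')
    = mat_sum d (\<lambda>(k, k'). eve_block (N, N, d) X k k') (?F a1 \<times> ?F b1) $$ (e1, e2)"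
    using assms by (simp add: sum.cartesian_product eve_block_def case_prod_beta)
  finally show ?thesis .
qed

text \<open>The estimate for one block length \<open>n\<close>. Up to the partial trace over the
  factor \<open>F\<close>, the old protocol is the average over \<open>t\<close> of its runs on the
  inserted seed \<open>t\<close>, and the one-shot theorem selects a seed and a hash.
  \<open>M\<close> is left free; its dependence on \<open>L\<close>, \<open>l\<close> and
  \<open>n\<close> is chosen when the limit is taken.\<close>

lemma key_distillation_without_key:
  fixes dA dB dE dF l n L M d0 :: nat and \<rho> \<tau>F \<tau>0 :: "complex mat"
    and \<Lambda> :: "complex mat \<Rightarrow> complex mat" and \<epsilon>' :: real
  defines "D \<equiv> (dA, dB, dE)" and "K \<equiv> key_dims l dF"
  defines "\<sigma> \<equiv> \<Lambda> (tri_power (dims_mult D K) (tri_tensor D K \<rho> (perfect_key l dF \<tau>F)) n)"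
  assumes \<rho>: "density_op (total_dim D) \<rho>" and \<tau>F: "density_op dF \<tau>F"
    and \<Lambda>: "lopc (dims_power (dims_mult D K) n) (key_dims L d0) \<Lambda>"
    and \<tau>0: "density_op d0 \<tau>0"
    and \<epsilon>': "2 * trace_dist \<sigma> (perfect_key L d0 \<tau>0) < \<epsilon>'"
  shows "0 \<le> trace_dist \<sigma> (perfect_key L d0 \<tau>0)"
    and "\<exists>d \<Lambda>' \<tau>. lopc (dims_power D n) (key_dims M d) \<Lambda>' \<and> density_op d \<tau> \<and>
      0 \<le> trace_dist (\<Lambda>' (tri_power D \<rho> n)) (perfect_key M d \<tau>) \<and>
      trace_dist (\<Lambda>' (tri_power D \<rho> n)) (perfect_key M d \<tau>)
        \<le> sqrt ((2 ^ M - 1) * 2 ^ (l * n) / 2 ^ L) + 2 * sqrt \<epsilon>' + 2 * \<epsilon>'"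
proof -
  define k where "k = (2 :: nat) ^ l"
  define s where "s = k ^ n"
  have k: "0 < k" by (simp add: k_def)
  have s: "0 < s" using k by (simp add: s_def)
  define A where "A = (dA * k) ^ n"
  define B where "B = (dB * k) ^ n"
  define E where "E = dE ^ n"
  define EF where "EF = (dE * dF) ^ n"
  define G where "G = dF ^ n"
  define N where "N = (2 :: nat) ^ L"
  define m where "m = (2 :: nat) ^ M"
  have N: "0 < N" and m: "0 < m" by (auto simp: N_def m_def)
  have DK: "dims_mult D K = (dA * k, dB * k, dE * dF)" by (simp add: D_def K_def key_dims_def k_def)
  have DKn: "dims_power (dims_mult D K) n = (A, B, EF)"
    unfolding DK dims_power_eq by (simp add: A_def B_def EF_def)
  have Dn: "dims_power D n = (dA ^ n, dB ^ n, E)" unfolding D_def dims_power_eq E_def ..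
  define \<rho>n where "\<rho>n = tri_power D \<rho> n"
  have \<rho>n: "density_op (total_dim (dA ^ n, dB ^ n, E)) \<rho>n"
    unfolding \<rho>n_def D_def E_def using \<rho> by (intro density_op_power) (simp add: D_def)
  define \<omega> where "\<omega> = tri_power (dims_mult D K) (tri_tensor D K \<rho> (perfect_key l dF \<tau>F)) n"
  have \<omega>_eq: "\<omega> = tri_power (dA * k, dB * k, dE * dF)
      (tri_tensor (dA, dB, dE) (k, k, dF) \<rho> (perfect_key l dF \<tau>F)) n"
    unfolding \<omega>_def DK by (simp add: D_def K_def key_dims_def k_def)
  have key: "density_op (total_dim (k, k, dF)) (perfect_key l dF \<tau>F)"
    unfolding k_def by (rule density_op_perfect_key[OF \<tau>F])
  have \<omega>: "density_op (total_dim (A, B, EF)) \<omega>"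
    unfolding \<omega>_eq A_def B_def EF_def
    by (intro density_op_power density_op_tensor key) (use \<rho> in \<open>simp add: D_def\<close>)
  have \<Lambda>': "lopc (A, B, EF) (N, N, d0) \<Lambda>"
    using \<Lambda> unfolding DKn key_dims_def N_def .
  note \<Lambda>_facts = lopc_facts[OF \<Lambda>', unfolded ptp_map_def]
  have \<sigma>: "\<sigma> = \<Lambda> \<omega>" by (simp add: \<sigma>_def \<omega>_def)
  have \<sigma>p: "positive_op (total_dim (N, N, d0)) \<sigma>"
    unfolding \<sigma> using \<omega> \<Lambda>_facts unfolding density_op_def by blast
  define \<kappa> where "\<kappa> = perfect_key L d0 \<tau>0"
  have \<kappa>p: "positive_op (total_dim (N, N, d0)) \<kappa>"
    unfolding \<kappa>_def N_def using density_op_perfect_key[OF \<tau>0] unfolding density_op_def by blast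
  note \<sigma>c = positive_op_carrier[OF \<sigma>p] and \<kappa>c = positive_op_carrier[OF \<kappa>p]
  show "0 \<le> trace_dist \<sigma> (perfect_key L d0 \<tau>0)"
    using trace_dist_nonneg[OF \<sigma>c \<kappa>c positive_op_hermitian[OF \<sigma>p] positive_op_hermitian[OF \<kappa>p]]
    unfolding \<kappa>_def .
  obtain P0 Q0 where P0: "positive_op (total_dim (N, N, d0)) P0" and Q0: "positive_op (total_dim (N, N, d0)) Q0"
    and PQ: "\<sigma> - \<kappa> = P0 - Q0" and trPQ: "2 * trace_dist \<sigma> \<kappa> = rtrace P0 + rtrace Q0"
    using trace_dist_decomposition[OF \<sigma>c \<kappa>c positive_op_hermitian[OF \<sigma>p] positive_op_hermitian[OF \<kappa>p]] .
  note P0c = positive_op_carrier[OF P0] and Q0c = positive_op_carrier[OF Q0]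
  \<comment> \<open>The old map expects Eve's part of the keys. Tracing it out at the start
    corresponds to tracing out some factor at the end, and the LOPC map \<open>\<Lambda>t\<close> in
    between acts without it.\<close>
  have split: "splits EF E G (join_digits dE dF n)"
    unfolding EF_def E_def G_def by (rule splits_join_digits)
  obtain d u \<Lambda>t where \<Lambda>t: "lopc (A, B, E) (N, N, d) \<Lambda>t" and u: "splits d0 d G u"
    and comm: "\<And>X. \<Lambda>t (eve_trace (A, B, EF) G (join_digits dE dF n) E X) = eve_trace (N, N, d0) G u d (\<Lambda> X)"
    using lopc_eve_trace[OF \<Lambda>' split] by blast
  note \<Lambda>t_facts = lopc_facts[OF \<Lambda>t, unfolded ptp_map_def]
  have \<Lambda>t_lin: "linear_op (total_dim (A, B, E)) (total_dim (N, N, d)) \<Lambda>t" using \<Lambda>t_facts by blast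
  define Y where "Y t X = bob_local (A, dB ^ n, E) B (insert_seed dB k n t)
      (alice_local (dA ^ n, dB ^ n, E) A (insert_seed dA k n t) X)" for t X
  have Y_lopc: "lopc (dA ^ n, dB ^ n, E) (A, B, E) (Y t)" if "t < s" for t
  proof -
    have "lopc_step (dA ^ n, dB ^ n, E) (A, dB ^ n, E) (alice_local (dA ^ n, dB ^ n, E) A (insert_seed dA k n t))"
      unfolding A_def using that[unfolded s_def] by (intro lopc_step.alice_local cptp_insert_seed)
    moreover have "lopc_step (A, dB ^ n, E) (A, B, E) (bob_local (A, dB ^ n, E) B (insert_seed dB k n t))"
      unfolding B_def using that[unfolded s_def] by (intro lopc_step.bob_local cptp_insert_seed)
    ultimately show ?thesis
      unfolding Y_def[abs_def] by (intro lopc_trans[OF lopc_single lopc_single])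
  qed
  define Z where "Z t = \<Lambda>t (Y t \<rho>n)" for t
  have Y\<rho>: "positive_op (total_dim (A, B, E)) (Y t \<rho>n)" "mat_trace (Y t \<rho>n) = 1" if "t < s" for t
    using lopc_facts[OF Y_lopc[OF that], unfolded ptp_map_def] \<rho>n positive_op_carrier unfolding density_op_def by auto
  have Z: "positive_op (total_dim (N, N, d)) (Z t)" "mat_trace (Z t) = 1" if "t < s" for t
    using \<Lambda>t_facts Y\<rho>[OF that] positive_op_carrier unfolding Z_def by auto
  \<comment> \<open>Once Eve's part is traced out, the \<open>n\<close> keys are a uniform mixture
    of the \<open>s = 2 ^ (l * n)\<close> states in which both parties hold the same
    \<open>t\<close>. Here the given key is replaced by preparations that Alice and Bob can carry
    out locally.\<close>
  have seeds: "eve_trace (A, B, EF) G (join_digits dE dF n) E \<omega>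
    = of_real (1 / real s) \<cdot>\<^sub>m mat_sum (total_dim (A, B, E)) (\<lambda>t. Y t \<rho>n) {..<s}"
  proof (rule tri_mat_eqI[where D = "(A, B, E)"])
    fix p q assume pq: "p \<in> idx (A, B, E)" "q \<in> idx (A, B, E)"
    obtain a1 b1 e1 a2 b2 e2 where eq: "p = (a1, b1, e1)" "q = (a2, b2, e2)" by (metis prod_cases3)
    have l: "a1 < A" "b1 < B" "e1 < E" "a2 < A" "b2 < B" "e2 < E" using pq eq by auto
    let ?r = "tri_entry (dA ^ n, dB ^ n, E) \<rho>n (left_digits dA k n a1, left_digits dB k n b1, e1)
         (left_digits dA k n a2, left_digits dB k n b2, e2)"
    let ?ra1 = "right_digits dA k n a1" and ?ra2 = "right_digits dA k n a2"
      and ?rb1 = "right_digits dB k n b1" and ?rb2 = "right_digits dB k n b2"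
    have rl: "?ra1 < k ^ n" "?ra2 < k ^ n" "?rb1 < k ^ n" "?rb2 < k ^ n"
      using l unfolding A_def B_def by (auto intro: split_digits(2))
    have "tri_entry (A, B, E) (eve_trace (A, B, EF) G (join_digits dE dF n) E \<omega>) p q
      = (\<Sum>g<G. tri_entry (A, B, EF) \<omega> (a1, b1, join_digits dE dF n e1 g) (a2, b2, join_digits dE dF n e2 g))"
      unfolding tri_entry_eve_trace[OF pq] unfolding eq by simp
    also have "\<dots> = (\<Sum>g<G. ?r * tri_entry (k ^ n, k ^ n, dF ^ n) (tri_power (k, k, dF) (perfect_key l dF \<tau>F) n)
        (?ra1, ?rb1, g) (?ra2, ?rb2, g))"
    proof (intro sum.cong refl)
      fix g assume "g \<in> {..<G}"
      then have g: "g < dF ^ n" by (simp add: G_def)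
      have e: "e1 < dE ^ n" "e2 < dE ^ n" using l by (auto simp: E_def)
      have i: "(a1, b1, join_digits dE dF n e1 g) \<in> idx ((dA * k) ^ n, (dB * k) ^ n, (dE * dF) ^ n)"
        "(a2, b2, join_digits dE dF n e2 g) \<in> idx ((dA * k) ^ n, (dB * k) ^ n, (dE * dF) ^ n)"
        using l join_digits(1)[OF e(1) g] join_digits(1)[OF e(2) g] by (auto simp: A_def B_def)
      show "tri_entry (A, B, EF) \<omega> (a1, b1, join_digits dE dF n e1 g) (a2, b2, join_digits dE dF n e2 g)
        = ?r * tri_entry (k ^ n, k ^ n, dF ^ n) (tri_power (k, k, dF) (perfect_key l dF \<tau>F) n)
        (?ra1, ?rb1, g) (?ra2, ?rb2, g)"
        unfolding \<omega>_eq A_def B_def EF_def tri_entry_tensor_power[OF i] unfolding \<rho>n_def D_def E_def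
        by (simp add: tri_map_def join_digits[OF e(1) g] join_digits[OF e(2) g])
    qed
    also have "\<dots> = ?r * (if ?ra1 = ?rb1 \<and> ?ra2 = ?rb2 \<and> ?ra1 = ?ra2 then 1 / (2 ^ l) ^ n else 0)"
      unfolding sum_distrib_left[symmetric] G_def using key_power_marginal[OF \<tau>F] rl unfolding k_def by simp
    also have "\<dots> = of_real (1 / real s) * (\<Sum>t<s. if ?ra1 = t \<and> ?ra2 = t \<and> ?rb1 = t \<and> ?rb2 = t then ?r else 0)"
    proof -
      have "(\<Sum>t<s. if ?ra1 = t \<and> ?ra2 = t \<and> ?rb1 = t \<and> ?rb2 = t then ?r else 0)
        = (\<Sum>t<s. if t = ?ra1 then (if ?ra2 = t \<and> ?rb1 = t \<and> ?rb2 = t then ?r else 0) else 0)"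
        by (intro sum.cong refl) auto
      also have "\<dots> = (if ?ra2 = ?ra1 \<and> ?rb1 = ?ra1 \<and> ?rb2 = ?ra1 then ?r else 0)"
        using rl(1) by (simp add: s_def)
      finally show ?thesis by (auto simp: s_def k_def)
    qed
    also have "(\<Sum>t<s. if ?ra1 = t \<and> ?ra2 = t \<and> ?rb1 = t \<and> ?rb2 = t then ?r else 0)
      = (\<Sum>t<s. tri_entry (A, B, E) (Y t \<rho>n) p q)"
      unfolding eq Y_def A_def B_def E_def
      by (intro sum.cong refl, subst tri_entry_insert_seeds) (use l in \<open>auto simp: A_def B_def E_def\<close>)
    also have "of_real (1 / real s) * \<dots> = tri_entry (A, B, E)
      (of_real (1 / real s) \<cdot>\<^sub>m mat_sum (total_dim (A, B, E)) (\<lambda>t. Y t \<rho>n) {..<s}) p q"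
      by (simp only: tri_entry_smult[OF mat_sum_carrier pq] tri_entry_mat_sum[OF pq])
    finally show "tri_entry (A, B, E) (eve_trace (A, B, EF) G (join_digits dE dF n) E \<omega>) p q = tri_entry (A, B, E)
      (of_real (1 / real s) \<cdot>\<^sub>m mat_sum (total_dim (A, B, E)) (\<lambda>t. Y t \<rho>n) {..<s}) p q" .
  qed (rule eve_trace_carrier, simp)
  have avg: "eve_trace (N, N, d0) G u d \<sigma> = of_real (1 / real s) \<cdot>\<^sub>m mat_sum (total_dim (N, N, d)) Z {..<s}"
  proof -
    have "mat_sum (total_dim (N, N, d)) Z {..<s} = \<Lambda>t (mat_sum (total_dim (A, B, E)) (\<lambda>t. Y t \<rho>n) {..<s})"
      unfolding Z_def by (rule linear_op_mat_sum[OF \<Lambda>t_lin, symmetric])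
        (use Y\<rho>(1) positive_op_carrier in auto)
    then show ?thesis
      unfolding \<sigma> comm[symmetric] seeds by (simp only: linear_opD(3)[OF \<Lambda>t_lin mat_sum_carrier])
  qed
  define \<tau>' where "\<tau>' = mat d d (\<lambda>(e1, e2). \<Sum>g<G. \<tau>0 $$ (u e1 g, u e2 g))"
  have \<tau>': "density_op d \<tau>'" unfolding \<tau>'_def by (rule density_op_partial_trace[OF u \<tau>0])
  have \<tau>'p: "positive_op d \<tau>'" using \<tau>' by (simp add: density_op_def)
  \<comment> \<open>\<open>T\<close> is the block of the partially traced ideal key that belongs to
    one of its \<open>N\<close> values, so its trace is \<open>1 / N\<close>.\<close>
  define T where "T = of_real (1 / real N) \<cdot>\<^sub>m \<tau>'"
  have T: "positive_op d T" unfolding T_def by (rule positive_op_smult[OF \<tau>'p]) simp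
  have trT: "rtrace T = 1 / real N"
    using \<tau>' unfolding T_def by (simp add: mat_trace_smult[OF positive_op_carrier[OF \<tau>'p]] density_op_def)
  note et = eve_trace_facts[OF u, where dA = N and dB = N]
  define P where "P = eve_trace (N, N, d0) G u d P0"
  define Q where "Q = eve_trace (N, N, d0) G u d Q0"
  have P: "positive_op (total_dim (N, N, d)) P" and Q: "positive_op (total_dim (N, N, d)) Q"
    unfolding P_def Q_def using et(2) P0 Q0 by blast+
  let ?b = "eve_block (N, N, d)"
  have bc: "?b X k k' \<in> carrier_mat d d" for X k k' by (simp add: eve_block_def)
  \<comment> \<open>The averaged output is the ideal key plus \<open>P\<close> minus
    \<open>Q\<close>. Omitting the positive operator \<open>Q\<close> turns this identity into the
    operator inequality of the one-shot theorem.\<close>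
  have eq: "mat_sum d (\<lambda>t. ?b (Z t) k k') {..<s}
      = of_real (real s) \<cdot>\<^sub>m (((if k = k' then T else 0\<^sub>m d d) + ?b P k k') - ?b Q k k')"
    if kk: "k < N" "k' < N" for k k'
  proof (rule eq_matI)
    have Tc: "T \<in> carrier_mat d d" using T by (rule positive_op_carrier)
    have ifc: "(if k = k' then T else 0\<^sub>m d d) \<in> carrier_mat d d" using Tc by simp
    fix i j
    assume "i < dim_row (of_real (real s) \<cdot>\<^sub>m (((if k = k' then T else 0\<^sub>m d d) + ?b P k k') - ?b Q k k'))"
      "j < dim_col (of_real (real s) \<cdot>\<^sub>m (((if k = k' then T else 0\<^sub>m d d) + ?b P k k') - ?b Q k k'))"
    then have ij: "i < d" "j < d" using ifc bc by (auto simp: eve_block_def)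
    let ?p = "(k, k', i)" and ?q = "(k, k', j)"
    have pq: "?p \<in> idx (N, N, d)" "?q \<in> idx (N, N, d)" using kk ij by auto
    have "of_real (1 / real s) * (\<Sum>t<s. tri_entry (N, N, d) (Z t) ?p ?q)
      = tri_entry (N, N, d) (eve_trace (N, N, d0) G u d \<sigma>) ?p ?q"
      unfolding avg by (simp only: tri_entry_smult[OF mat_sum_carrier pq] tri_entry_mat_sum[OF pq])
    also have "\<dots> = (\<Sum>g<G. tri_entry (N, N, d0) \<sigma> (k, k', u i g) (k, k', u j g))"
      unfolding tri_entry_eve_trace[OF pq] by simp
    also have "\<dots> = (\<Sum>g<G. (if k = k' then \<tau>0 $$ (u i g, u j g) / 2 ^ L else 0) +
        tri_entry (N, N, d0) P0 (k, k', u i g) (k, k', u j g) - tri_entry (N, N, d0) Q0 (k, k', u i g) (k, k', u j g))"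
    proof (intro sum.cong refl)
      fix g assume "g \<in> {..<G}"
      then have ug: "u i g < d0" "u j g < d0" using splits_less[OF u] ij by auto
      then have i: "(k, k', u i g) \<in> idx (N, N, d0)" "(k, k', u j g) \<in> idx (N, N, d0)" using kk by auto
      have "tri_entry (N, N, d0) \<sigma> (k, k', u i g) (k, k', u j g) - tri_entry (N, N, d0) \<kappa> (k, k', u i g) (k, k', u j g)
        = tri_entry (N, N, d0) P0 (k, k', u i g) (k, k', u j g) - tri_entry (N, N, d0) Q0 (k, k', u i g) (k, k', u j g)"
        unfolding tri_entry_minus[OF \<sigma>c \<kappa>c i, symmetric] tri_entry_minus[OF P0c Q0c i, symmetric] PQ ..
      moreover have "tri_entry (N, N, d0) \<kappa> (k, k', u i g) (k, k', u j g) = (if k = k' then \<tau>0 $$ (u i g, u j g) / 2 ^ L else 0)"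
        unfolding \<kappa>_def N_def using kk ug by (subst tri_entry_perfect_key) (auto simp: N_def)
      ultimately show "tri_entry (N, N, d0) \<sigma> (k, k', u i g) (k, k', u j g)
        = (if k = k' then \<tau>0 $$ (u i g, u j g) / 2 ^ L else 0) +
        tri_entry (N, N, d0) P0 (k, k', u i g) (k, k', u j g) - tri_entry (N, N, d0) Q0 (k, k', u i g) (k, k', u j g)"
        by (simp add: algebra_simps)
    qed
    also have "\<dots> = (if k = k' then T $$ (i, j) else 0) + ?b P k k' $$ (i, j) - ?b Q k k' $$ (i, j)"
    proof -
      have "?b P k k' $$ (i, j) = (\<Sum>g<G. tri_entry (N, N, d0) P0 (k, k', u i g) (k, k', u j g))"
        "?b Q k k' $$ (i, j) = (\<Sum>g<G. tri_entry (N, N, d0) Q0 (k, k', u i g) (k, k', u j g))"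
        using ij tri_entry_eve_trace[OF pq] by (simp_all add: eve_block_def P_def Q_def del: eve_trace.simps)
      moreover have "T $$ (i, j) = (\<Sum>g<G. \<tau>0 $$ (u i g, u j g) / 2 ^ L)"
        using ij by (simp add: T_def \<tau>'_def N_def sum_divide_distrib)
      ultimately show ?thesis by (auto simp: sum.distrib sum_subtractf)
    qed
    finally have main: "(\<Sum>t<s. tri_entry (N, N, d) (Z t) ?p ?q)
      = of_real (real s) * ((if k = k' then T $$ (i, j) else 0) + ?b P k k' $$ (i, j) - ?b Q k k' $$ (i, j))"
      using s by (simp add: field_simps)
    have "(\<Sum>t<s. ?b (Z t) k k' $$ (i, j)) = (\<Sum>t<s. tri_entry (N, N, d) (Z t) ?p ?q)"
      using ij by (simp add: eve_block_def)
    then show "mat_sum d (\<lambda>t. ?b (Z t) k k') {..<s} $$ (i, j)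
      = (of_real (real s) \<cdot>\<^sub>m (((if k = k' then T else 0\<^sub>m d d) + ?b P k k') - ?b Q k k')) $$ (i, j)"
      using ij main Tc carrier_matD[OF bc] by (auto simp del: of_real_of_nat_eq)
  qed (auto simp: eve_block_def)
  have "\<exists>t<s. \<exists>f AA BB. (\<forall>k<N. f k < m) \<and>
    (\<forall>a<m. \<forall>b<m. positive_op d (AA a b) \<and> positive_op d (BB a b) \<and>
      AA a b - BB a b = mat_sum d (\<lambda>(k, k'). ?b (Z t) k k') ({k. k < N \<and> f k = a} \<times> {k. k < N \<and> f k = b}) -
        (if a = b then of_real (1 / real m) \<cdot>\<^sub>m mat_sum d (\<lambda>(k, k'). ?b (Z t) k k') ({..<N} \<times> {..<N})
         else 0\<^sub>m d d)) \<and>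
    (\<Sum>a<m. \<Sum>b<m. rtrace (AA a b) + rtrace (BB a b))
      \<le> sqrt ((real m - 1) * rtrace T * real s) + 2 * sqrt \<epsilon>' + 2 * \<epsilon>'"
  proof (rule one_shot_key_extraction[where \<epsilon> = "2 * trace_dist \<sigma> \<kappa>" and P = "\<lambda>k k'. ?b P k k'", OF m s T])
    show "positive_op d (?b P k k')" if "k < N" "k' < N" for k k'
      by (rule positive_op_eve_block[OF P that])
    have "(\<Sum>k<N. \<Sum>k'<N. rtrace (?b P k k')) = rtrace P"
      unfolding mat_trace_eve_blocks[OF positive_op_carrier[OF P], symmetric] by simp
    also have "mat_trace P = mat_trace P0" unfolding P_def by (rule et(3)[OF P0c])
    finally show "(\<Sum>k<N. \<Sum>k'<N. rtrace (?b P k k')) \<le> 2 * trace_dist \<sigma> \<kappa>"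
      using trPQ mat_trace_positive_op(2)[OF Q0] by simp
    show "2 * trace_dist \<sigma> \<kappa> < \<epsilon>'" using \<epsilon>' unfolding \<kappa>_def .
    show "positive_op d (?b (Z t) k k')" if "t < s" "k < N" "k' < N" for t k k'
      by (rule positive_op_eve_block[OF Z(1)[OF that(1)] that(2,3)])
    show "(\<Sum>k<N. \<Sum>k'<N. rtrace (?b (Z t) k k')) = 1" if "t < s" for t
      using mat_trace_eve_blocks[OF positive_op_carrier[OF Z(1)[OF that]]] Z(2)[OF that]
      by (metis (no_types, lifting) Re_sum one_complex.sel(1) sum.cong)
    show "positive_op d (of_real (real s) \<cdot>\<^sub>m ((if k = k' then T else 0\<^sub>m d d) + ?b P k k')
      - mat_sum d (\<lambda>t. ?b (Z t) k k') {..<s})" if kk: "k < N" "k' < N" for k k'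
    proof -
      have "of_real (real s) \<cdot>\<^sub>m ((if k = k' then T else 0\<^sub>m d d) + ?b P k k')
        - mat_sum d (\<lambda>t. ?b (Z t) k k') {..<s} = of_real (real s) \<cdot>\<^sub>m ?b Q k k'"
        unfolding eq[OF kk] using positive_op_carrier[OF T] carrier_matD[OF bc]
        by (intro eq_matI) (auto simp: algebra_simps)
      then show ?thesis
        using positive_op_smult[OF positive_op_eve_block[OF Q kk], of "real s"] by simp
    qed
  qed
  then obtain t f AA BB where t: "t < s" and f: "\<And>k. k < N \<Longrightarrow> f k < m"
    and AB: "\<forall>a<m. \<forall>b<m. positive_op d (AA a b) \<and> positive_op d (BB a b) \<and>
      AA a b - BB a b = mat_sum d (\<lambda>(k, k'). ?b (Z t) k k') ({k. k < N \<and> f k = a} \<times> {k. k < N \<and> f k = b}) -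
        (if a = b then of_real (1 / real m) \<cdot>\<^sub>m mat_sum d (\<lambda>(k, k'). ?b (Z t) k k') ({..<N} \<times> {..<N})
         else 0\<^sub>m d d)"
    and bound: "(\<Sum>a<m. \<Sum>b<m. rtrace (AA a b) + rtrace (BB a b))
      \<le> sqrt ((real m - 1) * rtrace T * real s) + 2 * sqrt \<epsilon>' + 2 * \<epsilon>'"
    by blast
  \<comment> \<open>Eve's reduced state in the run with seed \<open>t\<close>. Local hashing leaves
    it unchanged, and it is the state of Eve in the new target key.\<close>
  define y where "y = mat_sum d (\<lambda>(k, k'). ?b (Z t) k k') ({..<N} \<times> {..<N})"
  have y: "density_op d y"
  proof -
    have "positive_op d y" unfolding y_def
      using positive_op_eve_block[OF Z(1)[OF t]] by (intro positive_op_mat_sum) auto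
    moreover have "mat_trace y = (\<Sum>p\<in>{..<N} \<times> {..<N}. mat_trace (case p of (k, k') \<Rightarrow> ?b (Z t) k k'))"
      unfolding y_def using bc by (intro mat_trace_mat_sum) auto
    then have "mat_trace y = mat_trace (Z t)"
      unfolding mat_trace_eve_blocks[OF positive_op_carrier[OF Z(1)[OF t]], symmetric]
      by (simp add: sum.cartesian_product case_prod_beta)
    ultimately show ?thesis using Z(2)[OF t] by (simp add: density_op_def)
  qed
  define H where "H X = bob_local (m, N, d) m (hash_channel N m f)
      (alice_local (N, N, d) m (hash_channel N m f) X)" for X
  have H_lopc: "lopc (N, N, d) (m, m, d) H"
  proof -
    have "lopc_step (N, N, d) (m, N, d) (alice_local (N, N, d) m (hash_channel N m f))"
      by (intro lopc_step.alice_local cptp_hash_channel f)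
    moreover have "lopc_step (m, N, d) (m, m, d) (bob_local (m, N, d) m (hash_channel N m f))"
      by (intro lopc_step.bob_local cptp_hash_channel f)
    ultimately show ?thesis
      unfolding H_def[abs_def] by (intro lopc_trans[OF lopc_single lopc_single])
  qed
  define \<Lambda>n where "\<Lambda>n X = H (\<Lambda>t (Y t X))" for X
  have \<Lambda>n: "lopc (dims_power D n) (key_dims M d) \<Lambda>n"
    unfolding Dn key_dims_def m_def[symmetric] \<Lambda>n_def[abs_def]
    by (rule lopc_trans[OF H_lopc lopc_trans[OF \<Lambda>t Y_lopc[OF t]]])
  have out: "\<Lambda>n \<rho>n = H (Z t)" by (simp add: \<Lambda>n_def Z_def)
  have HZ: "positive_op (total_dim (m, m, d)) (H (Z t))"
    using lopc_facts[OF H_lopc, unfolded ptp_map_def] Z(1)[OF t] by blast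
  have pk: "positive_op (total_dim (m, m, d)) (perfect_key M d y)"
    using density_op_perfect_key[OF y, of M] unfolding m_def density_op_def by blast
  note HZc = positive_op_carrier[OF HZ] and pkc = positive_op_carrier[OF pk]
  let ?AA = "block_diagonal (m, m, d) AA" and ?BB = "block_diagonal (m, m, d) BB"
  have AA: "positive_op (total_dim (m, m, d)) ?AA" and BB: "positive_op (total_dim (m, m, d)) ?BB"
    using AB by (auto intro!: block_diagonal_facts(1) simp del: total_dim.simps)
  have diff: "H (Z t) - perfect_key M d y = ?AA - ?BB"
  proof (rule tri_mat_eqI[where D = "(m, m, d)"])
    fix p q assume pq: "p \<in> idx (m, m, d)" "q \<in> idx (m, m, d)"
    obtain a1 b1 e1 a2 b2 e2 where eq: "p = (a1, b1, e1)" "q = (a2, b2, e2)" by (metis prod_cases3)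
    have l: "a1 < m" "b1 < m" "e1 < d" "a2 < m" "b2 < m" "e2 < d" using pq eq by auto
    let ?S = "mat_sum d (\<lambda>(k, k'). ?b (Z t) k k') ({k. k < N \<and> f k = a1} \<times> {k. k < N \<and> f k = b1})"
    have AB1: "AA a1 b1 \<in> carrier_mat d d" "BB a1 b1 \<in> carrier_mat d d"
      "AA a1 b1 - BB a1 b1 = ?S - (if a1 = b1 then of_real (1 / real m) \<cdot>\<^sub>m y else 0\<^sub>m d d)"
      using AB l positive_op_carrier unfolding y_def by auto
    have yc: "y \<in> carrier_mat d d" by (simp add: y_def)
    have "AA a1 b1 $$ (e1, e2) - BB a1 b1 $$ (e1, e2) = (AA a1 b1 - BB a1 b1) $$ (e1, e2)"
      using AB1(1,2) l by simp
    also have "\<dots> = ?S $$ (e1, e2) - (if a1 = b1 then y $$ (e1, e2) / 2 ^ M else 0)"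
      unfolding AB1(3) using l yc by (auto simp: m_def)
    finally have ent: "AA a1 b1 $$ (e1, e2) - BB a1 b1 $$ (e1, e2)
      = ?S $$ (e1, e2) - (if a1 = b1 then y $$ (e1, e2) / 2 ^ M else 0)" .
    have "tri_entry (m, m, d) (H (Z t) - perfect_key M d y) p q
      = (if a1 = a2 \<and> b1 = b2 then ?S $$ (e1, e2) else 0) -
        (if a1 = b1 \<and> a2 = b2 \<and> a1 = a2 then y $$ (e1, e2) / 2 ^ M else 0)"
      unfolding tri_entry_minus[OF HZc pkc pq] unfolding eq H_def tri_entry_hash_channels[OF l]
      using l unfolding m_def by (subst tri_entry_perfect_key) auto
    also have "\<dots> = (if a1 = a2 \<and> b1 = b2 then AA a1 b1 $$ (e1, e2) else 0) -
        (if a1 = a2 \<and> b1 = b2 then BB a1 b1 $$ (e1, e2) else 0)"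
      using ent by auto
    also have "\<dots> = tri_entry (m, m, d) (?AA - ?BB) p q"
      unfolding tri_entry_minus[OF positive_op_carrier[OF AA] positive_op_carrier[OF BB] pq]
      unfolding block_diagonal_def tri_entry_tri_mat[OF pq] unfolding eq by simp
    finally show "tri_entry (m, m, d) (H (Z t) - perfect_key M d y) p q = tri_entry (m, m, d) (?AA - ?BB) p q" .
  qed (use HZc pkc positive_op_carrier[OF AA] positive_op_carrier[OF BB] in
      \<open>auto simp del: total_dim.simps\<close>)
  have "trace_dist (H (Z t)) (perfect_key M d y) \<le> (rtrace ?AA + rtrace ?BB) / 2"
    by (rule trace_dist_le[OF HZc pkc AA BB diff])
  \<comment> \<open>The factor 1/2 of the trace distance is given away.\<close>
  also have "\<dots> \<le> rtrace ?AA + rtrace ?BB"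
    using mat_trace_positive_op(2)[OF AA] mat_trace_positive_op(2)[OF BB] by simp
  also have "\<dots> = (\<Sum>a<m. \<Sum>b<m. rtrace (AA a b) + rtrace (BB a b))"
  proof -
    have "mat_trace ?AA = (\<Sum>a<m. \<Sum>b<m. mat_trace (AA a b))" "mat_trace ?BB = (\<Sum>a<m. \<Sum>b<m. mat_trace (BB a b))"
      using AB by (auto intro!: block_diagonal_facts(2))
    then show ?thesis by (simp add: sum.distrib)
  qed
  also note bound
  also have "(real m - 1) * rtrace T * real s = (2 ^ M - 1) * 2 ^ (l * n) / 2 ^ L"
    unfolding trT by (simp add: m_def N_def s_def k_def power_mult)
  finally have fin: "trace_dist (H (Z t)) (perfect_key M d y)
    \<le> sqrt ((2 ^ M - 1) * 2 ^ (l * n) / 2 ^ L) + 2 * sqrt \<epsilon>' + 2 * \<epsilon>'" .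
  have "0 \<le> trace_dist (H (Z t)) (perfect_key M d y)"
    by (rule trace_dist_nonneg[OF HZc pkc positive_op_hermitian[OF HZ] positive_op_hermitian[OF pk]])
  then show "\<exists>d \<Lambda>' \<tau>. lopc (dims_power D n) (key_dims M d) \<Lambda>' \<and> density_op d \<tau> \<and>
      0 \<le> trace_dist (\<Lambda>' (tri_power D \<rho> n)) (perfect_key M d \<tau>) \<and>
      trace_dist (\<Lambda>' (tri_power D \<rho> n)) (perfect_key M d \<tau>)
        \<le> sqrt ((2 ^ M - 1) * 2 ^ (l * n) / 2 ^ L) + 2 * sqrt \<epsilon>' + 2 * \<epsilon>'"
    using \<Lambda>n y fin unfolding out[symmetric] \<rho>n_def by (intro exI conjI)
qed

theorem corollary5p3:
  fixes D :: dims and \<rho> :: "complex mat"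
    and l dF :: nat and \<tau>F :: "complex mat"
    and out :: "nat \<Rightarrow> dims" and P :: "nat \<Rightarrow> complex mat \<Rightarrow> complex mat"
    and R :: ereal
  assumes "density_op (total_dim D) \<rho>"
    and "density_op dF \<tau>F"
    and "key_distillation_protocol (dims_mult D (key_dims l dF))
           (tri_tensor D (key_dims l dF) \<rho> (perfect_key l dF \<tau>F)) out P R"
  shows "\<exists>out' P' R'. key_distillation_protocol D \<rho> out' P' R' \<and> R' \<ge> R - ereal (real l)"
proof -
  let ?K = "key_dims l dF"
  let ?in = "\<lambda>n. tri_power (dims_mult D ?K) (tri_tensor D ?K \<rho> (perfect_key l dF \<tau>F)) n"
  obtain dA dB dE where D: "D = (dA, dB, dE)" by (cases D)
  obtain L :: "nat \<Rightarrow> nat" and d0 :: "nat \<Rightarrow> nat" and \<tau>0 :: "nat \<Rightarrow> complex mat" where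
    lopc: "\<And>n. lopc (dims_power (dims_mult D ?K) n) (out n) (P n)"
    and out: "\<And>n. out n = key_dims (L n) (d0 n)" and \<tau>0: "\<And>n. density_op (d0 n) (\<tau>0 n)"
    and R: "limsup (\<lambda>n. ereal (real (L n) / real n)) = R"
    and lim: "(\<lambda>n. trace_dist (P n (?in n)) (perfect_key (L n) (d0 n) (\<tau>0 n))) \<longlonglongrightarrow> 0"
    using assms(3) unfolding key_distillation_protocol_def lopc_protocol_def by blast
  define \<delta> where "\<delta> n = trace_dist (P n (?in n)) (perfect_key (L n) (d0 n) (\<tau>0 n))" for n
  \<comment> \<open>The summand \<open>1 / Suc n\<close> makes the bound strict, as
    \<open>key_distillation_without_key\<close> requires, and still tends to zero.\<close>
  define \<epsilon> where "\<epsilon> n = 2 * \<delta> n + 1 / real (Suc n)" for n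
  \<comment> \<open>A square root serves both requirements on the security margin:
    \<open>k n\<close> tends to infinity, so the hashing error vanishes, and \<open>k n / n\<close>
    tends to 0, so the rate does not suffer.\<close>
  define k where "k n = nat \<lfloor>sqrt (real n)\<rfloor>" for n :: nat
  \<comment> \<open>Truncated subtraction: if the old key is too short, the new protocol outputs
    zero bits.\<close>
  define M where "M n = L n - l * n - k n" for n
  have "\<forall>n. \<exists>d \<Lambda>' \<tau>. lopc (dims_power D n) (key_dims (M n) d) \<Lambda>' \<and> density_op d \<tau> \<and>
      0 \<le> trace_dist (\<Lambda>' (tri_power D \<rho> n)) (perfect_key (M n) d \<tau>) \<and>
      trace_dist (\<Lambda>' (tri_power D \<rho> n)) (perfect_key (M n) d \<tau>)
        \<le> sqrt ((2 ^ M n - 1) * 2 ^ (l * n) / 2 ^ L n) + 2 * sqrt (\<epsilon> n) + 2 * \<epsilon> n"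
  proof
    fix n
    have lt: "2 * trace_dist (P n (?in n)) (perfect_key (L n) (d0 n) (\<tau>0 n)) < \<epsilon> n"
      by (simp add: \<epsilon>_def \<delta>_def)
    have lo: "lopc (dims_power (dims_mult (dA, dB, dE) ?K) n) (key_dims (L n) (d0 n)) (P n)"
      using lopc[of n] unfolding out D .
    show "\<exists>d \<Lambda>' \<tau>. lopc (dims_power D n) (key_dims (M n) d) \<Lambda>' \<and> density_op d \<tau> \<and>
      0 \<le> trace_dist (\<Lambda>' (tri_power D \<rho> n)) (perfect_key (M n) d \<tau>) \<and>
      trace_dist (\<Lambda>' (tri_power D \<rho> n)) (perfect_key (M n) d \<tau>)
        \<le> sqrt ((2 ^ M n - 1) * 2 ^ (l * n) / 2 ^ L n) + 2 * sqrt (\<epsilon> n) + 2 * \<epsilon> n"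
      using key_distillation_without_key(2)[OF assms(1)[unfolded D] assms(2) lo \<tau>0 lt[unfolded D], of "M n"]
      unfolding D .
  qed
  then obtain d P' \<tau> where P': "\<And>n. lopc (dims_power D n) (key_dims (M n) (d n)) (P' n)"
    and \<tau>: "\<And>n. density_op (d n) (\<tau> n)"
    and nonneg: "\<And>n. 0 \<le> trace_dist (P' n (tri_power D \<rho> n)) (perfect_key (M n) (d n) (\<tau> n))"
    and bound: "\<And>n. trace_dist (P' n (tri_power D \<rho> n)) (perfect_key (M n) (d n) (\<tau> n))
        \<le> sqrt ((2 ^ M n - 1) * 2 ^ (l * n) / 2 ^ L n) + 2 * sqrt (\<epsilon> n) + 2 * \<epsilon> n"
    unfolding choice_iff by blast
  have "\<epsilon> \<longlonglongrightarrow> 2 * 0 + 0"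
    unfolding \<epsilon>_def using lim LIMSEQ_inverse_real_of_nat
    by (intro tendsto_intros) (simp_all add: \<delta>_def inverse_eq_divide)
  then have \<epsilon>: "\<epsilon> \<longlonglongrightarrow> 0" by simp
  \<comment> \<open>For \<open>M n = 0\<close> the factor \<open>2 ^ M n - 1\<close> is zero, so
    block lengths with truncated \<open>M n\<close> need no estimate in terms of
    \<open>L n\<close>.\<close>
  have hash: "sqrt ((2 ^ M n - 1) * 2 ^ (l * n) / 2 ^ L n) \<le> sqrt ((1 / 2) ^ k n)" for n
  proof (cases "M n = 0")
    case False
    then have L: "L n = M n + l * n + k n" by (simp add: M_def)
    have "(2 ^ M n - 1) * 2 ^ (l * n) / 2 ^ L n \<le> (2 ^ M n * 2 ^ (l * n) / 2 ^ L n :: real)"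
      by (intro divide_right_mono mult_right_mono) auto
    also have "\<dots> = (1 / 2) ^ k n" by (simp add: L power_add power_one_over field_simps)
    finally show ?thesis by (rule real_sqrt_le_mono)
  qed simp
  have k_top: "filterlim k at_top sequentially" unfolding k_def by real_asymp
  have k_small: "(\<lambda>n. real (k n) / real n) \<longlonglongrightarrow> 0" unfolding k_def by real_asymp
  have "(\<lambda>n. (1 / 2 :: real) ^ k n) \<longlonglongrightarrow> 0"
    using filterlim_compose[OF LIMSEQ_power_zero k_top, of "1 / 2 :: real"] by simp
  from tendsto_real_sqrt[OF this] have hash_lim: "(\<lambda>n. sqrt ((1 / 2) ^ k n)) \<longlonglongrightarrow> 0" by simp
  have "(\<lambda>n. sqrt ((1 / 2) ^ k n) + 2 * sqrt (\<epsilon> n) + 2 * \<epsilon> n) \<longlonglongrightarrow> 0 + 2 * sqrt 0 + 2 * 0"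
    by (intro tendsto_intros hash_lim \<epsilon>)
  then have upper: "(\<lambda>n. sqrt ((1 / 2) ^ k n) + 2 * sqrt (\<epsilon> n) + 2 * \<epsilon> n) \<longlonglongrightarrow> 0" by simp
  have conv: "(\<lambda>n. trace_dist (P' n (tri_power D \<rho> n)) (perfect_key (M n) (d n) (\<tau> n))) \<longlonglongrightarrow> 0"
    by (rule tendsto_sandwich[OF _ _ tendsto_const upper])
      (simp_all add: nonneg order_trans[OF bound add_right_mono[OF add_right_mono[OF hash]]])
  define R' where "R' = limsup (\<lambda>n. ereal (real (M n) / real n))"
  have "key_distillation_protocol D \<rho> (\<lambda>n. key_dims (M n) (d n)) P' R'"
    unfolding key_distillation_protocol_def lopc_protocol_def
    using P' \<tau> conv unfolding R'_def by blast
  moreover have "R - ereal (real l) \<le> R'"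
  proof -
    have le: "ereal (real (L n) / real n) \<le> ereal (real l + real (k n) / real n) + ereal (real (M n) / real n)" for n
    proof -
      have "L n \<le> M n + l * n + k n" by (simp add: M_def)
      then have "real (L n) \<le> real (M n) + real l * real n + real (k n)"
        by (metis of_nat_add of_nat_le_iff of_nat_mult)
      then have "real (L n) / real n \<le> (real (M n) + real l * real n + real (k n)) / real n"
        by (rule divide_right_mono) simp
      \<comment> \<open>For \<open>n = 0\<close> all quotients are 0 by convention, and only the
        inequality holds.\<close>
      also have "\<dots> \<le> real (M n) / real n + real l + real (k n) / real n"
        by (cases "n = 0") (simp_all add: add_divide_distrib)
      finally show ?thesis by simp
    qed
    have "(\<lambda>n. ereal (real l + real (k n) / real n)) \<longlonglongrightarrow> ereal (real l + 0)"
      by (intro tendsto_intros k_small)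
    then have lim_l: "(\<lambda>n. ereal (real l + real (k n) / real n)) \<longlonglongrightarrow> ereal (real l)" by simp
    have "R \<le> limsup (\<lambda>n. ereal (real l + real (k n) / real n) + ereal (real (M n) / real n))"
      unfolding R[symmetric] by (intro Limsup_mono always_eventually allI le)
    \<comment> \<open>One summand converges to a finite limit, so the limes superior splits
      additively even if the rates are infinite.\<close>
    also have "\<dots> = ereal (real l) + R'"
      unfolding R'_def by (rule ereal_limsup_lim_add[OF lim_l]) simp
    finally show ?thesis by (simp add: ereal_minus_le_iff add.commute)
  qed
  ultimately show ?thesis by blast
qed

end
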